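(* Let $H$ and $U$ be two complex Hilbert spaces. Let $A:D(A)\subset H\longrightarrow H$ be the generator of a $C_0$-semigroup on $H$ and let $B\in\mathcal{L}(U,D(A^* )')$ be admissible for $A$. For $T\ge 0$ let $\Phi_T\in\mathcal{L}(L^2(0,+\infty;U),H)$ be the input map of $(A,B)$. Assume that there exist a complex Banach space $V$ and a compact operator $P\in\mathcal{L}(H,V)$ such that, for some $T_0>0$ and $\alpha>0$, $$\alpha\|z\|_H^2\le\int_0^{T_0}\|\Phi_{T_0}^*z(t)\|_U^2\,dt+\|Pz\|_V^2,\qquad\forall z\in H.$$ Let $$\sigma_F=\{\lambda\in\mathbb{C} : \ker(\lambda-A^* )\cap\ker B^*\neq\{0\}\},$$ and for every $\lambda\in\mathbb{C}$ let $$E_\lambda=\Big\{z\in\bigcup_{m=1}^{+\infty}\ker(\lambda-A^* )^m : B^*(\lambda-A^* )^m z=0\ \text{ for all } m\in\mathbb{N}\Big\}.$$ Then the set $\sigma_F$ is finite, the subspace $E_\lambda$ is finite dimensional for every $\lambda\in\mathbb{C}$, and $$\mathrm{Im}\,\Phi_T=\Big(\bigoplus_{\lambda\in\sigma_F}E_\lambda\Big)^{\perp},\qquad\forall T>T_0.$$ In particular, $(A,B)$ is exactly controllable in time $T$ for every $T>T_0$ if $(A,B)$ satisfies the Fattorini-Hautus test, i.e. if $\ker(\lambda-A^* )\cap\ker B^*=\{0\}$ for all $\lambda\in\mathbb{C}$.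
   Context: Let $H,U$ be Hilbert spaces, $A:D(A)\subset H\to H$ the generator of a $C_0$-semigroup $(S_A(t))_{t\ge 0}$ on $H$, and $B\in\mathcal{L}(U,D(A^* )')$, where $D(A^* )$ carries the graph norm and $D(A^* )'$ is its dual with respect to the pivot space $H$ (so $D(A^* )\subset H\subset D(A^* )'$, and $S_A(t)$ extends to a $C_0$-semigroup on $D(A^* )'$). The adjoint of $B$ is $B^*\in\mathcal{L}(D(A^* ),U)$. For $T\ge 0$ the input map $\Phi_T\in\mathcal{L}(L^2(0,+\infty;U),D(A^* )')$ of $(A,B)$ is $\Phi_T u=\int_0^T S_A(T-s)Bu(s)\,ds$. The operator $B$ is admissible for $A$ if $\mathrm{Im}\,\Phi_T\subset H$ for some (equivalently all) $T>0$; then $\Phi_T\in\mathcal{L}(L^2(0,+\infty;U),H)$, and its adjoint $\Phi_T^*\in\mathcal{L}(H,L^2(0,+\infty;U))$ is the unique continuous linear extension to $H$ of the map $z\in D(A^* )\mapsto B^*S_A(T-\cdot)^*z$, extended by zero outside $(0,T)$. For $B$ admissible, the system $\frac{d}{dt}y=Ay+Bu$ on $(0,T)$, $y(0)=y^0\in H$, with $u\in L^2(0,T;U)$, has the unique solution $y\in C^0([0,T];H)$ given by $y(t)=S_A(t)y^0+\Phi_t u$. $(A,B)$ is exactly controllable in time $T>0$ if for every $y^0,y^1\in H$ there is $u\in L^2(0,T;U)$ with $y(T)=y^1$. Here $\mathbb{N}$ contains $0$; the direct sum over an empty set is $\{0\}$; $\perp$ denotes the orthogonal complement in $H$. *)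

theory Defs
  imports "HOL-Analysis.Analysis"
begin

section \<open>Complex Banach and Hilbert spaces\<close>

class complex_normed_vector = real_normed_vector +
  fixes scaleC :: "complex \<Rightarrow> 'a \<Rightarrow> 'a" (infixr \<open>*\<^sub>C\<close> 75)
  assumes scaleC_add_right: "a *\<^sub>C (x + y) = a *\<^sub>C x + a *\<^sub>C y"
    and scaleC_add_left: "(a + b) *\<^sub>C x = a *\<^sub>C x + b *\<^sub>C x"
    and scaleC_scaleC: "a *\<^sub>C (b *\<^sub>C x) = (a * b) *\<^sub>C x"
    and scaleR_scaleC: "r *\<^sub>R x = complex_of_real r *\<^sub>C x"
    and norm_scaleC: "norm (a *\<^sub>C x) = cmod a * norm x"

class complex_banach = complex_normed_vector + complete_space

text \<open>The inner product is linear in the first argument. The underlying real inner product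
  is its real part, so that \<open>norm x ^ 2 = Re (cinner x x)\<close>; and \<open>cinner x x\<close> is real by
  conjugate symmetry. No separability is required.\<close>

class complex_hilbert = complex_banach + real_inner +
  fixes cinner :: "'a \<Rightarrow> 'a \<Rightarrow> complex"
  assumes cinner_commute: "cinner x y = cnj (cinner y x)"
    and cinner_add_left: "cinner (x + y) z = cinner x z + cinner y z"
    and cinner_scaleC_left: "cinner (a *\<^sub>C x) y = a * cinner x y"
    and Re_cinner: "Re (cinner x y) = inner x y"

instantiation complex :: complex_hilbert
begin

definition "scaleC_complex = ((*) :: complex \<Rightarrow> complex \<Rightarrow> complex)"
definition "cinner_complex x y = x * cnj (y :: complex)"

instance
  by standard
    (auto simp: scaleC_complex_def cinner_complex_def algebra_simps norm_mult
      inner_complex_def scaleR_conv_of_real)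

end

global_interpretation complex_vector:
  vector_space "scaleC :: complex \<Rightarrow> 'a \<Rightarrow> 'a::complex_normed_vector"
  defines cspan = complex_vector.span
proof
  fix x :: 'a
  show "1 *\<^sub>C x = x"
    using scaleR_scaleC[of 1 x] by simp
qed (simp_all add: scaleC_add_right scaleC_add_left scaleC_scaleC)

definition bounded_clinear ::
    "('a::complex_normed_vector \<Rightarrow> 'b::complex_normed_vector) \<Rightarrow> bool" where
  "bounded_clinear f \<longleftrightarrow> bounded_linear f \<and> (\<forall>c x. f (c *\<^sub>C x) = c *\<^sub>C f x)"

definition compact_operator ::
    "('a::complex_normed_vector \<Rightarrow> 'b::complex_normed_vector) \<Rightarrow> bool" where
  "compact_operator P \<longleftrightarrow> bounded_clinear P \<and> compact (closure (P ` cball 0 1))"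

definition orth_compl :: "'a::complex_hilbert set \<Rightarrow> 'a set" where
  "orth_compl W = {x. \<forall>y\<in>W. cinner x y = 0}"

definition finite_dimensional :: "'a::complex_normed_vector set \<Rightarrow> bool" where
  "finite_dimensional W \<longleftrightarrow> (\<exists>b. finite b \<and> W = cspan b)"

text \<open>The algebraic sum of a family of subspaces, and its directness. The sum over the empty
  family is \<open>{0}\<close>.\<close>

definition subspace_sum :: "'i set \<Rightarrow> ('i \<Rightarrow> 'a::complex_normed_vector set) \<Rightarrow> 'a set" where
  "subspace_sum J E = {(\<Sum>i\<in>F. z i) | F z. finite F \<and> F \<subseteq> J \<and> (\<forall>i\<in>F. z i \<in> E i)}"

definition sum_is_direct :: "'i set \<Rightarrow> ('i \<Rightarrow> 'a::complex_normed_vector set) \<Rightarrow> bool" where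
  "sum_is_direct J E \<longleftrightarrow>
     (\<forall>F z. finite F \<and> F \<subseteq> J \<and> (\<forall>i\<in>F. z i \<in> E i) \<and> (\<Sum>i\<in>F. z i) = 0 \<longrightarrow> (\<forall>i\<in>F. z i = 0))"

section \<open>Unbounded operators, adjoints and semigroups\<close>

text \<open>An unbounded operator is a partial map; \<open>dom A\<close> is its domain \<open>D(A)\<close>, and \<open>\<circ>\<^sub>m\<close> is the
  composition with its natural domain.\<close>

definition ker :: "('a \<rightharpoonup> 'b::zero) \<Rightarrow> 'a set" where
  "ker R = {z. R z = Some 0}"

primrec op_power :: "('a \<rightharpoonup> 'a) \<Rightarrow> nat \<Rightarrow> ('a \<rightharpoonup> 'a)" where
  "op_power R 0 = Some"
| "op_power R (Suc m) = R \<circ>\<^sub>m op_power R m"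

definition shift_op :: "complex \<Rightarrow> ('a::complex_normed_vector \<rightharpoonup> 'a) \<Rightarrow> ('a \<rightharpoonup> 'a)" where
  "shift_op c A = (\<lambda>z. map_option (\<lambda>w. c *\<^sub>C z - w) (A z))"

text \<open>The \<open>THE\<close> below is well defined when \<open>dom A\<close> is dense, as it is for a generator.\<close>

definition adj :: "('a::complex_hilbert \<rightharpoonup> 'b::complex_hilbert) \<Rightarrow> ('b \<rightharpoonup> 'a)" where
  "adj A = (\<lambda>z. if \<exists>w. \<forall>x\<in>dom A. cinner (the (A x)) z = cinner x w
                then Some (THE w. \<forall>x\<in>dom A. cinner (the (A x)) z = cinner x w) else None)"

definition bounded_adj ::
    "('a::complex_hilbert \<Rightarrow> 'b::complex_hilbert) \<Rightarrow> 'b \<Rightarrow> 'a" where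
  "bounded_adj f z = (THE w. \<forall>x. cinner (f x) z = cinner x w)"

definition C0_semigroup :: "(real \<Rightarrow> 'a::complex_banach \<Rightarrow> 'a) \<Rightarrow> bool" where
  "C0_semigroup S \<longleftrightarrow>
     (\<forall>t\<ge>0. bounded_clinear (S t)) \<and>
     (\<forall>x. S 0 x = x) \<and>
     (\<forall>s\<ge>0. \<forall>t\<ge>0. \<forall>x. S (s + t) x = S s (S t x)) \<and>
     (\<forall>x. ((\<lambda>t. S t x) \<longlongrightarrow> x) (at_right 0))"

definition generator :: "(real \<Rightarrow> 'a::complex_banach \<Rightarrow> 'a) \<Rightarrow> ('a \<rightharpoonup> 'a)" where
  "generator S = (\<lambda>x.
     if \<exists>y. ((\<lambda>t. (S t x - x) /\<^sub>R t) \<longlongrightarrow> y) (at_right 0)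
     then Some (Lim (at_right 0) (\<lambda>t. (S t x - x) /\<^sub>R t)) else None)"

section \<open>The spaces \<open>D(A\<^sup>*)'\<close> and \<open>L\<^sup>2\<close>\<close>

text \<open>Elements of \<open>D(A\<^sup>*)'\<close> are the antilinear functionals on \<open>D(A\<^sup>*)\<close> that are bounded for the
  graph norm, so that the pivot embedding \<open>h \<mapsto> \<langle>h, _\<rangle>\<close> of \<open>H\<close> is linear. They are set to \<open>0\<close>
  outside \<open>D(A\<^sup>*)\<close>, so that they are equal as functions iff they agree on \<open>D(A\<^sup>*)\<close>.\<close>

definition graph_norm :: "('a::complex_normed_vector \<rightharpoonup> 'a) \<Rightarrow> 'a \<Rightarrow> real" where
  "graph_norm A z = sqrt ((norm z)\<^sup>2 + (norm (the (A z)))\<^sup>2)"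

definition dual_dom_adj :: "('h::complex_hilbert \<rightharpoonup> 'h) \<Rightarrow> ('h \<Rightarrow> complex) set" where
  "dual_dom_adj A = {l.
     (\<forall>z\<in>dom (adj A). \<forall>w\<in>dom (adj A). l (z + w) = l z + l w) \<and>
     (\<forall>c. \<forall>z\<in>dom (adj A). l (c *\<^sub>C z) = cnj c * l z) \<and>
     (\<exists>K. \<forall>z\<in>dom (adj A). cmod (l z) \<le> K * graph_norm (adj A) z) \<and>
     (\<forall>z. z \<notin> dom (adj A) \<longrightarrow> l z = 0)}"

definition pivot_embed :: "('h::complex_hilbert \<rightharpoonup> 'h) \<Rightarrow> 'h \<Rightarrow> ('h \<Rightarrow> complex)" where
  "pivot_embed A h = (\<lambda>z. if z \<in> dom (adj A) then cinner h z else 0)"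

text \<open>The extension of \<open>S\<^sub>A(t)\<close> to \<open>D(A\<^sup>*)'\<close> is the transpose of \<open>S\<^sub>A(t)\<^sup>*\<close> acting on \<open>D(A\<^sup>*)\<close>.\<close>

definition semigroup_ext ::
    "('h::complex_hilbert \<rightharpoonup> 'h) \<Rightarrow> (real \<Rightarrow> 'h \<Rightarrow> 'h) \<Rightarrow> real \<Rightarrow> ('h \<Rightarrow> complex) \<Rightarrow> ('h \<Rightarrow> complex)" where
  "semigroup_ext A S t l = (\<lambda>z. if z \<in> dom (adj A) then l (bounded_adj (S t) z) else 0)"

text \<open>\<open>B \<in> L(U, D(A\<^sup>*)')\<close>.\<close>

definition control_operator ::
    "('h::complex_hilbert \<rightharpoonup> 'h) \<Rightarrow> ('u::complex_hilbert \<Rightarrow> 'h \<Rightarrow> complex) \<Rightarrow> bool" where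
  "control_operator A B \<longleftrightarrow>
     (\<forall>u. B u \<in> dual_dom_adj A) \<and>
     (\<forall>u v z. B (u + v) z = B u z + B v z) \<and>
     (\<forall>c u z. B (c *\<^sub>C u) z = c * B u z) \<and>
     (\<exists>K. \<forall>u. \<forall>z\<in>dom (adj A). cmod (B u z) \<le> K * norm u * graph_norm (adj A) z)"

text \<open>\<open>B\<^sup>*\<close> as an unbounded operator from \<open>H\<close> to \<open>U\<close> with domain \<open>D(A\<^sup>*)\<close>.\<close>

definition control_adj ::
    "('h::complex_hilbert \<rightharpoonup> 'h) \<Rightarrow> ('u::complex_hilbert \<Rightarrow> 'h \<Rightarrow> complex) \<Rightarrow> ('h \<rightharpoonup> 'u)" where
  "control_adj A B = (\<lambda>z. if z \<in> dom (adj A) then Some (THE w. \<forall>u. B u z = cinner u w) else None)"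

text \<open>Since \<open>U\<close> need not be separable, measurability of \<open>U\<close>-valued functions means strong
  (Bochner) measurability. Members of \<open>L2 I\<close> are functions, not classes modulo null sets.\<close>

definition strongly_measurable :: "'a measure \<Rightarrow> ('a \<Rightarrow> 'b::topological_space) \<Rightarrow> bool" where
  "strongly_measurable M f \<longleftrightarrow>
     (\<exists>s. (\<forall>n. simple_function M (s n)) \<and> (AE x in M. (\<lambda>n::nat. s n x) \<longlonglongrightarrow> f x))"

definition L2 :: "real set \<Rightarrow> (real \<Rightarrow> 'u::real_normed_vector) set" where
  "L2 I = {u. strongly_measurable (lebesgue_on I) u \<and>
              integrable (lebesgue_on I) (\<lambda>t. (norm (u t))\<^sup>2)}"

section \<open>Input map, admissibility and controllability\<close>

text \<open>\<open>\<Phi>\<^sub>T u\<close> as an element of \<open>D(A\<^sup>*)'\<close>. The integral of a \<open>D(A\<^sup>*)'\<close>-valued function is the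
  functional obtained by integrating its values at each \<open>z \<in> D(A\<^sup>*)\<close>.\<close>

definition input_functional ::
    "('h::complex_hilbert \<rightharpoonup> 'h) \<Rightarrow> (real \<Rightarrow> 'h \<Rightarrow> 'h) \<Rightarrow> ('u::complex_hilbert \<Rightarrow> 'h \<Rightarrow> complex) \<Rightarrow>
     real \<Rightarrow> (real \<Rightarrow> 'u) \<Rightarrow> ('h \<Rightarrow> complex)" where
  "input_functional A S B T u =
     (\<lambda>z. LINT s|lebesgue_on {0<..<T}. semigroup_ext A S (T - s) (B (u s)) z)"

definition admissible ::
    "('h::complex_hilbert \<rightharpoonup> 'h) \<Rightarrow> (real \<Rightarrow> 'h \<Rightarrow> 'h) \<Rightarrow> ('u::complex_hilbert \<Rightarrow> 'h \<Rightarrow> complex) \<Rightarrow> bool" where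
  "admissible A S B \<longleftrightarrow>
     (\<exists>T>0. input_functional A S B T ` L2 {0<..} \<subseteq> range (pivot_embed A))"

text \<open>For admissible \<open>B\<close>, the input map with values in \<open>H\<close>; the pivot embedding is injective
  when \<open>D(A\<^sup>*)\<close> is dense.\<close>

definition input_map ::
    "('h::complex_hilbert \<rightharpoonup> 'h) \<Rightarrow> (real \<Rightarrow> 'h \<Rightarrow> 'h) \<Rightarrow> ('u::complex_hilbert \<Rightarrow> 'h \<Rightarrow> complex) \<Rightarrow>
     real \<Rightarrow> (real \<Rightarrow> 'u) \<Rightarrow> 'h" where
  "input_map A S B T u = (THE h. pivot_embed A h = input_functional A S B T u)"

text \<open>The Hilbert space adjoint \<open>\<Phi>\<^sub>T\<^sup>* : H \<rightarrow> L\<^sup>2(0, +\<infinity>; U)\<close>; each value is determined up to a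
  null set, and \<open>SOME\<close> picks a representative.\<close>

definition input_map_adj ::
    "('h::complex_hilbert \<rightharpoonup> 'h) \<Rightarrow> (real \<Rightarrow> 'h \<Rightarrow> 'h) \<Rightarrow> ('u::complex_hilbert \<Rightarrow> 'h \<Rightarrow> complex) \<Rightarrow>
     real \<Rightarrow> 'h \<Rightarrow> (real \<Rightarrow> 'u)" where
  "input_map_adj A S B T z = (SOME v. v \<in> L2 {0<..} \<and>
     (\<forall>u\<in>L2 {0<..}.
        cinner (input_map A S B T u) z = (LINT t|lebesgue_on {0<..}. cinner (u t) (v t))))"

definition trajectory ::
    "('h::complex_hilbert \<rightharpoonup> 'h) \<Rightarrow> (real \<Rightarrow> 'h \<Rightarrow> 'h) \<Rightarrow> ('u::complex_hilbert \<Rightarrow> 'h \<Rightarrow> complex) \<Rightarrow>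
     'h \<Rightarrow> (real \<Rightarrow> 'u) \<Rightarrow> real \<Rightarrow> 'h" where
  "trajectory A S B y0 u t = S t y0 + input_map A S B t u"

text \<open>A control in \<open>L\<^sup>2(0, T; U)\<close> is extended by zero to \<open>(0, +\<infinity>)\<close>.\<close>

definition exactly_controllable ::
    "('h::complex_hilbert \<rightharpoonup> 'h) \<Rightarrow> (real \<Rightarrow> 'h \<Rightarrow> 'h) \<Rightarrow> ('u::complex_hilbert \<Rightarrow> 'h \<Rightarrow> complex) \<Rightarrow>
     real \<Rightarrow> bool" where
  "exactly_controllable A S B T \<longleftrightarrow>
     (\<forall>y0 y1. \<exists>u\<in>L2 {0<..<T}.
        trajectory A S B y0 (\<lambda>s. if s \<in> {0<..<T} then u s else 0) T = y1)"

definition sigma_F ::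
    "('h::complex_hilbert \<rightharpoonup> 'h) \<Rightarrow> ('u::complex_hilbert \<Rightarrow> 'h \<Rightarrow> complex) \<Rightarrow> complex set" where
  "sigma_F A B = {c. ker (shift_op c (adj A)) \<inter> ker (control_adj A B) \<noteq> {0}}"

definition E_space ::
    "('h::complex_hilbert \<rightharpoonup> 'h) \<Rightarrow> ('u::complex_hilbert \<Rightarrow> 'h \<Rightarrow> complex) \<Rightarrow> complex \<Rightarrow> 'h set" where
  "E_space A B c =
     {z \<in> (\<Union>m\<in>{1..}. ker (op_power (shift_op c (adj A)) m)).
        \<forall>m. (control_adj A B \<circ>\<^sub>m op_power (shift_op c (adj A)) m) z = Some 0}"

end

theory Submission
  imports Defs "HOL-Computational_Algebra.Fundamental_Theorem_Algebra"
begin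

text \<open>Let \<open>C = B\<^sup>*\<close> and let \<open>R t = S\<^sub>A(t)\<^sup>*\<close>, which on a Hilbert space is again a strongly continuous
semigroup, generated by \<open>A\<^sup>*\<close> (\<open>generator_R\<close>). For \<open>z \<in> D(A\<^sup>*)\<close> the function \<open>\<Phi>\<^sub>T\<^sup>* z\<close> is the output
\<open>C (R (T - \<cdot>) z)\<close>, which is continuous; write \<open>energy T z\<close> for its squared \<open>L\<^sup>2\<close> norm. All arguments
take place on the dense subspace \<open>D(A\<^sup>*)\<close>, where the hypothesis reads
\<open>\<alpha> \<parallel>z\<parallel>\<^sup>2 \<le> energy T0 z + \<parallel>P z\<parallel>\<^sup>2\<close>.

Duality. A state \<open>y\<close> is reached at time \<open>T\<close> if \<open>\<bar>\<langle>y, z\<rangle>\<bar>\<^sup>2 \<le> K energy T z\<close> on \<open>D(A\<^sup>*)\<close>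
(\<open>steers_if_energy_bound\<close>): minimise \<open>energy T z - 2 \<langle>y, z\<rangle>\<close>; the outputs of a minimising sequence
converge in \<open>L\<^sup>2\<close> to a control that steers to \<open>y\<close>. Conversely the reachable states make the output
map closable (\<open>output_closable\<close>), so that a state in \<open>D(A\<^sup>*)\<close> that is approximated by states with
vanishing energy has no output at all.

The kernel. Let \<open>output_kernel T\<close>, the kernel of \<open>\<Phi>\<^sub>T\<^sup>*\<close>, consist of the limits of states whose
energy up to time \<open>T\<close> tends to \<open>0\<close>. On \<open>output_kernel T0\<close> the operator \<open>P\<close> is bounded below; as \<open>P\<close> is
compact, this space has finite dimension. The spaces decrease with \<open>T\<close>, and \<open>R h\<close> maps
\<open>output_kernel (T + h)\<close> into \<open>output_kernel T\<close>. To the left of any \<open>T > T0\<close> there is an interval on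
which the dimension is constant; there the kernel is invariant under \<open>R\<close>. A finite dimensional
invariant space lies in \<open>D(A\<^sup>*)\<close>, and so the kernel is the space of the \<open>z \<in> D(A\<^sup>*)\<close> without any
output at any time, for every \<open>T > T0\<close> (\<open>output_kernel_eq_unobservable\<close>). Compactness of \<open>P\<close> once
more gives \<open>\<parallel>z\<parallel>\<^sup>2 \<le> c energy T z\<close> on the orthogonal complement of this space, and duality shows that
the range of \<open>\<Phi>\<^sub>T\<close> is exactly that complement (\<open>input_map_range\<close>).

The spectrum. On the unobservable space \<open>A\<^sup>*\<close> is a linear map of a complex vector space of finite
dimension and \<open>C\<close> vanishes. Conversely every element of \<open>E\<^sub>\<lambda>\<close> is unobservable, because the orbit of a
generalised eigenvector stays in the span of its images under \<open>\<lambda> - A\<^sup>*\<close>. Hence the spaces \<open>E\<^sub>\<lambda>\<close> are the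
generalised eigenspaces of \<open>A\<^sup>*\<close> on the unobservable space, \<open>\<sigma>\<^sub>F\<close> is the set of its eigenvalues, and
the assertions on \<open>\<sigma>\<^sub>F\<close> and \<open>E\<^sub>\<lambda>\<close> are the decomposition of a finite dimensional complex vector space
into generalised eigenspaces (\<open>unobservable_decomposition\<close>).\<close>

section \<open>Complex Hilbert spaces\<close>

lemma cinner_scaleC_right: "cinner x (c *\<^sub>C y) = cnj c * cinner x y"
  by (metis cinner_commute cinner_scaleC_left complex_cnj_mult)

lemma cinner_eq_Complex: "cinner x y = Complex (inner x y) (inner x (\<i> *\<^sub>C y))"
proof (rule complex_eqI)
  have "inner x (\<i> *\<^sub>C y) = Re (cnj \<i> * cinner x y)"
    by (metis Re_cinner cinner_scaleC_right)
  then show "Im (cinner x y) = Im (Complex (inner x y) (inner x (\<i> *\<^sub>C y)))" by simp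
qed (simp add: Re_cinner)

lemma cinner_add_right: "cinner x (y + z) = cinner x y + cinner x z"
  by (metis cinner_add_left cinner_commute complex_cnj_add)

lemma scaleC_minus_one: "(-1) *\<^sub>C x = - x"
  by (metis complex_vector.scale_minus_left complex_vector.scale_one)

lemma scaleC_diff_right: "c *\<^sub>C (x - y) = c *\<^sub>C x - c *\<^sub>C (y::'a::complex_normed_vector)"
  by (rule complex_vector.scale_right_diff_distrib)

lemma cinner_zero_left [simp]: "cinner 0 y = 0"
  by (metis cinner_scaleC_left mult_zero_left complex_vector.scale_zero_left)

lemma cinner_zero_right [simp]: "cinner x 0 = 0"
  by (metis cinner_commute cinner_zero_left complex_cnj_zero)

lemma cinner_minus_left: "cinner (- x) y = - cinner x y"
  by (metis cinner_scaleC_left mult_minus1 scaleC_minus_one)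

lemma cinner_minus_right: "cinner x (- y) = - cinner x y"
  by (metis cinner_minus_left cinner_commute complex_cnj_minus)

lemma cinner_diff_left: "cinner (x - y) z = cinner x z - cinner y z"
  using cinner_add_left[of x "-y" z] by (simp add: cinner_minus_left)

lemma cinner_diff_right: "cinner x (y - z) = cinner x y - cinner x z"
  using cinner_add_right[of x y "-z"] by (simp add: cinner_minus_right)

lemma cinner_sum_left: "cinner (\<Sum>i\<in>F. f i) y = (\<Sum>i\<in>F. cinner (f i) y)"
  by (induction F rule: infinite_finite_induct) (auto simp: cinner_add_left)

lemma cinner_self: "cinner x x = complex_of_real ((norm x)\<^sup>2)"
proof -
  have "Im (cinner x x) = 0"
    by (metis cinner_commute cnj.simps(2) equal_neg_zero)
  then show ?thesis
    by (simp add: complex_eq_iff Re_cinner power2_norm_eq_inner)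
qed

lemma cinner_self_eq_zero [simp]: "cinner x x = 0 \<longleftrightarrow> x = 0"
  by (simp add: cinner_self)

lemma norm_cinner_le: "cmod (cinner x y) \<le> norm x * norm y"
proof (cases "cinner x y = 0")
  case False
  define c where "c = cnj (cinner x y) / cmod (cinner x y)"
  have c: "cmod c = 1" using False by (simp add: c_def norm_divide)
  have "c * cinner x y = complex_of_real (cmod (cinner x y))"
  proof -
    have "cnj (cinner x y) * cinner x y = complex_of_real (cmod (cinner x y)) * cmod (cinner x y)"
      using complex_norm_square[of "cinner x y"] by (simp only: power2_eq_square mult.commute of_real_mult)
    then show ?thesis using False by (simp add: c_def)
  qed
  then have "cmod (cinner x y) = inner (c *\<^sub>C x) y"
    by (metis Re_cinner Re_complex_of_real cinner_scaleC_left)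
  also have "\<dots> \<le> norm (c *\<^sub>C x) * norm y" by (rule norm_cauchy_schwarz)
  finally show ?thesis by (simp add: norm_scaleC c)
qed simp

lemma bounded_bilinear_cinner: "bounded_bilinear (cinner :: 'a::complex_hilbert \<Rightarrow> 'a \<Rightarrow> complex)"
proof
  fix r :: real and a b :: 'a
  show "cinner (r *\<^sub>R a) b = r *\<^sub>R cinner a b"
    by (simp add: scaleR_scaleC cinner_scaleC_left scaleC_complex_def)
  show "cinner a (r *\<^sub>R b) = r *\<^sub>R cinner a b"
    by (simp add: scaleR_scaleC cinner_scaleC_right scaleC_complex_def)
  show "\<exists>K. \<forall>a b. norm (cinner a b) \<le> norm (a::'a) * norm b * K"
    by (rule exI[of _ 1]) (simp add: norm_cinner_le)
qed (simp_all add: cinner_add_left cinner_add_right)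

lemmas tendsto_cinner = bounded_bilinear.tendsto[OF bounded_bilinear_cinner]
lemmas continuous_on_cinner = bounded_bilinear.continuous_on[OF bounded_bilinear_cinner]

lemma bounded_linear_scaleC: "bounded_linear (\<lambda>x::'a::complex_normed_vector. c *\<^sub>C x)"
  by (rule bounded_linear_intro[of _ "cmod c"])
    (simp_all add: scaleC_add_right scaleR_scaleC scaleC_scaleC norm_scaleC mult.commute)

lemmas tendsto_scaleC = bounded_linear.tendsto[OF bounded_linear_scaleC]

lemma cinner_eqI:
  assumes "\<And>x. inner x z = inner x w"
  shows "z = (w::'a::complex_hilbert)"
  using assms[of "z - w"] by (metis inner_diff_right inner_eq_zero_iff eq_iff_diff_eq_0)

lemma complex_subspace_imp_real:
  "complex_vector.subspace (M::'a::complex_normed_vector set) \<Longrightarrow> subspace M"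
  by (simp add: complex_vector.subspace_def subspace_def scaleR_scaleC)

text \<open>An antilinear functional satisfies \<open>Im (f z) = Re (f (\<i> z))\<close>, so that its real part determines it.\<close>

lemma cinner_eq_if_Re_eq:
  assumes "\<And>z. z \<in> D \<Longrightarrow> inner h z = Re (f z)" "\<And>z. z \<in> D \<Longrightarrow> \<i> *\<^sub>C z \<in> D"
    and "\<And>z. z \<in> D \<Longrightarrow> f (\<i> *\<^sub>C z) = - \<i> * f z" and "z \<in> D"
  shows "cinner h z = f z"
  using assms(1)[OF assms(4)] assms(1)[OF assms(2)[OF assms(4)]] assms(3)[OF assms(4)]
  by (simp add: cinner_eq_Complex complex_eq_iff)

section \<open>Minimising a quadratic functional\<close>

lemma quadratic_nonneg_discriminant:
  fixes b c e :: real
  assumes "\<And>t. 0 \<le> t\<^sup>2 * c + 2 * t * b + e"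
  shows "b\<^sup>2 \<le> e * c"
proof (cases "c = 0")
  case True
  have "b = 0"
  proof (rule ccontr)
    assume "b \<noteq> 0"
    with assms[of "- (e + 1) / (2 * b)"] True show False by (simp add: field_simps)
  qed
  with True show ?thesis by simp
next
  case False
  have "c > 0"
  proof (rule ccontr)
    assume "\<not> c > 0"
    with False have c: "c < 0" by simp
    define t where "t = (2 * \<bar>b\<bar> + \<bar>e\<bar> + 1) / (- c) + 1"
    have t: "t \<ge> 1" using c unfolding t_def by (simp add: divide_nonneg_neg)
    have "t * c = - (2 * \<bar>b\<bar> + \<bar>e\<bar> + 1) + c" using c by (simp add: t_def field_simps)
    then have "t * (t * c + 2 * b) < t * (- \<bar>e\<bar>)"
      using t c by (intro mult_strict_left_mono) auto
    also have "\<dots> \<le> - \<bar>e\<bar>" using t by (simp add: mult_le_cancel_right1)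
    finally show False using assms[of t] by (simp add: power2_eq_square algebra_simps)
  qed
  then show ?thesis
    using assms[of "- b / c"] by (simp add: power2_eq_square field_simps)
qed

lemma tendsto_zero_if_power2:
  fixes g :: "'i \<Rightarrow> real"
  assumes "((\<lambda>n. (g n)\<^sup>2) \<longlongrightarrow> 0) F"
  shows "(g \<longlongrightarrow> 0) F"
proof -
  have "((\<lambda>n. sqrt ((g n)\<^sup>2)) \<longlongrightarrow> sqrt 0) F" by (intro tendsto_real_sqrt assms)
  then show ?thesis by (simp add: tendsto_rabs_zero_iff)
qed

text \<open>The functional \<open>J x = a x x - 2 * f x\<close> is bounded below because \<open>a\<close> dominates \<open>f\<close>. Along a
minimising sequence the parallelogram law makes differences small for \<open>a\<close>, and the first variation
of \<open>J\<close> tends to \<open>0\<close>. The conclusion is about the sequence rather than a limit, because the form is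
taken once as the inner product, where the sequence converges in the Hilbert space, and once as the
energy of the output, where only the outputs converge.\<close>

lemma minimizing_sequence:
  fixes D :: "'a::real_vector set" and a :: "'a \<Rightarrow> 'a \<Rightarrow> real" and f :: "'a \<Rightarrow> real"
  assumes D: "subspace D"
    and sym: "\<And>x y. x \<in> D \<Longrightarrow> y \<in> D \<Longrightarrow> a x y = a y x"
    and add: "\<And>x y z. x \<in> D \<Longrightarrow> y \<in> D \<Longrightarrow> z \<in> D \<Longrightarrow> a (x + y) z = a x z + a y z"
    and scale: "\<And>r x z. x \<in> D \<Longrightarrow> z \<in> D \<Longrightarrow> a (r *\<^sub>R x) z = r * a x z"
    and pos: "\<And>x. x \<in> D \<Longrightarrow> 0 \<le> a x x"
    and fadd: "\<And>x y. x \<in> D \<Longrightarrow> y \<in> D \<Longrightarrow> f (x + y) = f x + f y"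
    and fscale: "\<And>r x. x \<in> D \<Longrightarrow> f (r *\<^sub>R x) = r * f x"
    and bd: "\<And>x. x \<in> D \<Longrightarrow> (f x)\<^sup>2 \<le> K * a x x" and K: "K > 0"
  obtains w M where "\<And>n. w n \<in> D"
    and "\<And>n k. k \<le> n \<Longrightarrow> a (w n - w k) (w n - w k) \<le> (1/4)^k"
    and "\<And>n. a (w n) (w n) \<le> M"
    and "\<And>x. x \<in> D \<Longrightarrow> (\<lambda>n. a (w n) x) \<longlonglongrightarrow> f x"
proof -
  define J where "J x = a x x - 2 * f x" for x
  have lin: "x + r *\<^sub>R y \<in> D" if "x \<in> D" "y \<in> D" for x y r
    using D that by (simp add: subspace_def)
  have exp: "a (x + r *\<^sub>R y) (x + r *\<^sub>R y) = a x x + 2 * r * a x y + r\<^sup>2 * a y y"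
    if "x \<in> D" "y \<in> D" for x y r
  proof -
    have ry: "r *\<^sub>R y \<in> D" using that D by (simp add: subspace_def)
    have z: "x + r *\<^sub>R y \<in> D" using that lin by blast
    have "a (x + r *\<^sub>R y) (x + r *\<^sub>R y) = a x (x + r *\<^sub>R y) + r * a y (x + r *\<^sub>R y)"
      using add scale that ry z by metis
    moreover have "a x (x + r *\<^sub>R y) = a x x + r * a x y"
      using sym add scale that ry z by metis
    moreover have "a y (x + r *\<^sub>R y) = a x y + r * a y y"
      using sym add scale that ry z by metis
    ultimately show ?thesis by (simp add: power2_eq_square algebra_simps)
  qed
  have Jexp: "J (x + r *\<^sub>R y) = J x + 2 * r * (a x y - f y) + r\<^sup>2 * a y y"
    if "x \<in> D" "y \<in> D" for x y r
  proof -
    have "r *\<^sub>R y \<in> D" using that D by (simp add: subspace_def)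
    then show ?thesis
      using that exp by (simp add: J_def fadd fscale algebra_simps)
  qed
  have half: "2 * f x \<le> a x x / 2 + 2 * K" if "x \<in> D" for x
  proof -
    have "0 \<le> (f x - 2 * K)\<^sup>2" by simp
    then have "4 * K * f x \<le> (f x)\<^sup>2 + 4 * K\<^sup>2" by (simp add: power2_eq_square algebra_simps)
    also have "\<dots> \<le> K * (a x x + 4 * K)"
      using bd[OF that] by (simp add: power2_eq_square algebra_simps)
    finally have "K * (4 * f x) \<le> K * (a x x + 4 * K)" by simp
    then show ?thesis using K by simp
  qed
  have lower: "- 2 * K \<le> J x" if "x \<in> D" for x
    using half[OF that] pos[OF that] unfolding J_def by linarith
  then have bdd: "bdd_below (J ` D)" by (auto intro!: bdd_belowI)
  define m where "m = Inf (J ` D)"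
  have ne: "D \<noteq> {}" using D by (auto simp: subspace_def)
  have m: "m \<le> J x" if "x \<in> D" for x
    unfolding m_def using bdd that by (simp add: cInf_lower)
  have "\<exists>x\<in>D. J x \<le> m + (1/4)^Suc n" for n
  proof (rule ccontr)
    assume "\<not> ?thesis"
    then have "m + (1/4)^Suc n \<le> Inf (J ` D)"
      using ne by (intro cInf_greatest) (auto simp: not_le intro: less_imp_le)
    moreover have "0 < ((1::real)/4)^Suc n" by simp
    ultimately show False unfolding m_def by linarith
  qed
  then obtain w where w: "\<And>n. w n \<in> D" "\<And>n. J (w n) \<le> m + (1/4)^Suc n" by metis
  show ?thesis
  proof
    show "w n \<in> D" for n by (rule w)
    show "a (w n - w k) (w n - w k) \<le> (1/4)^k" if "k \<le> n" for n k
    proof -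
      define y where "y = w n - w k"
      have y: "y \<in> D" using w D by (simp add: y_def subspace_diff)
      \<comment> \<open>the midpoint of two almost minimal points is not below the infimum\<close>
      have "m \<le> J (w k + (1/2) *\<^sub>R y)" by (intro m lin w y)
      also have "\<dots> = J (w k) + (a (w k) y - f y) + a y y / 4"
        by (simp add: Jexp w y power2_eq_square)
      finally have 1: "m \<le> J (w k) + (a (w k) y - f y) + a y y / 4" .
      have "J (w n) = J (w k) + 2 * (a (w k) y - f y) + a y y"
        using Jexp[of "w k" y 1] w y by (simp add: y_def)
      with 1 w(2)[of n] w(2)[of k]
      have "a y y \<le> 2 * (1/4)^Suc n + 2 * (1/4)^Suc k" by simp
      also have "(1/4)^Suc n \<le> ((1::real)/4)^Suc k"
        using that by (intro power_decreasing) auto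
      finally show ?thesis by (simp add: y_def)
    qed
    show "a (w n) (w n) \<le> 2 * (m + 1 + 2 * K)" for n
    proof -
      have "a (w n) (w n) - 2 * f (w n) \<le> m + (1/4)^Suc n" using w(2)[of n] by (simp add: J_def)
      moreover have "m + ((1::real)/4)^Suc n \<le> m + 1"
        by (intro add_left_mono power_le_one) auto
      ultimately have "a (w n) (w n) - 2 * f (w n) \<le> m + 1" by (rule order_trans)
      moreover have "x \<le> 2 * (m + 1 + 2 * K)"
        if "x - 2 * y \<le> m + 1" "2 * y \<le> x / 2 + 2 * K" for x y using that by (simp add: field_simps)
      ultimately show ?thesis using half[OF w(1)[of n]] by blast
    qed
    show "(\<lambda>n. a (w n) x) \<longlonglongrightarrow> f x" if x: "x \<in> D" for x
    proof -
      have le: "(a (w n) x - f x)\<^sup>2 \<le> (1/4)^Suc n * a x x" for n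
      proof (rule quadratic_nonneg_discriminant)
        fix t :: real
        have "m \<le> J (w n + t *\<^sub>R x)" by (intro m lin w x)
        then show "0 \<le> t\<^sup>2 * a x x + 2 * t * (a (w n) x - f x) + (1/4)^Suc n"
          using w(2)[of n] Jexp[OF w(1) x, of n t] by simp
      qed
      have "(\<lambda>n. ((1::real)/4)^n) \<longlonglongrightarrow> 0" by (intro LIMSEQ_power_zero) auto
      then have "(\<lambda>n. (1/4)^Suc n * a x x) \<longlonglongrightarrow> 0"
        by (rule tendsto_mult_left_zero[OF LIMSEQ_Suc])
      then have "(\<lambda>n. (a (w n) x - f x)\<^sup>2) \<longlonglongrightarrow> 0"
        by (rule tendsto_sandwich[OF _ _ tendsto_const, rotated 2]) (use le in auto)
      then have "(\<lambda>n. a (w n) x - f x) \<longlonglongrightarrow> 0"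
        by (rule tendsto_zero_if_power2)
      then show ?thesis by (simp add: LIM_zero_iff)
    qed
  qed
qed

lemma convergent_if_geometric:
  fixes w :: "nat \<Rightarrow> 'a::{real_normed_vector,complete_space}"
  assumes le: "\<And>n k. k \<le> n \<Longrightarrow> norm (w n - w k) \<le> c * q ^ k" and q: "0 \<le> q" "q < 1"
  obtains l where "w \<longlonglongrightarrow> l"
proof -
  have "(\<lambda>k. q ^ k) \<longlonglongrightarrow> 0" using q by (intro LIMSEQ_power_zero) simp
  then have lim: "(\<lambda>k. c * q ^ k) \<longlonglongrightarrow> 0" by (rule tendsto_mult_right_zero)
  have "Cauchy w"
  proof (rule metric_CauchyI)
    fix e :: real assume "e > 0"
    then have "\<forall>\<^sub>F k in sequentially. c * q ^ k < e / 2" by (intro order_tendstoD(2)[OF lim]) simp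
    then obtain k where k: "c * q ^ k < e / 2" by (auto simp: eventually_sequentially)
    have "dist (w m) (w n) < e" if "m \<ge> k" "n \<ge> k" for m n
      using le[OF that(1)] le[OF that(2)] k dist_triangle2[of "w m" "w n" "w k"]
      by (simp add: dist_norm)
    then show "\<exists>k. \<forall>m\<ge>k. \<forall>n\<ge>k. dist (w m) (w n) < e" by blast
  qed
  then show thesis using that Cauchy_convergent convergent_def by blast
qed

text \<open>With the inner product as the form, the minimising sequence converges in norm. For \<open>D = UNIV\<close>
  this is Riesz's theorem; for a functional that is itself an inner product it is orthogonal projection
  onto the closure of \<open>D\<close>.\<close>

lemma riesz_on_subspace:
  fixes D :: "'a::{real_inner,complete_space} set"
  assumes D: "subspace D"
    and fadd: "\<And>x y. x \<in> D \<Longrightarrow> y \<in> D \<Longrightarrow> f (x + y) = f x + f y"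
    and fscale: "\<And>r x. x \<in> D \<Longrightarrow> f (r *\<^sub>R x) = r * f x"
    and bd: "\<And>x. x \<in> D \<Longrightarrow> \<bar>f x\<bar> \<le> K * norm x"
  obtains h where "h \<in> closure D" and "\<And>x. x \<in> D \<Longrightarrow> inner h x = f x"
proof -
  define L where "L = \<bar>K\<bar> + 1"
  show thesis
  proof (rule minimizing_sequence[of D inner f "L\<^sup>2"])
    show "(f x)\<^sup>2 \<le> L\<^sup>2 * inner x x" if "x \<in> D" for x
    proof -
      have "\<bar>f x\<bar> \<le> K * norm x" by (rule bd[OF that])
      also have "\<dots> \<le> L * norm x" unfolding L_def by (intro mult_right_mono) auto
      finally have "\<bar>f x\<bar>\<^sup>2 \<le> (L * norm x)\<^sup>2" by (intro power_mono) auto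
      then show ?thesis by (simp add: power_mult_distrib power2_norm_eq_inner)
    qed
    show "L\<^sup>2 > 0" unfolding L_def by (intro zero_less_power) simp
    show "inner x y = inner y x" for x y :: 'a by (rule inner_commute)
    show "inner (x + y) z = inner x z + inner y z" for x y z :: 'a by (rule inner_add_left)
    show "inner (r *\<^sub>R x) z = r * inner x z" for r and x z :: 'a by simp
  next
    fix w M
    assume w: "\<And>n. w n \<in> D"
        "\<And>n k. k \<le> n \<Longrightarrow> inner (w n - w k) (w n - w k) \<le> (1/4)^k"
        "\<And>x. x \<in> D \<Longrightarrow> (\<lambda>n. inner (w n) x) \<longlonglongrightarrow> f x"
    have nle: "norm (w n - w k) \<le> (1/2)^k" if "k \<le> n" for n k
    proof -
      have "((1::real)/2)^k * (1/2)^k = (1/4)^k" by (simp flip: power_mult_distrib)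
      then have "(norm (w n - w k))\<^sup>2 \<le> ((1/2)^k)\<^sup>2"
        using w(2)[OF that] by (simp add: power2_norm_eq_inner) (simp add: power2_eq_square)
      then show ?thesis by (rule power2_le_imp_le) simp
    qed
    obtain h where h: "w \<longlonglongrightarrow> h"
      by (rule convergent_if_geometric[of w 1 "1/2"]) (use nle in auto)
    show thesis
    proof (rule that)
      show "h \<in> closure D" using h w(1) closure_sequential by blast
      show "inner h x = f x" if "x \<in> D" for x
        using LIMSEQ_unique[OF tendsto_inner[OF h tendsto_const] w(3)[OF that]] .
    qed
  qed (use D fadd fscale in auto)
qed

text \<open>The difference of a vector and its projection onto the closure is orthogonal to the subspace.\<close>

lemma dense_subspace_if_orthogonal_trivial:
  fixes D :: "'a::{real_inner,complete_space} set"
  assumes D: "subspace D" and tr: "\<And>x. (\<And>y. y \<in> D \<Longrightarrow> inner x y = 0) \<Longrightarrow> x = 0"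
  shows "closure D = UNIV"
proof -
  have "h \<in> closure D" for h
  proof -
    obtain p where p: "p \<in> closure D" "\<And>x. x \<in> D \<Longrightarrow> inner p x = inner h x"
      using riesz_on_subspace[of D "inner h" "norm h"] D
      by (auto simp: inner_add_right Cauchy_Schwarz_ineq2)
    then have "h - p = 0" by (intro tr) (simp add: inner_diff_left)
    with p show ?thesis by simp
  qed
  then show ?thesis by auto
qed

lemma eq_zero_if_orthogonal_dense:
  fixes x :: "'a::real_inner"
  assumes "closure D = UNIV" "\<And>y. y \<in> D \<Longrightarrow> inner x y = 0"
  shows "x = 0"
proof -
  obtain w where w: "\<And>n. w n \<in> D" "w \<longlonglongrightarrow> x"
    using assms(1) closure_sequential by (metis UNIV_I)
  have "(\<lambda>n. inner x (w n)) \<longlonglongrightarrow> inner x x" by (intro tendsto_inner tendsto_const w)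
  then have "inner x x = 0"
    using LIMSEQ_unique[of "\<lambda>n. 0::real" "inner x x" 0] w(1) assms(2) by simp
  then show ?thesis by simp
qed

section \<open>Strongly continuous semigroups\<close>

instance complex_banach \<subseteq> banach ..

text \<open>If \<open>v\<close> nearly attains the norm of \<open>T\<close>, then so does one of the points \<open>x + v\<close> and \<open>x - v\<close>, since
their images differ by \<open>2 T v\<close>. The ratio \<open>5/6\<close> leaves a margin for the tail of the gliding hump below.\<close>

lemma near_norm_attained:
  fixes T :: "'a::real_normed_vector \<Rightarrow> 'b::real_normed_vector"
  assumes T: "bounded_linear T" and pos: "onorm T > 0" and r: "r > 0"
  shows "\<exists>y. norm (y - x) \<le> r \<and> norm (T y) \<ge> 5/6 * onorm T * r"
proof -
  interpret T: bounded_linear T by (rule T)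
  have "\<exists>e. norm (T e) > norm e * (5/6 * onorm T)"
  proof (rule ccontr)
    assume "\<not> ?thesis"
    then have "onorm T \<le> 5/6 * onorm T"
      using pos by (intro onorm_bound) (auto simp: not_less mult.commute)
    with pos show False by simp
  qed
  then obtain e where e: "norm (T e) > norm e * (5/6 * onorm T)" by blast
  then have e0: "norm e > 0" using T.zero by auto
  define v where "v = (r / norm e) *\<^sub>R e"
  have v: "norm v = r" using e0 r by (simp add: v_def)
  have "norm (T v) = r / norm e * norm (T e)" using r by (simp add: v_def T.scaleR)
  also have "\<dots> \<ge> r / norm e * (norm e * (5/6 * onorm T))"
    using r e by (intro mult_left_mono) auto
  finally have Tv: "norm (T v) \<ge> 5/6 * onorm T * r" using e0 by (simp add: mult.commute)
  have "2 * norm (T v) = norm (T (x + v) - T (x - v))"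
    by (simp add: T.add T.diff flip: scaleR_2)
  also have "\<dots> \<le> norm (T (x + v)) + norm (T (x - v))" by (rule norm_triangle_ineq4)
  finally have "norm (T v) \<le> norm (T (x + v)) \<or> norm (T v) \<le> norm (T (x - v))" by linarith
  then show ?thesis
  proof
    assume "norm (T v) \<le> norm (T (x + v))"
    with Tv v show ?thesis by (intro exI[of _ "x + v"]) simp
  next
    assume "norm (T v) \<le> norm (T (x - v))"
    with Tv v show ?thesis by (intro exI[of _ "x - v"]) simp
  qed
qed

text \<open>A gliding hump: if the norms are unbounded, a subfamily has norms above \<open>4 ^ k\<close>. Moving a
  point by at most \<open>(1/3) ^ k\<close> at step \<open>k\<close> makes its image under the \<open>k\<close>-th of these operators at least
  \<open>5/6\<close> of the norm times the step. The later steps have total length \<open>1/2 * (1/3) ^ k\<close>, so the image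
  of the limit point keeps at least the size \<open>1/3 * (4/3) ^ k\<close>.\<close>

lemma uniform_boundedness:
  fixes T :: "nat \<Rightarrow> 'a::banach \<Rightarrow> 'b::real_normed_vector"
  assumes T: "\<And>n. bounded_linear (T n)" and bd: "\<And>x. \<exists>M. \<forall>n. norm (T n x) \<le> M"
  shows "\<exists>K. \<forall>n. onorm (T n) \<le> K"
proof (rule ccontr)
  assume "\<not> ?thesis"
  then have "\<exists>n. onorm (T n) > 4 ^ k" for k :: nat by (meson not_le)
  then obtain n where n: "\<And>k. onorm (T (n k)) > 4 ^ k" by metis
  have npos: "onorm (T (n k)) > 0" for k using n[of k] by (rule less_trans[rotated]) simp
  have "\<forall>k x. \<exists>y. norm (y - x) \<le> (1/3)^k \<and> norm (T (n k) y) \<ge> 5/6 * onorm (T (n k)) * (1/3)^k"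
    by (intro allI near_norm_attained T npos) simp
  then obtain g where g: "\<And>k x. norm (g k x - x) \<le> (1/3)^k"
      "\<And>k x. norm (T (n k) (g k x)) \<ge> 5/6 * onorm (T (n k)) * (1/3)^k"
    by (fastforce simp: choice_iff)
  define y where "y = rec_nat (0::'a) g"
  have y: "y (Suc k) = g k (y k)" for k by (simp add: y_def)
  have tail: "norm (y (m + i) - y m) \<le> 3/2 * ((1/3)^m - (1/3)^(m+i))" for m i
  proof (induction i)
    case (Suc i)
    have "norm (y (m + Suc i) - y m) \<le> norm (y (Suc (m + i)) - y (m + i)) + norm (y (m + i) - y m)"
      using norm_triangle_ineq[of "y (Suc (m + i)) - y (m + i)" "y (m + i) - y m"] by simp
    also have "\<dots> \<le> (1/3)^(m+i) + 3/2 * ((1/3)^m - (1/3)^(m+i))"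
      using g(1)[of "m+i" "y (m+i)"] Suc unfolding y by (intro add_mono)
    also have "\<dots> = 3/2 * ((1/3)^m - (1/3)^(m + Suc i))" by (simp add: field_simps)
    finally show ?case .
  qed simp
  have tail': "norm (y (m + i) - y m) \<le> 3/2 * (1/3)^m" for m i
    proof -
    have "3/2 * ((1/3)^m - (1/3)^(m+i)) \<le> 3/2 * ((1::real)/3)^m" by simp
    with tail[of m i] show ?thesis by (rule order_trans)
  qed
  obtain x where x: "y \<longlonglongrightarrow> x"
  proof (rule convergent_if_geometric[of y "3/2" "1/3"])
    show "norm (y n - y k) \<le> 3/2 * (1/3)^k" if "k \<le> n" for n k
      using tail'[of k "n - k"] that by simp
  qed auto
  have dx: "norm (x - y m) \<le> 3/2 * (1/3)^m" for m
  proof (rule tendsto_upperbound)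
    show "(\<lambda>i. norm (y (m + i) - y m)) \<longlonglongrightarrow> norm (x - y m)"
      using LIMSEQ_ignore_initial_segment[OF x, of m]
      by (intro tendsto_norm tendsto_diff tendsto_const) (simp add: add.commute)
  qed (use tail' in auto)
  obtain M where M: "\<And>n. norm (T n x) \<le> M" using bd by blast
  have "(4/3)^k \<le> 3 * M" for k
  proof -
    interpret Tk: bounded_linear "T (n k)" by (rule T)
    have "norm (T (n k) (y (Suc k) - x)) \<le> onorm (T (n k)) * norm (y (Suc k) - x)"
      by (rule onorm[OF T])
    also have "\<dots> \<le> onorm (T (n k)) * (3/2 * (1/3)^Suc k)"
      using dx[of "Suc k"] npos[of k] by (intro mult_left_mono) (auto simp: norm_minus_commute)
    finally have "norm (T (n k) (y (Suc k) - x)) \<le> 1/2 * (onorm (T (n k)) * (1/3)^k)" by simp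
    moreover have "norm (T (n k) (y (Suc k))) \<ge> 5/6 * (onorm (T (n k)) * (1/3)^k)"
      using g(2)[of k "y k"] by (simp add: y)
    moreover have "norm (T (n k) (y (Suc k))) \<le> norm (T (n k) (y (Suc k) - x)) + norm (T (n k) x)"
      using norm_triangle_ineq[of "T (n k) (y (Suc k) - x)" "T (n k) x"] by (simp add: Tk.diff)
    ultimately have "onorm (T (n k)) * (1/3)^k \<le> 3 * M" using M[of "n k"] by linarith
    moreover have "4^k * (1/3)^k \<le> onorm (T (n k)) * (1/3)^k"
      using n[of k] by (intro mult_right_mono) auto
    moreover have "(4::real)^k * (1/3)^k = (4/3)^k" by (simp flip: power_mult_distrib)
    ultimately show ?thesis by simp
  qed
  moreover obtain k where "3 * M < (4/3)^k" using real_arch_pow[of "4/3" "3*M"] by auto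
  ultimately show False by (meson not_le)
qed

lemma right_difference_quotient:
  fixes F :: "real \<Rightarrow> 'a::real_normed_vector"
  assumes F: "(F has_vector_derivative D) (at t within {a..b})" and t: "a \<le> t" "t < b"
  shows "((\<lambda>h. (F (t + h) - F t) /\<^sub>R h) \<longlongrightarrow> D) (at_right 0)"
proof -
  have "(F has_vector_derivative D) (at t within {t..b})"
    using F t by (auto intro: has_vector_derivative_within_subset)
  then have "((\<lambda>y. (1 / norm (y - t)) *\<^sub>R (F y - (F t + (y - t) *\<^sub>R D))) \<longlongrightarrow> 0) (at_right t)"
    using t by (simp add: has_vector_derivative_def has_derivative_within at_within_Icc_at_right)
  moreover have "\<forall>\<^sub>F y in at_right t. (1 / norm (y - t)) *\<^sub>R (F y - (F t + (y - t) *\<^sub>R D)) =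
      (F y - F t) /\<^sub>R (y - t) - D"
    using eventually_at_right_less[of t]
  proof eventually_elim
    case (elim y)
    have "(1 / norm (y - t)) *\<^sub>R (F y - (F t + (y - t) *\<^sub>R D)) =
        (F y - F t) /\<^sub>R (y - t) - (inverse (y - t) * (y - t)) *\<^sub>R D"
      using elim by (simp add: inverse_eq_divide scaleR_diff_right scaleR_add_right)
    then show ?case using elim by simp
  qed
  ultimately have "((\<lambda>y. (F y - F t) /\<^sub>R (y - t) - D) \<longlongrightarrow> 0) (at_right t)"
    using tendsto_cong by fast
  then have "((\<lambda>y. (F y - F t) /\<^sub>R (y - t)) \<longlongrightarrow> D) (at_right t)" by (simp add: LIM_zero_iff)
  then show ?thesis
    by (simp add: at_right_to_0[of t] filterlim_filtermap add.commute)
qed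

text \<open>The limit in the definition of the generator is unique, so that \<open>Lim\<close> can be eliminated.\<close>

lemma generator_eq_Some_iff:
  "generator S x = Some y \<longleftrightarrow> ((\<lambda>t. (S t x - x) /\<^sub>R t) \<longlongrightarrow> y) (at_right 0)"
proof
  assume "generator S x = Some y"
  then show "((\<lambda>t. (S t x - x) /\<^sub>R t) \<longlongrightarrow> y) (at_right 0)"
    by (auto simp: generator_def split: if_splits) (metis tendsto_Lim trivial_limit_at_right_real)
next
  assume "((\<lambda>t. (S t x - x) /\<^sub>R t) \<longlongrightarrow> y) (at_right 0)"
  then show "generator S x = Some y"
    by (auto simp: generator_def intro!: tendsto_Lim)
qed

locale semigroup =
  fixes S :: "real \<Rightarrow> 'a::complex_banach \<Rightarrow> 'a"
  assumes C0: "C0_semigroup S"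
begin

lemma linear: "t \<ge> 0 \<Longrightarrow> bounded_linear (S t)"
  using C0 by (simp add: C0_semigroup_def bounded_clinear_def)

lemma scaleC: "t \<ge> 0 \<Longrightarrow> S t (c *\<^sub>C x) = c *\<^sub>C S t x"
  using C0 by (simp add: C0_semigroup_def bounded_clinear_def)

lemma zero [simp]: "S 0 x = x"
  using C0 by (simp add: C0_semigroup_def)

lemma add: "s \<ge> 0 \<Longrightarrow> t \<ge> 0 \<Longrightarrow> S (s + t) x = S s (S t x)"
  using C0 by (simp add: C0_semigroup_def)

lemma tendsto_at_0: "((\<lambda>t. S t x) \<longlongrightarrow> x) (at_right 0)"
  using C0 by (simp add: C0_semigroup_def)

text \<open>Otherwise there are times tending to \<open>0\<close> along which the operator norms are unbounded, although
every orbit converges; this contradicts uniform boundedness.\<close>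

lemma bounded_near_0: "\<exists>d>0. \<exists>M\<ge>1. \<forall>t\<in>{0..d}. \<forall>x. norm (S t x) \<le> M * norm x"
proof (rule ccontr)
  assume neg: "\<not> ?thesis"
  have "\<exists>t. 0 < t \<and> t \<le> 1 / Suc n \<and> onorm (S t) > Suc n" for n :: nat
  proof -
    have "\<not> (\<forall>t\<in>{0..1 / Suc n}. \<forall>x. norm (S t x) \<le> Suc n * norm x)"
      using neg by (auto simp del: of_nat_Suc)
    then obtain t x where t: "0 \<le> t" "t \<le> 1 / Suc n" "norm (S t x) > Suc n * norm x"
      by (auto simp: not_le)
    moreover have "norm x \<le> Suc n * norm x" by (simp add: mult_le_cancel_right1)
    ultimately have "t \<noteq> 0" by (auto simp: not_less)
    moreover have "norm (S t x) \<le> onorm (S t) * norm x" by (intro onorm linear t)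
    then have "onorm (S t) > Suc n"
      using t(3) by (meson less_le_trans mult_right_mono norm_ge_zero not_le order.strict_trans1)
    ultimately show ?thesis using t by (intro exI[of _ t]) auto
  qed
  then obtain t where t: "\<And>n. 0 < t n" "\<And>n. t n \<le> 1 / Suc n" "\<And>n. onorm (S (t n)) > Suc n"
    by metis
  have "t \<longlonglongrightarrow> 0"
    using LIMSEQ_inverse_real_of_nat t(1,2)
    by (intro tendsto_sandwich[of "\<lambda>_. 0" t sequentially "\<lambda>n. inverse (Suc n)"])
      (auto simp: inverse_eq_divide less_imp_le)
  then have lim: "filterlim t (at_right 0) sequentially"
    using t(1) by (auto simp: filterlim_at less_imp_neq[THEN not_sym] intro!: always_eventually)
  have "\<exists>M. \<forall>n. norm (S (t n) x) \<le> M" for x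
  proof -
    have "Bseq (\<lambda>n. S (t n) x)"
      using filterlim_compose[OF tendsto_at_0 lim] convergentI convergent_imp_Bseq by blast
    then show ?thesis by (auto simp: Bseq_def)
  qed
  then obtain K where K: "\<And>n. onorm (S (t n)) \<le> K"
    using uniform_boundedness[of "\<lambda>n. S (t n)"] linear t(1) less_imp_le by metis
  obtain n where "K < real n" using reals_Archimedean2 by blast
  with K[of n] t(3)[of n] show False by simp
qed

text \<open>The bound near \<open>0\<close> spreads by the semigroup law: \<open>n\<close> steps of length \<open>d\<close> cost a factor \<open>M ^ n\<close>.\<close>

lemma bounded_on_interval: "\<exists>M\<ge>1. \<forall>t\<in>{0..T}. \<forall>x. norm (S t x) \<le> M * norm x"
proof -
  obtain d M where d: "d > 0" "M \<ge> 1" "\<And>t x. 0 \<le> t \<Longrightarrow> t \<le> d \<Longrightarrow> norm (S t x) \<le> M * norm x"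
    using bounded_near_0 by (metis atLeastAtMost_iff)
  have *: "norm (S t x) \<le> M ^ n * norm x" if "0 \<le> t" "t \<le> real n * d" for n t x
    using that
  proof (induction n arbitrary: t)
    case (Suc n)
    show ?case
    proof (cases "t \<le> d")
      case True
      then have "norm (S t x) \<le> M ^ 1 * norm x" using d Suc by simp
      also have "\<dots> \<le> M ^ Suc n * norm x"
        using d by (intro mult_right_mono power_increasing) auto
      finally show ?thesis .
    next
      case False
      then have "S t x = S d (S (t - d) x)" using add[of d "t - d" x] d by simp
      also have "norm \<dots> \<le> M * norm (S (t - d) x)" using d by simp
      also have "\<dots> \<le> M * (M ^ n * norm x)"
        using False Suc.prems d Suc.IH[of "t - d"] by (intro mult_left_mono) (auto simp: algebra_simps)
      finally show ?thesis by (simp add: algebra_simps)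
    qed
  qed simp
  obtain n where "T / d \<le> real n" using real_arch_simple by blast
  then have "T \<le> real n * d" using d by (simp add: field_simps)
  with * d show ?thesis by (intro exI[of _ "M ^ n"]) (auto simp: one_le_power)
qed

lemma continuous_on: "continuous_on {0..} (\<lambda>t. S t x)"
  unfolding continuous_on_iff
proof (intro ballI allI impI)
  fix t e :: real assume t: "t \<in> {0..}" and e: "e > 0"
  obtain M where M: "M \<ge> 1" "\<And>s x. 0 \<le> s \<Longrightarrow> s \<le> t + 1 \<Longrightarrow> norm (S s x) \<le> M * norm x"
    using bounded_on_interval by (metis atLeastAtMost_iff)
  have "\<forall>\<^sub>F h in at_right 0. dist (S h x) x < e / M"
    using tendsto_at_0 M e by (intro tendstoD) auto
  then obtain d where d: "d > 0" "\<And>h. 0 < h \<Longrightarrow> h < d \<Longrightarrow> dist (S h x) x < e / M"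
    by (auto simp: eventually_at_right[of 0 1, simplified])
  have *: "dist (S (r + h) x) (S r x) < e" if "0 \<le> r" "r \<le> t + 1" "0 \<le> h" "h < d" for r h
  proof -
    interpret Sr: bounded_linear "S r" using that by (intro linear)
    have "dist (S (r + h) x) (S r x) = norm (S r (S h x - x))"
      using that by (simp add: add dist_norm Sr.diff)
    also have "\<dots> \<le> M * dist (S h x) x" using M that by (simp add: dist_norm)
    also have "\<dots> < e"
      using d(2)[of h] that M e by (cases "h = 0") (auto simp: field_simps)
    finally show ?thesis .
  qed
  show "\<exists>d>0. \<forall>s\<in>{0..}. dist s t < d \<longrightarrow> dist (S s x) (S t x) < e"
  proof (intro exI[of _ "min d 1"] conjI ballI impI)
    fix s assume s: "s \<in> {0..}" "dist s t < min d 1"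
    show "dist (S s x) (S t x) < e"
    proof (cases "t \<le> s")
      case True
      then show ?thesis using *[of t "s - t"] s t by (simp add: dist_real_def)
    next
      case False
      then show ?thesis using *[of s "t - s"] s t by (simp add: dist_real_def dist_commute)
    qed
  qed (use d in auto)
qed

lemma continuous_on_Icc: "0 \<le> a \<Longrightarrow> continuous_on {a..b} (\<lambda>t. S t x)"
  by (rule continuous_on_subset[OF continuous_on]) auto

text \<open>Integrated orbits: \<open>J t\<close> maps every vector into the domain of the generator, and \<open>J t x / t\<close> tends to \<open>x\<close>.\<close>

definition J :: "real \<Rightarrow> 'a \<Rightarrow> 'a" where
  "J t x = integral {0..t} (\<lambda>s. S s x)"

lemma integrable: "0 \<le> a \<Longrightarrow> (\<lambda>s. S s x) integrable_on {a..b}"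
  by (intro integrable_continuous_interval continuous_on_Icc)

lemma J_has_derivative:
  "0 \<le> t \<Longrightarrow> t \<le> b \<Longrightarrow> ((\<lambda>u. J u x) has_vector_derivative S t x) (at t within {0..b})"
  unfolding J_def by (rule integral_has_vector_derivative) (auto intro: continuous_on_Icc)

lemma J_quotient: "0 \<le> t \<Longrightarrow> ((\<lambda>h. (J (t + h) x - J t x) /\<^sub>R h) \<longlongrightarrow> S t x) (at_right 0)"
  by (rule right_difference_quotient[OF J_has_derivative[of t "t + 1"]]) auto

lemma J_zero [simp]: "J 0 x = 0"
  by (simp add: J_def)

lemma J_average: "((\<lambda>h. J h x /\<^sub>R h) \<longlongrightarrow> x) (at_right 0)"
  using J_quotient[of 0 x] by simp

lemma bounded_linear_J:
  assumes "t \<ge> 0" shows "bounded_linear (J t)"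
proof -
  obtain M where M: "M \<ge> 1" "\<And>s x. 0 \<le> s \<Longrightarrow> s \<le> t \<Longrightarrow> norm (S s x) \<le> M * norm x"
    using bounded_on_interval by (metis atLeastAtMost_iff)
  show ?thesis
  proof (rule bounded_linear_intro)
    fix x y :: 'a and r :: real
    have "J t (x + y) = integral {0..t} (\<lambda>s. S s x + S s y)" unfolding J_def
      by (intro Henstock_Kurzweil_Integration.integral_cong)
        (simp add: bounded_linear.linear[OF linear] Real_Vector_Spaces.linear_add)
    then show "J t (x + y) = J t x + J t y"
      by (simp add: J_def integrable Henstock_Kurzweil_Integration.integral_add)
    have "J t (r *\<^sub>R x) = integral {0..t} (\<lambda>s. r *\<^sub>R S s x)" unfolding J_def
      by (intro Henstock_Kurzweil_Integration.integral_cong)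
        (simp add: bounded_linear.linear[OF linear] Real_Vector_Spaces.linear_scale)
    then show "J t (r *\<^sub>R x) = r *\<^sub>R J t x" by (simp add: J_def)
    show "norm (J t x) \<le> norm x * (M * t)"
      using integral_bound[of 0 t "\<lambda>s. S s x" "M * norm x"] assms M
      by (simp add: J_def continuous_on_Icc algebra_simps)
  qed
qed

lemma S_J: "0 \<le> h \<Longrightarrow> 0 \<le> t \<Longrightarrow> S h (J t x) = J t (S h x)"
proof -
  assume h: "0 \<le> h" and t: "0 \<le> t"
  have "S h (J t x) = integral {0..t} (S h \<circ> (\<lambda>s. S s x))"
    unfolding J_def by (rule integral_linear[OF integrable linear, symmetric]) (use h in auto)
  also have "\<dots> = J t (S h x)"
    unfolding J_def by (intro Henstock_Kurzweil_Integration.integral_cong)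
      (use h in \<open>simp add: add[symmetric] add.commute\<close>)
  finally show ?thesis .
qed

lemma S_J_diff: "0 \<le> h \<Longrightarrow> 0 \<le> t \<Longrightarrow> S h (J t x) = J (t + h) x - J h x"
proof -
  assume h: "0 \<le> h" and t: "0 \<le> t"
  have "S h (J t x) = integral {0..t} ((\<lambda>s. S s x) \<circ> (+) h)"
    unfolding S_J[OF h t] unfolding J_def by (intro Henstock_Kurzweil_Integration.integral_cong)
      (use h in \<open>simp add: add[symmetric] add.commute\<close>)
  also have "\<dots> = integral {0 + h..t + h} (\<lambda>s. S s x)"
    by (rule integral_shift_Icc_real)
  also have "\<dots> = J (t + h) x - J h x"
    using Henstock_Kurzweil_Integration.integral_combine[of 0 h "t + h" "\<lambda>s. S s x"] h t
    by (simp add: J_def integrable algebra_simps)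
  finally show ?thesis .
qed

lemma generator_J:
  assumes "0 \<le> t" shows "generator S (J t x) = Some (S t x - x)"
  unfolding generator_eq_Some_iff
proof (rule Lim_transform_eventually)
  show "((\<lambda>h. (J (t + h) x - J t x) /\<^sub>R h - J h x /\<^sub>R h) \<longlongrightarrow> S t x - x) (at_right 0)"
    by (intro tendsto_diff J_quotient J_average assms)
  show "\<forall>\<^sub>F h in at_right 0. (J (t + h) x - J t x) /\<^sub>R h - J h x /\<^sub>R h = (S h (J t x) - J t x) /\<^sub>R h"
    using eventually_at_right_less[of "0::real"]
    by eventually_elim (simp add: S_J_diff assms algebra_simps)
qed

text \<open>\<open>J t\<close> is bounded and commutes with the difference quotients at \<open>0\<close>. Passing to the limit gives the
fundamental theorem for orbits without differentiating them from the left.\<close>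

lemma J_generator:
  assumes x: "generator S x = Some y" and t: "0 \<le> t"
  shows "J t y = S t x - x"
proof -
  interpret Jt: bounded_linear "J t" by (rule bounded_linear_J[OF t])
  have "((\<lambda>h. J t ((S h x - x) /\<^sub>R h)) \<longlongrightarrow> J t y) (at_right 0)"
    using x by (intro Jt.tendsto) (simp add: generator_eq_Some_iff)
  then have "((\<lambda>h. (S h (J t x) - J t x) /\<^sub>R h) \<longlongrightarrow> J t y) (at_right 0)"
  proof (rule Lim_transform_eventually)
    show "\<forall>\<^sub>F h in at_right 0. J t ((S h x - x) /\<^sub>R h) = (S h (J t x) - J t x) /\<^sub>R h"
      using eventually_at_right_less[of "0::real"]
      by eventually_elim (simp add: S_J t Jt.scaleR Jt.diff)
  qed
  moreover have "((\<lambda>h. (S h (J t x) - J t x) /\<^sub>R h) \<longlongrightarrow> S t x - x) (at_right 0)"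
    using generator_J[OF t] by (simp add: generator_eq_Some_iff)
  ultimately show ?thesis using tendsto_unique trivial_limit_at_right_real by blast
qed

lemma generator_S:
  assumes x: "generator S x = Some y" and t: "0 \<le> t"
  shows "generator S (S t x) = Some (S t y)"
  unfolding generator_eq_Some_iff
proof (rule Lim_transform_eventually)
  interpret St: bounded_linear "S t" by (rule linear[OF t])
  show "((\<lambda>h. S t ((S h x - x) /\<^sub>R h)) \<longlongrightarrow> S t y) (at_right 0)"
    using x by (intro St.tendsto) (simp add: generator_eq_Some_iff)
  show "\<forall>\<^sub>F h in at_right 0. S t ((S h x - x) /\<^sub>R h) = (S h (S t x) - S t x) /\<^sub>R h"
    using eventually_at_right_less[of "0::real"]
    by eventually_elim (simp add: t St.scaleR St.diff add[symmetric] add.commute)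
qed

lemma has_derivative_on_domain:
  assumes x: "generator S x = Some y" and t: "0 \<le> t" "t \<le> b"
  shows "((\<lambda>u. S u x) has_vector_derivative S t y) (at t within {0..b})"
proof (rule has_vector_derivative_transform)
  show "((\<lambda>u. x + J u y) has_vector_derivative S t y) (at t within {0..b})"
    using J_has_derivative[OF t, of y] by (simp add: has_vector_derivative_add_const add.commute[of x])
qed (use t J_generator[OF x] in auto)

lemma generator_add:
  assumes "generator S x = Some y" "generator S x' = Some y'"
  shows "generator S (x + x') = Some (y + y')"
  unfolding generator_eq_Some_iff
proof (rule Lim_transform_eventually)
  show "((\<lambda>t. (S t x - x) /\<^sub>R t + (S t x' - x') /\<^sub>R t) \<longlongrightarrow> y + y') (at_right 0)"
    using assms by (intro tendsto_add) (simp_all add: generator_eq_Some_iff)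
  show "\<forall>\<^sub>F t in at_right 0. (S t x - x) /\<^sub>R t + (S t x' - x') /\<^sub>R t = (S t (x + x') - (x + x')) /\<^sub>R t"
    using eventually_at_right_less[of "0::real"]
    by eventually_elim (simp add: bounded_linear.linear[OF linear] Real_Vector_Spaces.linear_add
      algebra_simps flip: scaleR_add_right scaleR_diff_right)
qed

lemma generator_scaleC:
  assumes "generator S x = Some y" shows "generator S (c *\<^sub>C x) = Some (c *\<^sub>C y)"
  unfolding generator_eq_Some_iff
proof (rule Lim_transform_eventually)
  show "((\<lambda>t. c *\<^sub>C ((S t x - x) /\<^sub>R t)) \<longlongrightarrow> c *\<^sub>C y) (at_right 0)"
    using assms by (intro tendsto_scaleC) (simp_all add: generator_eq_Some_iff)
  show "\<forall>\<^sub>F t in at_right 0. c *\<^sub>C ((S t x - x) /\<^sub>R t) = (S t (c *\<^sub>C x) - c *\<^sub>C x) /\<^sub>R t"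
    using eventually_at_right_less[of "0::real"]
    by eventually_elim (simp add: scaleC scaleC_diff_right scaleR_scaleC scaleC_scaleC mult.commute)
qed

lemma dom_dense: "closure (dom (generator S)) = UNIV"
proof -
  have "x \<in> closure (dom (generator S))" for x
  proof (rule Lim_in_closed_set)
    show "((\<lambda>h. J h x /\<^sub>R h) \<longlongrightarrow> x) (at_right 0)" by (rule J_average)
    have "J h x /\<^sub>R h \<in> dom (generator S)" if "0 < h" for h
      using generator_scaleC[OF generator_J, of h "complex_of_real (inverse h)" x] that
      by (auto simp: scaleR_scaleC dom_def)
    then show "\<forall>\<^sub>F h in at_right 0. J h x /\<^sub>R h \<in> closure (dom (generator S))"
      using eventually_at_right_less[of "0::real"] closure_subset
      by (auto elim!: eventually_mono)
  qed auto
  then show ?thesis by auto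
qed

end

section \<open>The adjoint semigroup\<close>

lemma cinner_eq_if_inner_eq:
  assumes D: "complex_vector.subspace D"
    and f: "\<And>c x. x \<in> D \<Longrightarrow> f (c *\<^sub>C x) = c *\<^sub>C f x"
    and eq: "\<And>x. x \<in> D \<Longrightarrow> inner (f x) z = inner x w" and x: "x \<in> D"
  shows "cinner (f x) z = cinner x w"
proof (rule complex_eqI)
  show "Re (cinner (f x) z) = Re (cinner x w)" using eq[OF x] by (simp add: Re_cinner)
  have ix: "(- \<i>) *\<^sub>C x \<in> D" using D x by (simp only: complex_vector.subspace_scale)
  have "Re (cinner (f ((- \<i>) *\<^sub>C x)) z) = Re (cinner ((- \<i>) *\<^sub>C x) w)"
    using eq[OF ix] by (simp only: Re_cinner)
  then show "Im (cinner (f x) z) = Im (cinner x w)"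
    unfolding f[OF x] cinner_scaleC_left by simp
qed

text \<open>Riesz's theorem produces the representing vector, so that the definite description defining
\<open>bounded_adj\<close> is proper.\<close>

lemma cinner_bounded_adj:
  assumes f: "bounded_clinear f"
  shows "cinner (f x) z = cinner x (bounded_adj f z)"
proof -
  interpret f: bounded_linear f using f by (simp add: bounded_clinear_def)
  obtain K where K: "\<And>x. norm (f x) \<le> norm x * K" using f.bounded by blast
  have "\<bar>inner (f x) z\<bar> \<le> (K * norm z) * norm x" for x
  proof -
    have "\<bar>inner (f x) z\<bar> \<le> norm (f x) * norm z" by (rule Cauchy_Schwarz_ineq2)
    also have "\<dots> \<le> (norm x * K) * norm z" by (intro mult_right_mono K) simp
    finally show ?thesis by (simp add: ac_simps)
  qed
  then obtain w where "\<And>x. inner w x = inner (f x) z"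
    using riesz_on_subspace[of UNIV "\<lambda>x. inner (f x) z" "K * norm z"]
    by (auto simp: f.add f.scaleR inner_add_left)
  then have w: "cinner (f x) z = cinner x w" for x
    using cinner_eq_if_inner_eq[of UNIV f z w x] f complex_vector.subspace_UNIV
    by (auto simp: inner_commute bounded_clinear_def)
  have "bounded_adj f z = w"
    unfolding bounded_adj_def
  proof (rule the_equality)
    fix v assume "\<forall>x. cinner (f x) z = cinner x v"
    then have "inner x v = inner x w" for x using w by (metis Re_cinner)
    then show "v = w" by (rule cinner_eqI)
  qed (use w in blast)
  with w show ?thesis by simp
qed

lemma bounded_adj_eqI:
  assumes "bounded_clinear f" "\<And>x. cinner (f x) z = cinner x w"
  shows "bounded_adj f z = w"
  by (rule cinner_eqI) (metis Re_cinner assms cinner_bounded_adj)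

lemma bounded_clinear_bounded_adj:
  assumes f: "bounded_clinear f" and K: "\<And>x. norm (f x) \<le> K * norm x" and K0: "0 \<le> K"
  shows "bounded_clinear (bounded_adj f)" and "norm (bounded_adj f z) \<le> K * norm z"
proof -
  have bd: "norm (bounded_adj f z) \<le> K * norm z" for z
  proof (cases "bounded_adj f z = 0")
    case False
    let ?v = "bounded_adj f z"
    have "norm ?v * norm ?v = Re (cinner (f ?v) z)"
      by (simp add: cinner_bounded_adj[OF f] cinner_self power2_eq_square)
    also have "\<dots> \<le> norm (f ?v) * norm z"
      using norm_cinner_le complex_Re_le_cmod order_trans by blast
    also have "\<dots> \<le> (K * norm ?v) * norm z" by (intro mult_right_mono K) simp
    finally have "norm ?v * norm ?v \<le> norm ?v * (K * norm z)" by (simp add: ac_simps)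
    with False show ?thesis by simp
  next
    case True
    with K0 show ?thesis by simp
  qed
  then show "norm (bounded_adj f z) \<le> K * norm z" by blast
  have add: "bounded_adj f (x + y) = bounded_adj f x + bounded_adj f y" for x y
    by (rule bounded_adj_eqI[OF f]) (simp add: cinner_add_right cinner_bounded_adj[OF f])
  have scale: "bounded_adj f (c *\<^sub>C x) = c *\<^sub>C bounded_adj f x" for c x
    by (rule bounded_adj_eqI[OF f]) (simp add: cinner_scaleC_right cinner_bounded_adj[OF f])
  have "bounded_linear (bounded_adj f)"
    by (rule bounded_linear_intro[of _ K]) (use bd in \<open>simp_all add: add scale scaleR_scaleC mult.commute\<close>)
  with scale show "bounded_clinear (bounded_adj f)" by (simp add: bounded_clinear_def)
qed

text \<open>Density of the domain makes the vector \<open>w\<close> unique, which justifies the definite description in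
\<open>adj\<close>.\<close>

lemma adj_eq_Some_iff:
  assumes dense: "closure (dom A) = UNIV"
  shows "adj A z = Some w \<longleftrightarrow> (\<forall>x\<in>dom A. cinner (the (A x)) z = cinner x w)"
proof -
  have uniq: "w = w'" if w: "\<forall>x\<in>dom A. cinner (the (A x)) z = cinner x w"
      and w': "\<forall>x\<in>dom A. cinner (the (A x)) z = cinner x w'" for w w'
  proof -
    have "inner (w - w') x = 0" if "x \<in> dom A" for x
    proof -
      have "cinner x w = cinner x w'" using w w' \<open>x \<in> dom A\<close> by metis
      then have "inner x w = inner x w'" by (metis Re_cinner)
      then show ?thesis by (simp add: inner_diff_left inner_commute[of w x] inner_commute[of w' x])
    qed
    then have "w - w' = 0" by (rule eq_zero_if_orthogonal_dense[OF dense])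
    then show ?thesis by simp
  qed
  show ?thesis
  proof
    assume R: "\<forall>x\<in>dom A. cinner (the (A x)) z = cinner x w"
    then have "(THE w. \<forall>x\<in>dom A. cinner (the (A x)) z = cinner x w) = w"
      by (rule the_equality) (rule uniq[OF _ R])
    with R show "adj A z = Some w" unfolding adj_def by auto
  next
    assume L: "adj A z = Some w"
    then obtain v where v: "\<forall>x\<in>dom A. cinner (the (A x)) z = cinner x v"
      unfolding adj_def by (auto split: if_splits)
    then have "(THE w. \<forall>x\<in>dom A. cinner (the (A x)) z = cinner x w) = v"
      by (rule the_equality) (rule uniq[OF _ v])
    then have "adj A z = Some v" using v unfolding adj_def by auto
    with v L show "\<forall>x\<in>dom A. cinner (the (A x)) z = cinner x w" by simp
  qed
qed

locale hilbert_semigroup = semigroup S for S :: "real \<Rightarrow> 'h::complex_hilbert \<Rightarrow> 'h"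
begin

abbreviation "A \<equiv> generator S"

text \<open>The adjoint semigroup \<open>S\<^sup>*\<close>.\<close>

definition R :: "real \<Rightarrow> 'h \<Rightarrow> 'h" where
  "R t = bounded_adj (S t)"

lemma clinear: "t \<ge> 0 \<Longrightarrow> bounded_clinear (S t)"
  using C0 by (simp add: C0_semigroup_def)

lemma cinner_R: "t \<ge> 0 \<Longrightarrow> cinner (S t x) z = cinner x (R t z)"
  unfolding R_def by (rule cinner_bounded_adj[OF clinear])

lemma R_eqI: "t \<ge> 0 \<Longrightarrow> (\<And>x. cinner (S t x) z = cinner x w) \<Longrightarrow> R t z = w"
  unfolding R_def by (rule bounded_adj_eqI[OF clinear])

lemma R_bounded: "\<exists>M\<ge>1. \<forall>t\<in>{0..T}. \<forall>z. norm (R t z) \<le> M * norm z"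
proof -
  obtain M where M: "M \<ge> 1" "\<And>s x. 0 \<le> s \<Longrightarrow> s \<le> T \<Longrightarrow> norm (S s x) \<le> M * norm x"
    using bounded_on_interval by (metis atLeastAtMost_iff)
  then show ?thesis
    unfolding R_def by (intro exI[of _ M]) (auto intro!: bounded_clinear_bounded_adj(2) clinear)
qed

lemma R_clinear: "t \<ge> 0 \<Longrightarrow> bounded_clinear (R t)"
proof -
  assume t: "t \<ge> 0"
  obtain M where "M \<ge> 1" "\<And>x. norm (S t x) \<le> M * norm x"
    using bounded_on_interval[of t] t by (meson atLeastAtMost_iff order_refl)
  then show ?thesis
    unfolding R_def by (intro bounded_clinear_bounded_adj(1)[OF clinear[OF t], of M]) auto
qed

lemma J_clinear: "t \<ge> 0 \<Longrightarrow> bounded_clinear (J t)"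
proof -
  assume t: "t \<ge> 0"
  have "J t (c *\<^sub>C x) = c *\<^sub>C J t x" for c x
  proof -
    have "J t (c *\<^sub>C x) = integral {0..t} ((\<lambda>v. c *\<^sub>C v) \<circ> (\<lambda>s. S s x))"
      unfolding J_def by (intro Henstock_Kurzweil_Integration.integral_cong) (simp add: scaleC)
    also have "\<dots> = c *\<^sub>C J t x"
      unfolding J_def by (rule integral_linear[OF integrable bounded_linear_scaleC]) simp
    finally show ?thesis .
  qed
  with bounded_linear_J[OF t] show ?thesis by (simp add: bounded_clinear_def)
qed

lemma adj_iff: "adj A z = Some w \<longleftrightarrow> (\<forall>x y. A x = Some y \<longrightarrow> cinner y z = cinner x w)"
  unfolding adj_eq_Some_iff[OF dom_dense] by (auto simp: dom_def)

text \<open>The weak form of \<open>S\<^sup>*(t) z - z = \<integral>\<^sub>0\<^sup>t S\<^sup>*(s) A\<^sup>* z ds\<close>.\<close>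

lemma cinner_R_diff:
  assumes z: "adj A z = Some w" and t: "0 \<le> t"
  shows "cinner x (R t z - z) = cinner (J t x) w"
proof -
  have "cinner (S t x - x) z = cinner (J t x) w"
    using z generator_J[OF t, of x] by (auto simp: adj_iff)
  then show ?thesis by (simp add: cinner_diff_left cinner_diff_right cinner_R t)
qed

text \<open>Taking adjoints in \<open>J t (A x) = S t x - x\<close>: the adjoint of \<open>J t\<close> maps into \<open>D(A\<^sup>*)\<close>.\<close>

lemma adj_bounded_adj_J:
  assumes t: "0 \<le> t"
  shows "adj A (bounded_adj (J t) z) = Some (R t z - z)"
  unfolding adj_iff
proof (intro allI impI)
  fix x y assume x: "A x = Some y"
  have "cinner y (bounded_adj (J t) z) = cinner (S t x - x) z"
    by (simp add: cinner_bounded_adj[OF J_clinear[OF t], symmetric] J_generator[OF x t])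
  also have "\<dots> = cinner x (R t z - z)"
    by (simp add: cinner_diff_left cinner_diff_right cinner_R t)
  finally show "cinner y (bounded_adj (J t) z) = cinner x (R t z - z)" .
qed

lemma adj_subspace: "complex_vector.subspace (dom (adj A))"
  unfolding complex_vector.subspace_def
proof (intro conjI ballI allI)
  show "0 \<in> dom (adj A)" unfolding dom_def by (auto simp: adj_iff intro!: exI[of _ 0])
  show "x + y \<in> dom (adj A)" if "x \<in> dom (adj A)" "y \<in> dom (adj A)" for x y
  proof -
    obtain x' y' where "adj A x = Some x'" "adj A y = Some y'" using \<open>x \<in> _\<close> \<open>y \<in> _\<close> by (auto simp: dom_def)
    then have "adj A (x + y) = Some (x' + y')" by (simp add: adj_iff cinner_add_right)
    then show ?thesis by blast
  qed
  show "c *\<^sub>C x \<in> dom (adj A)" if "x \<in> dom (adj A)" for c x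
  proof -
    obtain x' where "adj A x = Some x'" using \<open>x \<in> _\<close> by (auto simp: dom_def)
    then have "adj A (c *\<^sub>C x) = Some (c *\<^sub>C x')" by (simp add: adj_iff cinner_scaleC_right)
    then show ?thesis by blast
  qed
qed

text \<open>\<open>D(A\<^sup>*)\<close> contains the averages of the orbits of \<open>S\<^sup>*\<close>, which converge weakly; hence it is
  weakly dense, and a weakly dense subspace is dense.\<close>

lemma adj_dense: "closure (dom (adj A)) = UNIV"
proof (rule dense_subspace_if_orthogonal_trivial)
  show "subspace (dom (adj A))" by (intro complex_subspace_imp_real adj_subspace)
  fix x assume x: "\<And>y. y \<in> dom (adj A) \<Longrightarrow> inner x y = 0"
  have "inner (J t x) x = 0" if "t > 0" for t
  proof -
    have "inner x (bounded_adj (J t) x) = 0" using adj_bounded_adj_J[of t x] that by (intro x) auto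
    moreover have "inner (J t x) x = inner x (bounded_adj (J t) x)"
      using cinner_bounded_adj[OF J_clinear, of t x x] that by (metis Re_cinner less_imp_le)
    ultimately show ?thesis by simp
  qed
  then have "\<forall>\<^sub>F t in at_right 0. inner (J t x /\<^sub>R t) x = 0"
    using eventually_at_right_less[of "0::real"] by (auto elim!: eventually_mono)
  moreover have "((\<lambda>t. inner (J t x /\<^sub>R t) x) \<longlongrightarrow> inner x x) (at_right 0)"
    by (rule tendsto_inner[OF J_average tendsto_const])
  ultimately have "((\<lambda>t. 0) \<longlongrightarrow> inner x x) (at_right (0::real))"
    by (rule Lim_transform_eventually[where f = "\<lambda>t. inner (J t x /\<^sub>R t) x", rotated])
  then have "inner x x = 0" by (simp add: tendsto_const_iff)
  then show "x = 0" by simp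
qed

text \<open>A priori the adjoint semigroup is only weakly continuous. For \<open>z \<in> D(A\<^sup>*)\<close> the weak integral
formula bounds \<open>\<parallel>S\<^sup>*(t) z - z\<parallel>\<close> by a multiple of \<open>t\<close>.\<close>

lemma R_tendsto_on_domain:
  assumes z: "adj A z = Some w"
  shows "((\<lambda>t. R t z) \<longlongrightarrow> z) (at_right 0)"
proof -
  obtain M where M: "M \<ge> 1" "\<And>s x. 0 \<le> s \<Longrightarrow> s \<le> 1 \<Longrightarrow> norm (S s x) \<le> M * norm x"
    using bounded_on_interval by (metis atLeastAtMost_iff)
  have le: "norm (R t z - z) \<le> M * norm w * t" if t: "0 < t" "t \<le> 1" for t
  proof (cases "R t z - z = 0")
    case False
    let ?v = "R t z - z"
    have "norm (J t ?v) \<le> M * norm ?v * (t - 0)"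
      unfolding J_def using t M by (intro integral_bound continuous_on_Icc) auto
    then have "norm (J t ?v) * norm w \<le> (M * norm ?v * t) * norm w"
      by (intro mult_right_mono) auto
    moreover have "norm ?v * norm ?v = Re (cinner (J t ?v) w)"
      using cinner_R_diff[OF z, of t ?v] t by (metis Re_complex_of_real cinner_self less_imp_le power2_eq_square)
    moreover have "Re (cinner (J t ?v) w) \<le> norm (J t ?v) * norm w"
      using norm_cinner_le complex_Re_le_cmod order_trans by blast
    ultimately have "norm ?v * norm ?v \<le> norm ?v * (M * norm w * t)" by (simp add: ac_simps)
    with False show ?thesis by simp
  qed (use M t in simp)
  have "((\<lambda>t. norm (R t z - z)) \<longlongrightarrow> 0) (at_right 0)"
  proof (rule tendsto_sandwich[OF _ _ tendsto_const])
    show "((\<lambda>t. M * norm w * t) \<longlongrightarrow> 0) (at_right 0)" by (auto intro!: tendsto_eq_intros)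
    show "\<forall>\<^sub>F t in at_right 0. norm (R t z - z) \<le> M * norm w * t"
      unfolding eventually_at_right_field by (rule exI[of _ 1]) (auto intro!: le)
  qed simp
  then show ?thesis by (simp add: tendsto_norm_zero_iff LIM_zero_iff)
qed

text \<open>Strong continuity passes from the dense subspace \<open>D(A\<^sup>*)\<close> to all vectors, because the operators
\<open>S\<^sup>*(t)\<close> are uniformly bounded for \<open>t \<le> 1\<close>.\<close>

lemma R_tendsto: "((\<lambda>t. R t z) \<longlongrightarrow> z) (at_right 0)"
proof (rule tendstoI)
  fix e :: real assume e: "e > 0"
  obtain M where M: "M \<ge> 1" "\<And>s x. 0 \<le> s \<Longrightarrow> s \<le> 1 \<Longrightarrow> norm (R s x) \<le> M * norm x"
    using R_bounded by (metis atLeastAtMost_iff)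
  have "z \<in> closure (dom (adj A))" by (simp add: adj_dense)
  moreover have "0 < e / (4 * M)" using e M by simp
  ultimately obtain y where y: "y \<in> dom (adj A)" "dist y z < e / (4 * M)"
    unfolding closure_approachable by blast
  have Mn: "M * norm (z - y) < e / 4"
    using y M by (simp add: dist_norm norm_minus_commute field_simps)
  have n: "norm (z - y) < e / 4"
  proof -
    have "1 * norm (z - y) \<le> M * norm (z - y)" using M by (intro mult_right_mono) auto
    with Mn show ?thesis by simp
  qed
  have "\<forall>\<^sub>F t in at_right 0. dist (R t y) y < e / 4"
    using y R_tendsto_on_domain e by (intro tendstoD) auto
  moreover have "\<forall>\<^sub>F t in at_right 0. (0::real) < t \<and> t < 1"
    unfolding eventually_at_right_field by (rule exI[of _ 1]) auto
  ultimately show "\<forall>\<^sub>F t in at_right 0. dist (R t z) z < e"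
  proof eventually_elim
    case (elim t)
    interpret Rt: bounded_linear "R t" using R_clinear[of t] elim by (simp add: bounded_clinear_def)
    have "R t z - z = R t (z - y) + (R t y - y) - (z - y)" by (simp add: Rt.diff)
    then have "norm (R t z - z) \<le> norm (R t (z - y) + (R t y - y)) + norm (z - y)"
      using norm_triangle_ineq4 by metis
    also have "\<dots> \<le> norm (R t (z - y)) + norm (R t y - y) + norm (z - y)"
      by (intro add_right_mono norm_triangle_ineq)
    also have "\<dots> \<le> M * norm (z - y) + norm (R t y - y) + norm (z - y)"
      using M(2)[of t "z - y"] elim by simp
    also have "\<dots> < e / 4 + e / 4 + e / 4"
      using Mn n elim by (intro add_strict_mono) (auto simp: dist_norm)
    also have "\<dots> < e" using e by simp
    finally show ?case by (simp add: dist_norm)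
  qed
qed

lemma C0_R: "C0_semigroup R"
  unfolding C0_semigroup_def
proof (intro conjI allI impI)
  show "R 0 x = x" for x by (rule R_eqI) auto
  show "R (s + t) x = R s (R t x)" if "0 \<le> s" "0 \<le> t" for s t x
  proof (rule R_eqI)
    show "cinner (S (s + t) y) x = cinner y (R s (R t x))" for y
      using add[of t s y] that by (simp add: cinner_R add.commute)
  qed (use that in simp)
qed (auto simp: R_clinear R_tendsto)

sublocale adjoint: semigroup R
  by standard (rule C0_R)

text \<open>That the generator of \<open>S\<^sup>*\<close> is a restriction of \<open>A\<^sup>*\<close> follows by testing the difference quotients
against \<open>D(A)\<close>. For \<open>z \<in> D(A\<^sup>*)\<close> the weak integral formula becomes \<open>S\<^sup>*(t) z - z = \<integral>\<^sub>0\<^sup>t S\<^sup>*(s) A\<^sup>* z ds\<close>,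
now with a strongly continuous integrand, and this can be differentiated at \<open>0\<close>.\<close>

lemma generator_R: "generator R = adj A"
proof -
  have "generator R z = Some w \<longleftrightarrow> adj A z = Some w" for z w
  proof
    assume z: "generator R z = Some w"
    show "adj A z = Some w" unfolding adj_iff
    proof (intro allI impI)
      fix x y assume x: "A x = Some y"
      have "((\<lambda>h. cinner ((S h x - x) /\<^sub>R h) z) \<longlongrightarrow> cinner y z) (at_right 0)"
        using x by (intro tendsto_cinner tendsto_const) (simp add: generator_eq_Some_iff)
      moreover have "\<forall>\<^sub>F h in at_right 0. cinner ((S h x - x) /\<^sub>R h) z = cinner x ((R h z - z) /\<^sub>R h)"
        using eventually_at_right_less[of "0::real"]
        by eventually_elim
          (simp add: scaleR_scaleC cinner_scaleC_left cinner_scaleC_right cinner_diff_left cinner_diff_right cinner_R)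
      ultimately have "((\<lambda>h. cinner x ((R h z - z) /\<^sub>R h)) \<longlongrightarrow> cinner y z) (at_right 0)"
        by (rule Lim_transform_eventually)
      moreover have "((\<lambda>h. cinner x ((R h z - z) /\<^sub>R h)) \<longlongrightarrow> cinner x w) (at_right 0)"
        using z by (intro tendsto_cinner tendsto_const) (simp add: generator_eq_Some_iff)
      ultimately show "cinner y z = cinner x w"
        using tendsto_unique trivial_limit_at_right_real by blast
    qed
  next
    assume z: "adj A z = Some w"
    have eq: "R t z - z = adjoint.J t w" if t: "0 \<le> t" for t
    proof (rule cinner_eqI)
      fix x
      have "inner x (R t z - z) = inner (J t x) w"
        using cinner_R_diff[OF z t, of x] by (metis Re_cinner)
      also have "\<dots> = integral {0..t} (\<lambda>s. inner (S s x) w)"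
        unfolding J_def by (rule integral_linear[OF integrable bounded_linear_inner_left, symmetric, unfolded o_def]) simp
      also have "\<dots> = integral {0..t} (\<lambda>s. inner x (R s w))"
        by (intro Henstock_Kurzweil_Integration.integral_cong) (metis Re_cinner cinner_R atLeastAtMost_iff)
      also have "\<dots> = inner x (adjoint.J t w)"
        unfolding adjoint.J_def by (rule integral_linear[OF adjoint.integrable bounded_linear_inner_right, unfolded o_def]) simp
      finally show "inner x (R t z - z) = inner x (adjoint.J t w)" .
    qed
    show "generator R z = Some w" unfolding generator_eq_Some_iff
    proof (rule Lim_transform_eventually[OF adjoint.J_average])
      show "\<forall>\<^sub>F h in at_right 0. adjoint.J h w /\<^sub>R h = (R h z - z) /\<^sub>R h"
        using eventually_at_right_less[of "0::real"] by eventually_elim (simp add: eq)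
    qed
  qed
  then show ?thesis by (intro ext) (metis not_Some_eq)
qed

end

section \<open>Square integrable functions with values in a Hilbert space\<close>

lemma complete_lebesgue_on:
  assumes I: "I \<in> sets lebesgue" shows "complete_measure (lebesgue_on I)"
proof
  fix A B assume "B \<subseteq> A" "A \<in> null_sets (lebesgue_on I)"
  then have "B \<subseteq> I" "B \<in> null_sets lebesgue"
    using I by (auto simp: null_sets_restrict_space intro: complete_measure.complete2[OF completion.complete_measure_axioms])
  then show "B \<in> sets (lebesgue_on I)" using I by (auto simp: sets_restrict_space_iff null_sets_def)
qed

text \<open>The hypothesis on \<open>h\<close> is joint sequential continuity; it is applied to the inner product and to the
squared norm.\<close>

lemma strongly_measurable_compose2:
  assumes u: "strongly_measurable M u" and v: "strongly_measurable M v"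
    and h: "\<And>s t a b. s \<longlonglongrightarrow> a \<Longrightarrow> t \<longlonglongrightarrow> b \<Longrightarrow> (\<lambda>n. h (s n) (t n)) \<longlonglongrightarrow> h a b"
  shows "strongly_measurable M (\<lambda>x. h (u x) (v x))"
proof -
  obtain s where s: "\<And>n. simple_function M (s n)" "AE x in M. (\<lambda>n. s n x) \<longlonglongrightarrow> u x"
    using u unfolding strongly_measurable_def by blast
  obtain t where t: "\<And>n. simple_function M (t n)" "AE x in M. (\<lambda>n. t n x) \<longlonglongrightarrow> v x"
    using v unfolding strongly_measurable_def by blast
  have "simple_function M (\<lambda>x. h (s n x) (t n x))" for n
    by (rule simple_function_compose2[OF s(1) t(1)])
  moreover have "AE x in M. (\<lambda>n. h (s n x) (t n x)) \<longlonglongrightarrow> h (u x) (v x)"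
    using s(2) t(2) by eventually_elim (rule h)
  ultimately show ?thesis
    unfolding strongly_measurable_def by (intro exI[of _ "\<lambda>n x. h (s n x) (t n x)"]) auto
qed

lemma measurable_if_AE_eq:
  assumes M: "complete_measure M" and g: "g \<in> measurable M N" and eq: "AE x in M. f x = g x"
    and f: "f \<in> space M \<rightarrow> space N"
  shows "f \<in> measurable M N"
proof (rule measurableI)
  fix A assume A: "A \<in> sets N"
  show "f -` A \<inter> space M \<in> sets M"
  proof (rule complete_measure.in_sets_AE[OF M])
    show "g -` A \<inter> space M \<in> sets M" using g A by (rule measurable_sets)
    show "AE x in M. (x \<in> g -` A \<inter> space M) = (x \<in> f -` A \<inter> space M)"
      using eq by eventually_elim auto
  qed auto
qed (use f in auto)

text \<open>The approximating simple functions converge only almost everywhere, so that completeness of the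
measure is used to pass from their limit to \<open>f\<close>.\<close>

lemma strongly_measurable_imp_borel:
  fixes f :: "'a \<Rightarrow> 'b::{second_countable_topology,real_normed_vector}"
  assumes M: "complete_measure M" and f: "strongly_measurable M f"
  shows "f \<in> borel_measurable M"
proof -
  obtain s where s: "\<And>n. simple_function M (s n)" "AE x in M. (\<lambda>n. s n x) \<longlonglongrightarrow> f x"
    using f unfolding strongly_measurable_def by blast
  obtain N where N: "N \<in> null_sets M" "\<And>x. x \<in> space M - N \<Longrightarrow> (\<lambda>n. s n x) \<longlonglongrightarrow> f x"
    by (rule AE_E3[OF s(2)], rule that)
  define g where "g x = indicator (space M - N) x *\<^sub>R f x" for x
  have "g \<in> borel_measurable M"
  proof (rule borel_measurable_LIMSEQ_metric)
    show "(\<lambda>x. indicator (space M - N) x *\<^sub>R s n x) \<in> borel_measurable M" for n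
      using N(1) borel_measurable_simple_function[OF s(1)]
      by (intro borel_measurable_scaleR borel_measurable_indicator) auto
    show "(\<lambda>n. indicator (space M - N) x *\<^sub>R s n x) \<longlonglongrightarrow> g x" if "x \<in> space M" for x
      using N(2)[of x] that by (cases "x \<in> N") (auto simp: g_def)
  qed
  moreover have "AE x in M. f x = g x"
    using AE_not_in[OF N(1)] AE_space by eventually_elim (auto simp: g_def)
  ultimately show ?thesis by (rule measurable_if_AE_eq[OF M]) auto
qed

lemma simple_function_subspace:
  assumes "simple_function (lebesgue_on I) s" "J \<subseteq> I" "I \<in> sets lebesgue" "J \<in> sets lebesgue"
  shows "simple_function (lebesgue_on J) s"
proof (rule simple_function_comp[where T = "\<lambda>x. x" and M' = "lebesgue_on I"])
  show "(\<lambda>x. x) \<in> lebesgue_on J \<rightarrow>\<^sub>M lebesgue_on I"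
    using assms by (auto intro!: measurable_restrict_space3)
qed fact

lemma simple_function_extend_zero:
  assumes s: "simple_function (lebesgue_on J) s" and J: "J \<subseteq> I" "I \<in> sets lebesgue" "J \<in> sets lebesgue"
  shows "simple_function (lebesgue_on I) (\<lambda>x. if x \<in> J then s x else 0)"
proof -
  have fin: "finite (s ` J)" using s by (simp add: simple_function_def)
  have "(\<lambda>x. if x \<in> J then s x else 0) -` {y} \<inter> I \<in> sets lebesgue" for y
  proof -
    have "s -` {y} \<inter> J \<in> sets lebesgue"
    proof (cases "y \<in> s ` J")
      case True
      then show ?thesis using s J by (auto simp: simple_function_def sets_restrict_space_iff)
    next
      case False
      then have "s -` {y} \<inter> J = {}" by auto
      then show ?thesis by simp
    qed
    moreover have "(\<lambda>x. if x \<in> J then s x else 0) -` {y} \<inter> I = (s -` {y} \<inter> J) \<union> (if y = 0 then I - J else {})"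
      using J by (auto split: if_splits)
    ultimately show ?thesis using J by auto
  qed
  moreover have "finite ((\<lambda>x. if x \<in> J then s x else 0) ` I)"
    by (rule finite_subset[of _ "insert 0 (s ` J)"]) (use fin in auto)
  ultimately show ?thesis using J by (auto simp: simple_function_def sets_restrict_space_iff)
qed

lemma AE_lebesgue_on: "I \<in> sets lebesgue \<Longrightarrow> (AE x in lebesgue_on I. P x) \<longleftrightarrow> (AE x in lebesgue. x \<in> I \<longrightarrow> P x)"
  by (rule AE_restrict_space_iff) simp

text \<open>Restriction to a subset and extension by zero are inverse to each other as far as integrals go. The
spaces over \<open>(0, T)\<close> and over \<open>(0, \<infinity>)\<close> are compared in this way throughout.\<close>

lemma integrable_lebesgue_on_extend_zero:
  fixes f :: "real \<Rightarrow> 'b::{banach, second_countable_topology}"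
  assumes "J \<subseteq> I" "I \<in> sets lebesgue" "J \<in> sets lebesgue"
  shows "integrable (lebesgue_on I) (\<lambda>x. if x \<in> J then f x else 0) \<longleftrightarrow> integrable (lebesgue_on J) f"
    and "(LINT x|lebesgue_on I. (if x \<in> J then f x else 0)) = (LINT x|lebesgue_on J. f x)"
proof -
  have eq: "indicator I x *\<^sub>R (if x \<in> J then f x else 0) = indicator J x *\<^sub>R f x" for x
    using assms by (auto simp: indicator_def)
  show "integrable (lebesgue_on I) (\<lambda>x. if x \<in> J then f x else 0) \<longleftrightarrow> integrable (lebesgue_on J) f"
    and "(LINT x|lebesgue_on I. (if x \<in> J then f x else 0)) = (LINT x|lebesgue_on J. f x)"
    using assms by (simp_all add: integrable_restrict_space integral_restrict_space eq)
qed

lemma integrable_lebesgue_on_subset: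
  fixes f :: "real \<Rightarrow> 'b::{banach, second_countable_topology}"
  assumes f: "integrable (lebesgue_on I) f" and "J \<subseteq> I" "I \<in> sets lebesgue" "J \<in> sets lebesgue"
  shows "integrable (lebesgue_on J) f"
proof -
  have "integrable (lebesgue_on I) (\<lambda>x. indicator J x *\<^sub>R f x)"
    using f assms by (intro integrable_mult_indicator) (auto simp: sets_restrict_space_iff)
  moreover have "(\<lambda>x. indicator J x *\<^sub>R f x) = (\<lambda>x. if x \<in> J then f x else 0)"
    by (auto simp: indicator_def)
  ultimately show ?thesis using integrable_lebesgue_on_extend_zero(1)[OF assms(2-4), of f] by simp
qed

lemma L2_subset:
  assumes u: "u \<in> L2 I" and J: "J \<subseteq> I" "I \<in> sets lebesgue" "J \<in> sets lebesgue"
  shows "u \<in> L2 J"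
proof -
  obtain s where s: "\<And>n. simple_function (lebesgue_on I) (s n)" "AE x in lebesgue_on I. (\<lambda>n. s n x) \<longlonglongrightarrow> u x"
    using u unfolding L2_def strongly_measurable_def by blast
  have "AE x in lebesgue_on J. (\<lambda>n. s n x) \<longlonglongrightarrow> u x"
    using s(2) J unfolding AE_lebesgue_on[OF J(2)] AE_lebesgue_on[OF J(3)] by auto
  then have "strongly_measurable (lebesgue_on J) u"
    unfolding strongly_measurable_def using simple_function_subspace[OF s(1) J] by blast
  moreover have "integrable (lebesgue_on J) (\<lambda>t. (norm (u t))\<^sup>2)"
    using u by (intro integrable_lebesgue_on_subset[OF _ J]) (simp add: L2_def)
  ultimately show ?thesis by (simp add: L2_def)
qed

lemma L2_extend_zero:
  assumes u: "u \<in> L2 J" and J: "J \<subseteq> I" "I \<in> sets lebesgue" "J \<in> sets lebesgue"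
  shows "(\<lambda>t. if t \<in> J then u t else 0) \<in> L2 I"
proof -
  obtain s where s: "\<And>n. simple_function (lebesgue_on J) (s n)" "AE x in lebesgue_on J. (\<lambda>n. s n x) \<longlonglongrightarrow> u x"
    using u unfolding L2_def strongly_measurable_def by blast
  have "AE x in lebesgue_on I. (\<lambda>n. if x \<in> J then s n x else 0) \<longlonglongrightarrow> (if x \<in> J then u x else 0)"
    using s(2) J unfolding AE_lebesgue_on[OF J(2)] AE_lebesgue_on[OF J(3)] by auto
  then have "strongly_measurable (lebesgue_on I) (\<lambda>t. if t \<in> J then u t else 0)"
    unfolding strongly_measurable_def using simple_function_extend_zero[OF s(1) J]
    by (intro exI[of _ "\<lambda>n x. if x \<in> J then s n x else 0"]) blast
  moreover have "(\<lambda>t. (norm (if t \<in> J then u t else 0))\<^sup>2) = (\<lambda>t. if t \<in> J then (norm (u t))\<^sup>2 else 0)"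
    by auto
  then have "integrable (lebesgue_on I) (\<lambda>t. (norm (if t \<in> J then u t else 0))\<^sup>2)"
    using u integrable_lebesgue_on_extend_zero(1)[OF J, of "\<lambda>t. (norm (u t))\<^sup>2"] by (simp add: L2_def)
  ultimately show ?thesis by (simp add: L2_def)
qed

lemma Ioo_sets [simp]: "{a<..<b::real} \<in> sets lebesgue" "{a<..} \<in> sets lebesgue"
  by (auto intro: sets_completionI_sets)

text \<open>Sampling a continuous function at the points of a fine grid gives a simple function.\<close>

lemma continuous_simple_approximation:
  fixes f :: "real \<Rightarrow> 'b::real_normed_vector"
  assumes f: "continuous_on {0..T} f" and e: "e > 0"
  shows "\<exists>s. simple_function (lebesgue_on {0<..<T}) s \<and> (\<forall>t\<in>{0<..<T}. norm (s t - f t) < e)"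
proof -
  have "uniformly_continuous_on {0..T} f" using f by (rule compact_uniformly_continuous) simp
  then obtain d where d: "d > 0"
      "\<And>t t'. t \<in> {0..T} \<Longrightarrow> t' \<in> {0..T} \<Longrightarrow> dist t' t < d \<Longrightarrow> dist (f t') (f t) < e"
    using e unfolding uniformly_continuous_on_def by metis
  obtain n where n: "inverse (real (Suc n)) < d" using reals_Archimedean[OF d(1)] by blast
  define k where "k t = \<lfloor>t * real (Suc n)\<rfloor>" for t
  define s where "s t = f (real_of_int (k t) / real (Suc n))" for t
  have "k \<in> measurable lborel (count_space UNIV)" unfolding k_def by measurable
  then have "k \<in> measurable lebesgue (count_space UNIV)" by (rule measurable_completion)
  then have meas: "k \<in> measurable (lebesgue_on {0<..<T}) (count_space UNIV)"
    by (rule measurable_restrict_space1)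
  have "k ` {0<..<T} \<subseteq> {0..\<lfloor>T * real (Suc n)\<rfloor>}"
    unfolding k_def by (auto intro!: floor_mono mult_right_mono simp: zero_le_floor)
  then have "finite (k ` {0<..<T})" by (rule finite_subset) simp
  with meas have "simple_function (lebesgue_on {0<..<T}) k"
    by (simp add: simple_function_eq_measurable)
  then have "simple_function (lebesgue_on {0<..<T}) s"
    unfolding s_def by (rule simple_function_compose1)
  moreover have "norm (s t - f t) < e" if t: "t \<in> {0<..<T}" for t
  proof -
    have k: "real_of_int (k t) \<le> t * real (Suc n)" "t * real (Suc n) < real_of_int (k t) + 1"
      unfolding k_def by linarith+
    have "0 \<le> k t" unfolding k_def using t by (auto simp: zero_le_floor)
    moreover have le: "real_of_int (k t) / real (Suc n) \<le> t" using k(1) by (simp add: field_simps)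
    moreover have "t < real_of_int (k t) / real (Suc n) + inverse (real (Suc n))"
      using k(2) by (simp add: field_simps)
    ultimately have "dist (real_of_int (k t) / real (Suc n)) t < d" using n
      unfolding dist_real_def by linarith
    then show ?thesis unfolding s_def dist_norm[symmetric]
      using le t \<open>0 \<le> k t\<close> by (intro d(2)) auto
  qed
  ultimately show ?thesis by blast
qed

text \<open>Each \<open>f n\<close> is replaced by a simple function at distance at most \<open>1 / (n + 1)\<close>, which does not change
the limit.\<close>

lemma strongly_measurable_limit_of_continuous:
  fixes f :: "nat \<Rightarrow> real \<Rightarrow> 'b::real_normed_vector"
  assumes f: "\<And>n. continuous_on {0..T} (f n)"
    and lim: "AE t in lebesgue_on {0<..<T}. (\<lambda>n. f n t) \<longlonglongrightarrow> u t"
  shows "strongly_measurable (lebesgue_on {0<..<T}) u"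
proof -
  have "\<forall>n. \<exists>s. simple_function (lebesgue_on {0<..<T}) s \<and>
      (\<forall>t\<in>{0<..<T}. norm (s t - f n t) < inverse (real (Suc n)))"
    by (intro allI continuous_simple_approximation f) simp
  then obtain s where s: "\<And>n. simple_function (lebesgue_on {0<..<T}) (s n)"
      "\<And>n t. t \<in> {0<..<T} \<Longrightarrow> norm (s n t - f n t) < inverse (real (Suc n))"
    by metis
  have "AE t in lebesgue_on {0<..<T}. (\<lambda>n. s n t) \<longlonglongrightarrow> u t"
    using lim AE_space
  proof eventually_elim
    case (elim t)
    have "(\<lambda>n. s n t - f n t) \<longlonglongrightarrow> 0"
      using s(2)[of t] elim
      by (intro Lim_null_comparison[OF _ LIMSEQ_inverse_real_of_nat]) (auto intro!: always_eventually less_imp_le)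
    from tendsto_add[OF this elim(1)] show ?case by simp
  qed
  with s(1) show ?thesis unfolding strongly_measurable_def by blast
qed

lemma strongly_measurable_continuous:
  "continuous_on {0..T} f \<Longrightarrow> strongly_measurable (lebesgue_on {0<..<T}) (f :: real \<Rightarrow> 'b::real_normed_vector)"
  by (rule strongly_measurable_limit_of_continuous[of T "\<lambda>n. f"]) auto

lemma integrable_continuous_Ioo:
  fixes f :: "real \<Rightarrow> 'b::euclidean_space"
  assumes "continuous_on {0..T} f"
  shows "integrable (lebesgue_on {0<..<T}) f"
    and "(LINT t|lebesgue_on {0<..<T}. f t) = integral {0..T} f"
proof -
  show i: "integrable (lebesgue_on {0<..<T}) f"
    by (rule integrable_lebesgue_on_subset[of "{0..T}"])
      (use assms in \<open>auto intro: continuous_imp_integrable_real\<close>)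
  show "(LINT t|lebesgue_on {0<..<T}. f t) = integral {0..T} f"
    using lebesgue_integral_eq_integral[OF i] by (simp add: integral_open_interval_real)
qed

lemma integrable_const_Ioo: "integrable (lebesgue_on {0<..<T::real}) (\<lambda>t. c::real)"
  by (rule integrable_continuous_Ioo) simp

lemma bounded_on_Icc:
  fixes g :: "real \<Rightarrow> 'b::real_normed_vector"
  assumes "continuous_on {0..T} g"
  obtains C where "0 \<le> C" "\<And>t. t \<in> {0..T} \<Longrightarrow> norm (g t) \<le> C"
proof -
  have "bounded (g ` {0..T})" using assms by (intro compact_imp_bounded compact_continuous_image) auto
  then obtain C where "C > 0" "\<And>t. t \<in> {0..T} \<Longrightarrow> norm (g t) \<le> C"
    by (auto simp: bounded_pos)
  with that[of C] show thesis by simp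
qed

lemma measurable_cinner:
  fixes u v :: "real \<Rightarrow> 'u::complex_hilbert"
  assumes "strongly_measurable (lebesgue_on {0<..<T}) u" "strongly_measurable (lebesgue_on {0<..<T}) v"
  shows "(\<lambda>t. cinner (u t) (v t)) \<in> borel_measurable (lebesgue_on {0<..<T})"
  by (intro strongly_measurable_imp_borel complete_lebesgue_on
      strongly_measurable_compose2[OF assms]) (auto intro: tendsto_cinner)

lemma integrable_cinner_continuous:
  fixes u :: "real \<Rightarrow> 'u::complex_hilbert"
  assumes u: "u \<in> L2 {0<..<T}" and v: "continuous_on {0..T} v"
  shows "integrable (lebesgue_on {0<..<T}) (\<lambda>t. cinner (u t) (v t))"
proof -
  obtain C where C: "0 \<le> C" "\<And>t. t \<in> {0..T} \<Longrightarrow> norm (v t) \<le> C" using bounded_on_Icc[OF v] by blast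
  have "integrable (lebesgue_on {0<..<T}) (\<lambda>t. (norm (u t))\<^sup>2 + C\<^sup>2)"
    using u by (intro Bochner_Integration.integrable_add integrable_const_Ioo) (simp add: L2_def)
  then show ?thesis
  proof (rule Bochner_Integration.integrable_bound)
    show "(\<lambda>t. cinner (u t) (v t)) \<in> borel_measurable (lebesgue_on {0<..<T})"
      using u by (intro measurable_cinner strongly_measurable_continuous[OF v]) (simp add: L2_def)
    show "AE t in lebesgue_on {0<..<T}. norm (cinner (u t) (v t)) \<le> norm ((norm (u t))\<^sup>2 + C\<^sup>2)"
      using AE_space
    proof eventually_elim
      case (elim t)
      have "norm (cinner (u t) (v t)) \<le> norm (u t) * C"
        using C(2)[of t] elim by (intro order_trans[OF norm_cinner_le] mult_left_mono) auto
      also have "\<dots> \<le> (norm (u t))\<^sup>2 + C\<^sup>2"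
        using sum_squares_bound[of "norm (u t)" C] mult_nonneg_nonneg[OF norm_ge_zero C(1), of "u t"]
        unfolding mult.assoc by linarith
      finally show ?case by simp
    qed
  qed
qed

text \<open>On a bounded interval a sequence that is geometrically Cauchy in \<open>L\<^sup>2\<close> is absolutely convergent
  in \<open>L\<^sup>1\<close>, hence almost everywhere. Fatou's lemma shows that the limit is square integrable, and the
  sum of the increments dominates the sequence. Continuity makes the terms strongly measurable.\<close>

lemma L2_limit_of_continuous:
  fixes f :: "nat \<Rightarrow> real \<Rightarrow> 'u::complex_hilbert"
  assumes f: "\<And>n. continuous_on {0..T} (f n)"
    and bd: "\<And>n. integral {0..T} (\<lambda>t. (norm (f n t))\<^sup>2) \<le> K"
    and cauchy: "\<And>n. integral {0..T} (\<lambda>t. (norm (f (Suc n) t - f n t))\<^sup>2) \<le> (1/4)^n"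
  obtains u where "u \<in> L2 {0<..<T}"
    and "\<And>g. continuous_on {0..T} g \<Longrightarrow>
      (\<lambda>n. LINT t|lebesgue_on {0<..<T}. cinner (f n t) (g t)) \<longlonglongrightarrow>
      (LINT t|lebesgue_on {0<..<T}. cinner (u t) (g t))"
proof -
  let ?M = "lebesgue_on {0<..<T}"
  define d where "d n t = norm (f (Suc n) t - f n t)" for n t
  have dc: "continuous_on {0..T} (d n)" for n unfolding d_def by (intro continuous_intros f)
  have di: "integrable ?M (d n)" for n by (intro integrable_continuous_Ioo dc)
  have dint: "(LINT t|?M. d n t) \<le> (1 + \<bar>T\<bar>) * (1/2)^n" for n
  proof -
    have d2: "continuous_on {0..T} (\<lambda>t. (d n t)\<^sup>2)" by (intro continuous_intros dc)
    \<comment> \<open>The weights turn the squared bound \<open>(1/4) ^ n\<close> into the summable bound \<open>(1/2) ^ n\<close> in \<open>L\<^sup>1\<close>.\<close>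
    have amgm: "d n t \<le> 2^n * (d n t)\<^sup>2 + (1/2)^n" for t
    proof -
      have "2 * (d n t * (2^n * d n t)) * 1 \<ge> 0" by (simp add: d_def)
      have "0 \<le> (2^n * d n t - 1)\<^sup>2" by simp
      then have "2 * (2^n * d n t) \<le> (2^n * d n t)\<^sup>2 + 1" by (simp add: power2_eq_square algebra_simps)
      moreover have "0 \<le> 2^n * d n t" by (simp add: d_def)
      ultimately have "2^n * d n t \<le> (2^n * d n t)\<^sup>2 + 1" by linarith
      also have "\<dots> = 2^n * (2^n * (d n t)\<^sup>2 + (1/2)^n)"
        by (simp add: power2_eq_square algebra_simps power_one_over)
      finally show ?thesis by simp
    qed
    have "(LINT t|?M. d n t) \<le> (LINT t|?M. 2^n * (d n t)\<^sup>2 + (1/2)^n)"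
      using amgm by (intro integral_mono di integrable_continuous_Ioo continuous_intros d2) auto
    also have "\<dots> = integral {0..T} (\<lambda>t. 2^n * (d n t)\<^sup>2 + (1/2)^n)"
      by (intro integrable_continuous_Ioo continuous_intros d2)
    also have "\<dots> = 2^n * integral {0..T} (\<lambda>t. (d n t)\<^sup>2) + integral {0..T} (\<lambda>t. (1/2)^n)"
      by (subst Henstock_Kurzweil_Integration.integral_add)
        (auto intro!: integrable_continuous_interval continuous_intros d2)
    also have "\<dots> \<le> 2^n * (1/4)^n + \<bar>T\<bar> * (1/2)^n"
      using cauchy[of n] by (intro add_mono mult_left_mono) (auto simp: d_def intro!: mult_right_mono)
    also have "2^n * (1/4)^n = ((1::real)/2)^n" by (simp flip: power_mult_distrib)
    finally show ?thesis by (simp add: algebra_simps)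
  qed
  have dsum: "summable (\<lambda>n. LINT t|?M. d n t)"
  proof (rule summable_comparison_test')
    show "summable (\<lambda>n. (1 + \<bar>T\<bar>) * (1/2)^n)" by (intro summable_mult summable_geometric) simp
    show "norm (LINT t|?M. d n t) \<le> (1 + \<bar>T\<bar>) * (1/2)^n" for n
      using dint[of n] Bochner_Integration.integral_nonneg[of ?M "d n"] by (simp add: d_def)
  qed
  have AEs: "AE t in ?M. summable (\<lambda>n. d n t)"
  proof -
    have "(\<integral>\<^sup>+t. (\<Sum>n. ennreal (d n t)) \<partial>?M) = (\<Sum>n. \<integral>\<^sup>+t. ennreal (d n t) \<partial>?M)"
      using di by (intro nn_integral_suminf) auto
    also have "\<dots> = (\<Sum>n. ennreal (LINT t|?M. d n t))"
      by (intro suminf_cong nn_integral_eq_integral di) (simp add: d_def)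
    also have "\<dots> \<noteq> \<infinity>"
      using dsum by (simp add: ennreal_suminf_neq_top d_def)
    finally have "AE t in ?M. (\<Sum>n. ennreal (d n t)) \<noteq> \<infinity>"
      using di by (intro nn_integral_PInf_AE) auto
    then show ?thesis
      by eventually_elim (auto intro!: summable_suminf_not_top simp: d_def)
  qed
  define h where "h t = (\<Sum>n. d n t)" for t
  have hi: "integrable ?M h"
    unfolding h_def
  proof (rule integrable_suminf[OF di])
    show "AE t in ?M. summable (\<lambda>n. norm (d n t))" using AEs by (simp add: d_def)
    show "summable (\<lambda>n. LINT t|?M. norm (d n t))" using dsum by (simp add: d_def)
  qed
  define u where "u t = lim (\<lambda>n. f n t)" for t
  have partial: "norm (f n t) \<le> norm (f 0 t) + (\<Sum>k<n. d k t)" for n t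
  proof (induction n)
    case (Suc n)
    have "norm (f (Suc n) t) \<le> norm (f n t) + d n t"
      unfolding d_def using norm_triangle_ineq[of "f n t" "f (Suc n) t - f n t"] by simp
    with Suc show ?case by simp
  qed simp
  have lim: "AE t in ?M. (\<lambda>n. f n t) \<longlonglongrightarrow> u t"
    using AEs
  proof eventually_elim
    case (elim t)
    then have "summable (\<lambda>n. f (Suc n) t - f n t)" unfolding d_def by (rule summable_norm_cancel)
    then have "convergent (\<lambda>n. \<Sum>k<n. f (Suc k) t - f k t)" by (simp add: summable_iff_convergent)
    moreover have "(\<Sum>k<n. f (Suc k) t - f k t) = f n t - f 0 t" for n
      by (rule sum_lessThan_telescope[of "\<lambda>k. f k t"])
    ultimately have "convergent (\<lambda>n. f n t - f 0 t)" by simp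
    then have "convergent (\<lambda>n. f n t)" by (simp add: convergent_diff_const_right_iff)
    then show ?case unfolding u_def by (rule convergent_LIMSEQ_iff[THEN iffD1])
  qed
  have sm: "strongly_measurable ?M u" by (rule strongly_measurable_limit_of_continuous[OF f lim])
  have n2: "continuous_on {0..T} (\<lambda>t. (norm (f n t))\<^sup>2)" for n by (intro continuous_intros f)
  have "strongly_measurable ?M (\<lambda>t. (norm (u t))\<^sup>2)"
    by (rule strongly_measurable_compose2[OF sm sm, of "\<lambda>a b. (norm a)\<^sup>2"]) (intro tendsto_power tendsto_norm)
  then have um: "(\<lambda>t. (norm (u t))\<^sup>2) \<in> borel_measurable ?M"
    by (intro strongly_measurable_imp_borel complete_lebesgue_on) auto
  have "integrable ?M (\<lambda>t. (norm (u t))\<^sup>2)"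
  proof (rule integrableI_bounded[OF um])
    have "(\<integral>\<^sup>+t. ennreal (norm ((norm (u t))\<^sup>2)) \<partial>?M) = (\<integral>\<^sup>+t. liminf (\<lambda>n. ennreal ((norm (f n t))\<^sup>2)) \<partial>?M)"
      using lim
    proof (intro nn_integral_cong_AE, eventually_elim)
      case (elim t)
      then have "(\<lambda>n. ennreal ((norm (f n t))\<^sup>2)) \<longlonglongrightarrow> ennreal ((norm (u t))\<^sup>2)"
        by (intro tendsto_ennrealI tendsto_power tendsto_norm)
      from lim_imp_Liminf[OF _ this] show ?case by simp
    qed
    also have "\<dots> \<le> liminf (\<lambda>n. \<integral>\<^sup>+t. ennreal ((norm (f n t))\<^sup>2) \<partial>?M)"
      using integrable_continuous_Ioo(1)[OF n2] by (intro nn_integral_liminf) auto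
    also have "\<dots> \<le> limsup (\<lambda>n. \<integral>\<^sup>+t. ennreal ((norm (f n t))\<^sup>2) \<partial>?M)"
      by (intro Liminf_le_Limsup) simp
    also have "\<dots> \<le> ennreal K"
    proof (intro Limsup_bounded always_eventually allI)
      fix n
      show "(\<integral>\<^sup>+t. ennreal ((norm (f n t))\<^sup>2) \<partial>?M) \<le> ennreal K"
        using bd[of n] by (simp add: nn_integral_eq_integral[OF integrable_continuous_Ioo(1)[OF n2]]
            integrable_continuous_Ioo(2)[OF n2] ennreal_leI)
    qed
    also have "\<dots> < \<infinity>" by simp
    finally show "(\<integral>\<^sup>+t. ennreal (norm ((norm (u t))\<^sup>2)) \<partial>?M) < \<infinity>" .
  qed
  with sm have uL: "u \<in> L2 {0<..<T}" by (simp add: L2_def)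
  show thesis
  proof (rule that[OF uL])
    fix g :: "real \<Rightarrow> 'u" assume g: "continuous_on {0..T} g"
    obtain C where C: "0 \<le> C" "\<And>t. t \<in> {0..T} \<Longrightarrow> norm (g t) \<le> C" using bounded_on_Icc[OF g] by blast
    have gm: "strongly_measurable ?M g" by (rule strongly_measurable_continuous[OF g])
    show "(\<lambda>n. LINT t|?M. cinner (f n t) (g t)) \<longlonglongrightarrow> (LINT t|?M. cinner (u t) (g t))"
    proof (rule integral_dominated_convergence)
      show "(\<lambda>t. cinner (u t) (g t)) \<in> borel_measurable ?M" by (rule measurable_cinner[OF sm gm])
      show "(\<lambda>t. cinner (f n t) (g t)) \<in> borel_measurable ?M" for n
        by (rule measurable_cinner[OF strongly_measurable_continuous[OF f] gm])
      show "integrable ?M (\<lambda>t. (norm (f 0 t) + h t) * C)"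
        by (intro integrable_mult_left Bochner_Integration.integrable_add hi integrable_continuous_Ioo
            continuous_intros f)
      show "AE t in ?M. (\<lambda>n. cinner (f n t) (g t)) \<longlonglongrightarrow> cinner (u t) (g t)"
        using lim by eventually_elim (intro tendsto_cinner tendsto_const)
      show "AE t in ?M. norm (cinner (f n t) (g t)) \<le> (norm (f 0 t) + h t) * C" for n
        using AEs AE_space
      proof eventually_elim
        case (elim t)
        have "(\<Sum>k<n. d k t) \<le> h t"
          unfolding h_def by (rule sum_le_suminf[OF elim(1)]) (auto simp: d_def)
        then have "norm (f n t) \<le> norm (f 0 t) + h t" using partial[of n t] by linarith
        moreover have "norm (g t) \<le> C" using elim by (intro C) auto
        ultimately have "norm (f n t) * norm (g t) \<le> (norm (f 0 t) + h t) * C"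
          using C(1) by (intro mult_mono) (auto intro: order_trans[OF norm_ge_zero])
        then show ?case using norm_cinner_le order_trans by blast
      qed
    qed
  qed
qed

lemma distr_shift_lebesgue_on:
  fixes c :: real
  assumes I: "I \<in> sets lebesgue"
  shows "(\<lambda>x. x + c) \<in> lebesgue_on {x. x + c \<in> I} \<rightarrow>\<^sub>M lebesgue_on I"
    and "distr (lebesgue_on {x. x + c \<in> I}) (lebesgue_on I) (\<lambda>x. x + c) = lebesgue_on I"
proof -
  have im: "{x. x + c \<in> B} = (+) (- c) ` B" for B
  proof (intro set_eqI iffI)
    fix x assume "x \<in> {x. x + c \<in> B}"
    then show "x \<in> (+) (- c) ` B" by (intro image_eqI[of x "(+) (- c)" "x + c"]) auto
  qed auto
  have J: "{x. x + c \<in> B} \<in> sets lebesgue" if "B \<in> sets lebesgue" for B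
    unfolding im by (rule lebesgue_sets_translation[OF that])
  show meas: "(\<lambda>x. x + c) \<in> lebesgue_on {x. x + c \<in> I} \<rightarrow>\<^sub>M lebesgue_on I"
  proof (rule measurableI)
    fix B assume "B \<in> sets (lebesgue_on I)"
    then have B: "B \<in> sets lebesgue" "B \<subseteq> I" using I by (auto simp: sets_restrict_space_iff)
    have "(\<lambda>x. x + c) -` B \<inter> space (lebesgue_on {x. x + c \<in> I}) = {x. x + c \<in> B}"
      using B by auto
    then show "(\<lambda>x. x + c) -` B \<inter> space (lebesgue_on {x. x + c \<in> I}) \<in> sets (lebesgue_on {x. x + c \<in> I})"
      using J[OF B(1)] J[OF I] B(2) by (auto simp: sets_restrict_space_iff)
  qed auto
  show "distr (lebesgue_on {x. x + c \<in> I}) (lebesgue_on I) (\<lambda>x. x + c) = lebesgue_on I"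
  proof (rule measure_eqI)
    fix B assume "B \<in> sets (distr (lebesgue_on {x. x + c \<in> I}) (lebesgue_on I) (\<lambda>x. x + c))"
    then have BI: "B \<in> sets (lebesgue_on I)" by simp
    then have B: "B \<in> sets lebesgue" "B \<subseteq> I" using I by (auto simp: sets_restrict_space_iff)
    have eq: "(\<lambda>x. x + c) -` B \<inter> space (lebesgue_on {x. x + c \<in> I}) = {x. x + c \<in> B}"
      using B by auto
    have "emeasure lebesgue {x. x + c \<in> B} = emeasure lebesgue B"
    proof -
      have "(+) (- c) ` B = (\<lambda>x. 1 *\<^sub>R x + (- c)) ` B" by (intro image_cong) auto
      then show ?thesis unfolding im using emeasure_lebesgue_affine[of 1 "- c" B] by simp
    qed
    moreover have "{x. x + c \<in> B} \<subseteq> {x. x + c \<in> I}" using B by auto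
    ultimately show "emeasure (distr (lebesgue_on {x. x + c \<in> I}) (lebesgue_on I) (\<lambda>x. x + c)) B = emeasure (lebesgue_on I) B"
      using B J[OF I] I by (subst emeasure_distr[OF meas BI], subst eq) (simp add: emeasure_restrict_space)
  qed simp
qed

lemma integral_shift_lebesgue_on:
  fixes f :: "real \<Rightarrow> 'b::{banach, second_countable_topology}"
  assumes I: "I \<in> sets lebesgue" and f: "integrable (lebesgue_on I) f"
  shows "integrable (lebesgue_on {x. x + c \<in> I}) (\<lambda>x. f (x + c))"
    and "(LINT x|lebesgue_on {x. x + c \<in> I}. f (x + c)) = (LINT x|lebesgue_on I. f x)"
proof -
  note distr = distr_shift_lebesgue_on[OF I, of c]
  have "integrable (distr (lebesgue_on {x. x + c \<in> I}) (lebesgue_on I) (\<lambda>x. x + c)) f"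
    unfolding distr(2) by (rule f)
  then show "integrable (lebesgue_on {x. x + c \<in> I}) (\<lambda>x. f (x + c))"
    by (rule integrable_distr[OF distr(1)])
  show "(LINT x|lebesgue_on {x. x + c \<in> I}. f (x + c)) = (LINT x|lebesgue_on I. f x)"
    using integral_distr[OF distr(1), of f] f unfolding distr(2) by simp
qed

lemma L2_shift:
  fixes u :: "real \<Rightarrow> 'u::real_normed_vector"
  assumes I: "I \<in> sets lebesgue" and u: "u \<in> L2 I"
  shows "(\<lambda>x. u (x + c)) \<in> L2 {x. x + c \<in> I}"
proof -
  note distr = distr_shift_lebesgue_on[OF I, of c]
  obtain s where s: "\<And>n. simple_function (lebesgue_on I) (s n)" "AE x in lebesgue_on I. (\<lambda>n. s n x) \<longlonglongrightarrow> u x"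
    using u unfolding L2_def strongly_measurable_def by blast
  have "simple_function (lebesgue_on {x. x + c \<in> I}) (\<lambda>x. s n (x + c))" for n
    by (rule simple_function_comp[OF distr(1) s(1)])
  moreover have "AE x in lebesgue_on {x. x + c \<in> I}. (\<lambda>n. s n (x + c)) \<longlonglongrightarrow> u (x + c)"
  proof -
    have "{x \<in> space (lebesgue_on I). (\<lambda>n. s n x) \<longlonglongrightarrow> u x} \<in> sets (lebesgue_on I)"
      by (rule complete_measure.in_sets_AE[OF complete_lebesgue_on[OF I], of "space (lebesgue_on I)"])
        (use s(2) AE_space in \<open>auto elim!: eventually_mono\<close>)
    then show ?thesis
      using s(2) AE_distr_iff[OF distr(1), of "\<lambda>x. (\<lambda>n. s n x) \<longlonglongrightarrow> u x"] unfolding distr(2) by simp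
  qed
  ultimately have "strongly_measurable (lebesgue_on {x. x + c \<in> I}) (\<lambda>x. u (x + c))"
    unfolding strongly_measurable_def by (intro exI[of _ "\<lambda>n x. s n (x + c)"]) auto
  moreover have "integrable (lebesgue_on {x. x + c \<in> I}) (\<lambda>x. (norm (u (x + c)))\<^sup>2)"
    using u by (intro integral_shift_lebesgue_on(1)[OF I, of "\<lambda>x. (norm (u x))\<^sup>2"]) (simp add: L2_def)
  ultimately show ?thesis by (simp add: L2_def)
qed

section \<open>The observation operator and the output\<close>

context hilbert_semigroup
begin

text \<open>The domain \<open>D(A\<^sup>*)\<close>, as a constant of its own so that membership is not expanded into the
  existence of a value.\<close>

definition D :: "'h set" where "D = dom (adj A)"

text \<open>\<open>A\<^sup>*\<close> as a total function; it is arbitrary outside \<open>D(A\<^sup>*)\<close>.\<close>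

definition G :: "'h \<Rightarrow> 'h" where "G z = the (adj A z)"

lemma D_subspace: "complex_vector.subspace D"
  unfolding D_def by (rule adj_subspace)

lemma D_dense: "closure D = UNIV"
  unfolding D_def by (rule adj_dense)

lemma adj_eq_G: "z \<in> D \<Longrightarrow> adj A z = Some (G z)"
  by (auto simp: G_def D_def)

lemma G_eqI: "adj A z = Some w \<Longrightarrow> G z = w"
  by (simp add: G_def)

lemma D_add: "z \<in> D \<Longrightarrow> w \<in> D \<Longrightarrow> z + w \<in> D"
  and D_scaleC: "z \<in> D \<Longrightarrow> c *\<^sub>C z \<in> D"
  and D_zero: "0 \<in> D"
  and D_diff: "z \<in> D \<Longrightarrow> w \<in> D \<Longrightarrow> z - w \<in> D"
  using D_subspace complex_vector.subspace_diff[OF D_subspace]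
  by (auto simp only: complex_vector.subspace_def)

lemma R_in_D: "z \<in> D \<Longrightarrow> 0 \<le> t \<Longrightarrow> R t z \<in> D"
  and G_R: "z \<in> D \<Longrightarrow> 0 \<le> t \<Longrightarrow> G (R t z) = R t (G z)"
  using adjoint.generator_S[of z "G z" t] by (auto simp: generator_R adj_eq_G D_def intro: G_eqI)

lemma G_add: "z \<in> D \<Longrightarrow> w \<in> D \<Longrightarrow> G (z + w) = G z + G w"
  using adjoint.generator_add[of z "G z" w "G w"] by (intro G_eqI) (simp add: generator_R adj_eq_G)

lemma G_scaleC: "z \<in> D \<Longrightarrow> G (c *\<^sub>C z) = c *\<^sub>C G z"
  using adjoint.generator_scaleC[of z "G z" c] by (intro G_eqI) (simp add: generator_R adj_eq_G)

lemma G_diff: "z \<in> D \<Longrightarrow> w \<in> D \<Longrightarrow> G (z - w) = G z - G w"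
  using G_add[of z "(-1) *\<^sub>C w"] D_scaleC[of w "-1"] G_scaleC[of w "-1"]
  by (simp add: scaleC_minus_one)

lemma R_add: "0 \<le> t \<Longrightarrow> R t (x + y) = R t x + R t y"
  and R_diff: "0 \<le> t \<Longrightarrow> R t (x - y) = R t x - R t y"
  and R_scaleC: "0 \<le> t \<Longrightarrow> R t (c *\<^sub>C x) = c *\<^sub>C R t x"
  and R_zero: "0 \<le> t \<Longrightarrow> R t 0 = 0"
  using bounded_linear.linear[OF adjoint.linear[of t]]
  by (simp_all add: linear_add linear_diff linear_0 adjoint.scaleC)

lemma R_scaleR: "0 \<le> t \<Longrightarrow> R t (r *\<^sub>R x) = r *\<^sub>R R t x"
  by (simp add: scaleR_scaleC R_scaleC)

end

locale control_system = hilbert_semigroup S for S :: "real \<Rightarrow> 'h::complex_hilbert \<Rightarrow> 'h" +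
  fixes B :: "'u::complex_hilbert \<Rightarrow> 'h \<Rightarrow> complex"
  assumes B: "control_operator A B"
begin

text \<open>\<open>B\<^sup>*\<close> as a total function; it is arbitrary outside \<open>D(A\<^sup>*)\<close>.\<close>

definition C :: "'h \<Rightarrow> 'u" where "C z = the (control_adj A B z)"

lemma B_add: "B (u + v) z = B u z + B v z"
  and B_scaleC: "B (c *\<^sub>C u) z = c * B u z"
  using B unfolding control_operator_def by blast+

text \<open>As \<open>\<complex>\<close> is itself a Hilbert space, the vector representing \<open>u \<mapsto> B u z\<close> is the adjoint of this
functional, applied to \<open>1\<close>.\<close>

lemma B_functional:
  assumes "z \<in> D"
  obtains w where "\<And>u. B u z = cinner u w"
proof -
  obtain K where K: "\<And>u. cmod (B u z) \<le> K * norm u * graph_norm (adj A) z"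
    using B assms unfolding control_operator_def D_def by blast
  have "bounded_linear (\<lambda>u. B u z)"
  proof (rule bounded_linear_intro)
    show "B (u + v) z = B u z + B v z" for u v by (rule B_add)
    show "B (r *\<^sub>R u) z = r *\<^sub>R B u z" for r u
      by (simp add: scaleR_scaleC B_scaleC scaleC_complex_def)
    show "cmod (B u z) \<le> norm u * (K * graph_norm (adj A) z)" for u
      using K[of u] by (simp add: ac_simps)
  qed
  then have "bounded_clinear (\<lambda>u. B u z)"
    by (simp add: bounded_clinear_def B_scaleC scaleC_complex_def)
  then obtain w where w: "\<And>u. cinner (B u z) 1 = cinner u w"
    using cinner_bounded_adj by blast
  show thesis
  proof (rule that)
    show "B u z = cinner u w" for u using w[of u] by (simp add: cinner_complex_def)
  qed
qed

lemma control_adj_eq: "z \<in> D \<Longrightarrow> control_adj A B z = Some (C z)"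
  by (simp add: C_def control_adj_def D_def)

lemma B_eq_cinner: 
  assumes "z \<in> D" shows "B u z = cinner u (C z)"
proof -
  obtain w where w: "\<And>u. B u z = cinner u w" using B_functional[OF assms] by blast
  have "(THE w. \<forall>u. B u z = cinner u w) = w"
  proof (rule the_equality)
    fix v assume "\<forall>u. B u z = cinner u v"
    then have "inner x v = inner x w" for x using w by (metis Re_cinner)
    then show "v = w" by (rule cinner_eqI)
  qed (use w in blast)
  then show ?thesis using w assms by (simp add: C_def control_adj_def D_def)
qed

lemma C_eqI: "z \<in> D \<Longrightarrow> (\<And>u. B u z = cinner u w) \<Longrightarrow> C z = w"
  by (rule cinner_eqI) (metis B_eq_cinner Re_cinner)

lemma B_dual: "B u \<in> dual_dom_adj A"
  using B by (simp add: control_operator_def)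

lemma C_add: "z \<in> D \<Longrightarrow> w \<in> D \<Longrightarrow> C (z + w) = C z + C w"
  using B_dual by (intro C_eqI D_add) (auto simp: dual_dom_adj_def D_def[symmetric] cinner_add_right B_eq_cinner[symmetric])

lemma C_scaleC: "z \<in> D \<Longrightarrow> C (c *\<^sub>C z) = c *\<^sub>C C z"
  using B_dual by (intro C_eqI D_scaleC) (auto simp: dual_dom_adj_def D_def[symmetric] cinner_scaleC_right B_eq_cinner[symmetric])

lemma C_scaleR: "z \<in> D \<Longrightarrow> C (r *\<^sub>R z) = r *\<^sub>R C z"
  by (simp only: scaleR_scaleC C_scaleC)

lemma C_diff: "z \<in> D \<Longrightarrow> w \<in> D \<Longrightarrow> C (z - w) = C z - C w"
  using C_add[of z "(-1) *\<^sub>C w"] D_scaleC[of w "-1"] C_scaleC[of w "-1"]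
  by (simp add: scaleC_minus_one)

lemma C_bound: "\<exists>K\<ge>0. \<forall>z\<in>D. norm (C z) \<le> K * (norm z + norm (G z))"
proof -
  obtain K where K: "\<And>u z. z \<in> D \<Longrightarrow> cmod (B u z) \<le> K * norm u * graph_norm (adj A) z"
    using B unfolding control_operator_def D_def[symmetric] by blast
  have "norm (C z) \<le> \<bar>K\<bar> * (norm z + norm (G z))" if z: "z \<in> D" for z
  proof (cases "C z = 0")
    case False
    have "norm (C z) * norm (C z) = cmod (B (C z) z)"
      by (simp add: B_eq_cinner z cinner_self power2_eq_square norm_mult)
    also have "\<dots> \<le> K * norm (C z) * graph_norm (adj A) z" by (rule K[OF z])
    also have "\<dots> \<le> \<bar>K\<bar> * norm (C z) * graph_norm (adj A) z"
      by (intro mult_right_mono) (auto simp: graph_norm_def)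
    also have "\<dots> \<le> \<bar>K\<bar> * norm (C z) * (norm z + norm (G z))"
      unfolding graph_norm_def G_def by (intro mult_left_mono sqrt_sum_squares_le_sum) auto
    finally have "norm (C z) * norm (C z) \<le> norm (C z) * (\<bar>K\<bar> * (norm z + norm (G z)))"
      by (simp add: ac_simps)
    with False show ?thesis by simp
  qed simp
  then show ?thesis by (intro exI[of _ "\<bar>K\<bar>"]) auto
qed

text \<open>\<open>C\<close> is bounded for the graph norm only, so that both \<open>g\<close> and \<open>A\<^sup>* g\<close> have to be continuous.\<close>

lemma continuous_on_C:
  assumes g: "continuous_on X g" "continuous_on X (\<lambda>t. G (g t))" and D: "\<And>t. t \<in> X \<Longrightarrow> g t \<in> D"
  shows "continuous_on X (\<lambda>t. C (g t))"
  unfolding continuous_on_def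
proof
  fix t assume t: "t \<in> X"
  obtain K where K: "\<And>z. z \<in> D \<Longrightarrow> norm (C z) \<le> K * (norm z + norm (G z))" using C_bound by blast
  have 1: "((\<lambda>s. g s - g t) \<longlongrightarrow> 0) (at t within X)" "((\<lambda>s. G (g s) - G (g t)) \<longlongrightarrow> 0) (at t within X)"
    using g t by (auto simp: continuous_on_def LIM_zero_iff)
  have "((\<lambda>s. K * (norm (g s - g t) + norm (G (g s) - G (g t)))) \<longlongrightarrow> K * (0 + 0)) (at t within X)"
    by (intro tendsto_mult tendsto_add tendsto_const tendsto_norm_zero 1)
  then have "((\<lambda>s. K * (norm (g s - g t) + norm (G (g s) - G (g t)))) \<longlongrightarrow> 0) (at t within X)"
    by simp
  then have "((\<lambda>s. C (g s) - C (g t)) \<longlongrightarrow> 0) (at t within X)"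
  proof (rule Lim_null_comparison[rotated])
    have "norm (C (g s) - C (g t)) \<le> K * (norm (g s - g t) + norm (G (g s) - G (g t)))" if "s \<in> X" for s
      using K[OF D_diff[OF D[OF that] D[OF t]]] D that t by (simp add: C_diff G_diff)
    then show "\<forall>\<^sub>F s in at t within X. norm (C (g s) - C (g t)) \<le> K * (norm (g s - g t) + norm (G (g s) - G (g t)))"
      by (simp add: eventually_at_filter)
  qed
  then show "((\<lambda>s. C (g s)) \<longlongrightarrow> C (g t)) (at t within X)" by (simp add: LIM_zero_iff)
qed

lemma continuous_on_output:
  assumes z: "z \<in> D" shows "continuous_on {0..} (\<lambda>t. C (R t z))"
proof (rule continuous_on_C)
  have "continuous_on {0..} (\<lambda>t. R t (G z))" by (rule adjoint.continuous_on)
  then show "continuous_on {0..} (\<lambda>t. G (R t z))"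
    using G_R[OF z] by (simp cong: continuous_on_cong_simp)
  show "R t z \<in> D" if "t \<in> {0..}" for t using R_in_D[OF z, of t] that by simp
qed (rule adjoint.continuous_on)

lemma continuous_on_output_reversed: "z \<in> D \<Longrightarrow> continuous_on {0..T} (\<lambda>t. C (R (T - t) z))"
  by (rule continuous_on_compose2[OF continuous_on_output]) (auto intro: continuous_intros)

text \<open>The squared norm in \<open>L\<^sup>2\<close> of \<open>\<Phi>\<^sub>T\<^sup>* z\<close>, which is this output with time reversed.\<close>

definition energy :: "real \<Rightarrow> 'h \<Rightarrow> real" where
  "energy T z = integral {0..T} (\<lambda>t. (norm (C (R t z)))\<^sup>2)"

lemma continuous_on_energy: "z \<in> D \<Longrightarrow> 0 \<le> a \<Longrightarrow> continuous_on {a..b} (\<lambda>t. (norm (C (R t z)))\<^sup>2)"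
  by (intro continuous_intros continuous_on_subset[OF continuous_on_output]) auto

lemma energy_nonneg: "0 \<le> energy T z"
  unfolding energy_def
  by (cases "(\<lambda>t. (norm (C (R t z)))\<^sup>2) integrable_on {0..T}")
    (auto intro: Henstock_Kurzweil_Integration.integral_nonneg simp: not_integrable_integral)

lemma integral_reverse:
  fixes f :: "real \<Rightarrow> real"
  shows "integral {0..T} (\<lambda>t. f (T - t)) = integral {0..T} f"
proof -
  have "integral {0..T} (\<lambda>t. f (T - t)) = integral {-0..-(-T)} (\<lambda>t. (f \<circ> (+) T) (- t))" by simp
  also have "\<dots> = integral {-T..0} (f \<circ> (+) T)" by (rule Henstock_Kurzweil_Integration.integral_reflect_real)
  also have "\<dots> = integral {0..T} f" by (simp add: integral_shift_Icc_real)
  finally show ?thesis .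
qed

lemma energy_reversed: "integral {0..T} (\<lambda>t. (norm (C (R (T - t) z)))\<^sup>2) = energy T z"
  unfolding energy_def by (rule integral_reverse[of T "\<lambda>t. (norm (C (R t z)))\<^sup>2"])

lemma integrable_energy: "z \<in> D \<Longrightarrow> 0 \<le> a \<Longrightarrow> (\<lambda>t. (norm (C (R t z)))\<^sup>2) integrable_on {a..b}"
  by (intro integrable_continuous_interval continuous_on_energy)

lemma energy_mono:
  assumes z: "z \<in> D" and T: "T \<le> T'" shows "energy T z \<le> energy T' z"
  unfolding energy_def
  by (rule integral_subset_le) (use T z in \<open>auto intro: integrable_energy\<close>)

lemma energy_shift:
  assumes z: "z \<in> D" and h: "0 \<le> h" and T: "0 \<le> T"
  shows "energy T (R h z) \<le> energy (T + h) z"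
proof -
  have "energy T (R h z) = integral {0..T} ((\<lambda>t. (norm (C (R t z)))\<^sup>2) \<circ> (+) h)"
    unfolding energy_def using h
    by (intro Henstock_Kurzweil_Integration.integral_cong) (simp add: adjoint.add[symmetric] add.commute)
  also have "\<dots> = integral {0 + h..T + h} (\<lambda>t. (norm (C (R t z)))\<^sup>2)"
    by (rule integral_shift_Icc_real)
  also have "\<dots> \<le> energy (T + h) z"
    unfolding energy_def by (rule integral_subset_le) (use h z in \<open>auto intro: integrable_energy\<close>)
  finally show ?thesis .
qed

text \<open>The constant \<open>2\<close> replaces the triangle inequality for the square root of the energy; it suffices
wherever energies tend to \<open>0\<close>.\<close>

lemma energy_add_le:
  assumes z: "z \<in> D" and w: "w \<in> D"
  shows "energy T (z + w) \<le> 2 * energy T z + 2 * energy T w"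
proof -
  have "energy T (z + w) \<le> integral {0..T} (\<lambda>t. 2 * (norm (C (R t z)))\<^sup>2 + 2 * (norm (C (R t w)))\<^sup>2)"
    unfolding energy_def
  proof (rule integral_le)
    fix t assume t: "t \<in> {0..T}"
    have "C (R t (z + w)) = C (R t z) + C (R t w)"
      using t z w by (simp add: R_add C_add R_in_D)
    then have "(norm (C (R t (z + w))))\<^sup>2 \<le> (norm (C (R t z)) + norm (C (R t w)))\<^sup>2"
      by (intro power_mono) (auto intro: norm_triangle_ineq)
    also have "\<dots> \<le> 2 * (norm (C (R t z)))\<^sup>2 + 2 * (norm (C (R t w)))\<^sup>2"
      using zero_le_power2[of "norm (C (R t z)) - norm (C (R t w))"]
      unfolding power2_sum power2_diff by linarith
    finally show "(norm (C (R t (z + w))))\<^sup>2 \<le> 2 * (norm (C (R t z)))\<^sup>2 + 2 * (norm (C (R t w)))\<^sup>2" .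
  qed (use z w in \<open>auto intro!: integrable_energy D_add integrable_add integrable_on_mult_right\<close>)
  also have "\<dots> = 2 * energy T z + 2 * energy T w"
    unfolding energy_def
    by (subst Henstock_Kurzweil_Integration.integral_add)
      (use z w in \<open>auto intro!: integrable_energy integrable_on_mult_right\<close>)
  finally show ?thesis .
qed

lemma energy_scaleC: "z \<in> D \<Longrightarrow> energy T (c *\<^sub>C z) = (cmod c)\<^sup>2 * energy T z"
proof -
  assume z: "z \<in> D"
  have "energy T (c *\<^sub>C z) = integral {0..T} (\<lambda>t. (cmod c)\<^sup>2 * (norm (C (R t z)))\<^sup>2)"
    unfolding energy_def using z
    by (intro Henstock_Kurzweil_Integration.integral_cong)
      (simp add: R_scaleC C_scaleC R_in_D norm_scaleC power_mult_distrib)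
  then show ?thesis by (simp add: energy_def)
qed

lemma energy_diff_le:
  assumes z: "z \<in> D" and w: "w \<in> D"
  shows "energy T (z - w) \<le> 2 * energy T z + 2 * energy T w"
  using energy_add_le[OF z D_scaleC[OF w, of "-1"], of T] energy_scaleC[OF w, of T "-1"]
  by (simp add: scaleC_minus_one)

lemma energy_eq_0_iff:
  assumes z: "z \<in> D" and T: "0 < T"
  shows "energy T z = 0 \<longleftrightarrow> (\<forall>t\<in>{0..T}. C (R t z) = 0)"
  unfolding energy_def using integral_eq_0_iff[OF continuous_on_energy[OF z, of 0 T] T] by simp

section \<open>The input map\<close>

text \<open>\<open>\<Phi>\<^sub>T u = h\<close>, tested against \<open>D(A\<^sup>*)\<close>. As a relation it makes sense before it is known that
  \<open>\<Phi>\<^sub>T u\<close> lies in \<open>H\<close>.\<close>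

definition steers :: "real \<Rightarrow> (real \<Rightarrow> 'u) \<Rightarrow> 'h \<Rightarrow> bool" where
  "steers T u h \<longleftrightarrow>
     (\<forall>z\<in>D. cinner h z = (LINT s|lebesgue_on {0<..<T}. cinner (u s) (C (R (T - s) z))))"

lemma input_functional_eq:
  assumes "z \<in> D"
  shows "input_functional A S B T u z = (LINT s|lebesgue_on {0<..<T}. cinner (u s) (C (R (T - s) z)))"
  unfolding input_functional_def semigroup_ext_def D_def[symmetric] using assms
  by (intro Bochner_Integration.integral_cong) (auto simp: B_eq_cinner[symmetric] R_in_D R_def[symmetric])

lemma steers_iff: "steers T u h \<longleftrightarrow> pivot_embed A h = input_functional A S B T u"
proof
  assume h: "steers T u h"
  have "input_functional A S B T u z = 0" if "z \<notin> D" for z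
    using that by (simp add: input_functional_def semigroup_ext_def D_def)
  with h show "pivot_embed A h = input_functional A S B T u"
    by (intro ext) (auto simp: pivot_embed_def steers_def input_functional_eq D_def[symmetric])
next
  assume eq: "pivot_embed A h = input_functional A S B T u"
  show "steers T u h"
    unfolding steers_def
  proof
    fix z assume "z \<in> D"
    then show "cinner h z = (LINT s|lebesgue_on {0<..<T}. cinner (u s) (C (R (T - s) z)))"
      using fun_cong[OF eq, of z] unfolding input_functional_eq[OF \<open>z \<in> D\<close>]
      by (simp add: pivot_embed_def D_def)
  qed
qed

lemma steers_unique: "steers T u h \<Longrightarrow> steers T u h' \<Longrightarrow> h = h'"
proof -
  assume "steers T u h" "steers T u h'"
  then have "inner (h - h') z = 0" if "z \<in> D" for z
  proof -
    have "cinner h z = cinner h' z"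
      using \<open>steers T u h\<close> \<open>steers T u h'\<close> that by (simp add: steers_def)
    then have "inner h z = inner h' z" by (metis Re_cinner)
    then show ?thesis by (simp add: inner_diff_left)
  qed
  then have "h - h' = 0" by (rule eq_zero_if_orthogonal_dense[OF D_dense])
  then show "h = h'" by simp
qed

lemma input_map_eq: "steers T u h \<Longrightarrow> input_map A S B T u = h"
  unfolding input_map_def steers_iff[symmetric]
  by (rule the_equality) (auto dest: steers_unique)

lemma steers_cong: "(\<And>s. s \<in> {0<..<T} \<Longrightarrow> u s = v s) \<Longrightarrow> steers T u h \<longleftrightarrow> steers T v h"
  unfolding steers_def
  by (intro ball_cong arg_cong2[where f = "(=)"] Bochner_Integration.integral_cong refl) auto

lemma integrable_pairing:
  assumes "u \<in> L2 {0<..}" "z \<in> D"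
  shows "integrable (lebesgue_on {0<..<T}) (\<lambda>s. cinner (u s) (C (R (T - s) z)))"
proof (rule integrable_cinner_continuous)
  show "u \<in> L2 {0<..<T}" by (rule L2_subset[OF assms(1)]) auto
qed (rule continuous_on_output_reversed[OF assms(2)])

text \<open>A translation of the time variable: a delay by \<open>T' - T\<close> leaves the time between the action of the
  control and the final time unchanged.\<close>

lemma steers_delay:
  assumes u: "u \<in> L2 {0<..}" and T: "T \<le> T'"
    and h: "steers T' (\<lambda>s. if s \<in> {T' - T<..} then u (s - (T' - T)) else 0) h"
  shows "steers T u h"
  unfolding steers_def
proof
  fix z assume z: "z \<in> D"
  define d where "d = T' - T"
  have d: "0 \<le> d" using T by (simp add: d_def)
  let ?f = "\<lambda>s. cinner (u s) (C (R (T - s) z))"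
  have shift: "{s. s + (- d) \<in> {0<..<T}} = {d<..<T'}" by (auto simp: d_def)
  have "cinner h z = (LINT s|lebesgue_on {0<..<T'}. cinner (if s \<in> {d<..} then u (s - d) else 0) (C (R (T' - s) z)))"
    using h z unfolding steers_def d_def by blast
  also have "\<dots> = (LINT s|lebesgue_on {0<..<T'}. (if s \<in> {d<..<T'} then ?f (s + (- d)) else 0))"
    by (intro Bochner_Integration.integral_cong) (auto simp: d_def algebra_simps)
  also have "\<dots> = (LINT s|lebesgue_on {d<..<T'}. ?f (s + (- d)))"
    by (rule integrable_lebesgue_on_extend_zero(2)) (use d in auto)
  also have "\<dots> = (LINT s|lebesgue_on {0<..<T}. ?f s)"
    using integral_shift_lebesgue_on(2)[OF _ integrable_pairing[OF u z, of T], of "- d"]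
    unfolding shift by simp
  finally show "cinner h z = (LINT s|lebesgue_on {0<..<T}. ?f s)" .
qed

lemma L2_delay:
  assumes u: "u \<in> L2 {0<..}" and d: "0 \<le> d"
  shows "(\<lambda>s. if s \<in> {d<..} then u (s - d) else (0::'u)) \<in> L2 {0<..}"
proof -
  have "{s. s + (- d) \<in> {0<..}} = {d<..}" by auto
  then have "(\<lambda>s. u (s - d)) \<in> L2 {d<..}"
    using L2_shift[OF _ u, of "- d"] by simp
  then show ?thesis by (rule L2_extend_zero) (use d in auto)
qed

lemma L2_advance:
  assumes u: "u \<in> L2 {0<..}" and d: "0 \<le> d"
  shows "(\<lambda>s. u (s + d) :: 'u) \<in> L2 {0<..}"
proof -
  have eq: "{s. s + d \<in> {d<..}} = {0<..}" by auto
  have "u \<in> L2 {d<..}" by (rule L2_subset[OF u]) (use d in auto)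
  from L2_shift[OF _ this, of d] show ?thesis unfolding eq by simp
qed

text \<open>The state reached at time \<open>T + T'\<close> is the state reached at time \<open>T\<close>, transported by \<open>S T'\<close>, plus
the effect of the remaining control.\<close>

lemma steers_concatenate:
  assumes u: "u \<in> L2 {0<..}" and T: "0 \<le> T" "0 \<le> T'"
    and h: "steers T u h" and h': "steers T' (\<lambda>s. u (s + T)) h'"
  shows "steers (T + T') u (S T' h + h')"
  unfolding steers_def
proof
  fix z assume z: "z \<in> D"
  define f where "f s = cinner (u s) (C (R (T + T' - s) z))" for s
  have fi: "integrable (lebesgue_on {0<..<T + T'}) f"
    unfolding f_def by (rule integrable_pairing[OF u z])
  have hk: "(LINT s|lebesgue_on {a<..<b}. f s) = integral {a..b} f" if "0 \<le> a" "b \<le> T + T'" for a b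
  proof -
    have "integrable (lebesgue_on {a<..<b}) f"
      by (rule integrable_lebesgue_on_subset[OF fi]) (use that in auto)
    then show ?thesis by (simp add: lebesgue_integral_eq_integral integral_open_interval_real)
  qed
  have "f integrable_on {0<..<T + T'}"
    using has_integral_integral_lebesgue_on[OF fi] by (auto simp: integrable_on_def)
  then have "f integrable_on {0..T + T'}" by (simp add: integrable_on_open_interval_real)
  then have split: "integral {0..T + T'} f = integral {0..T} f + integral {T..T + T'} f"
    using T by (simp add: Henstock_Kurzweil_Integration.integral_combine)
  have "cinner (S T' h) z = cinner h (R T' z)" by (simp add: cinner_R T)
  also have "\<dots> = (LINT s|lebesgue_on {0<..<T}. cinner (u s) (C (R (T - s) (R T' z))))"
    using h R_in_D[OF z T(2)] by (simp add: steers_def)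
  also have "\<dots> = (LINT s|lebesgue_on {0<..<T}. f s)"
    unfolding f_def using T by (intro Bochner_Integration.integral_cong)
      (auto simp: adjoint.add[symmetric] algebra_simps)
  finally have 1: "cinner (S T' h) z = integral {0..T} f" using hk[of 0 T] T by simp
  have shift: "{s. s + T \<in> {T<..<T + T'}} = {0<..<T'}" by auto
  have fi2: "integrable (lebesgue_on {T<..<T + T'}) f"
    by (rule integrable_lebesgue_on_subset[OF fi]) (use T in auto)
  have "cinner h' z = (LINT s|lebesgue_on {0<..<T'}. f (s + T))"
    using h' z by (simp add: steers_def f_def algebra_simps)
  also have "\<dots> = (LINT s|lebesgue_on {T<..<T + T'}. f s)"
    using integral_shift_lebesgue_on(2)[OF _ fi2, of T] unfolding shift by simp
  finally have 2: "cinner h' z = integral {T..T + T'} f" using hk[of T "T + T'"] T by simp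
  show "cinner (S T' h + h') z = (LINT s|lebesgue_on {0<..<T + T'}. cinner (u s) (C (R (T + T' - s) z)))"
    using hk[of 0 "T + T'"] by (simp add: cinner_add_left 1 2 split f_def)
qed

end

context control_system
begin

text \<open>The integral of \<open>(f + r g)\<^sup>2\<close> is a nonnegative quadratic polynomial in \<open>r\<close>.\<close>

lemma cauchy_schwarz_integral:
  fixes f g :: "real \<Rightarrow> real"
  assumes f: "continuous_on {0..T} f" and g: "continuous_on {0..T} g"
  shows "(integral {0..T} (\<lambda>t. f t * g t))\<^sup>2 \<le> integral {0..T} (\<lambda>t. (f t)\<^sup>2) * integral {0..T} (\<lambda>t. (g t)\<^sup>2)"
proof (rule quadratic_nonneg_discriminant)
  fix r :: real
  have "0 \<le> integral {0..T} (\<lambda>t. (f t + r * g t)\<^sup>2)"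
    by (intro Henstock_Kurzweil_Integration.integral_nonneg integrable_continuous_interval continuous_intros f g) auto
  also have "\<dots> = integral {0..T} (\<lambda>t. r\<^sup>2 * (g t)\<^sup>2 + (2 * r * (f t * g t) + (f t)\<^sup>2))"
    by (intro Henstock_Kurzweil_Integration.integral_cong) (simp add: power2_eq_square algebra_simps)
  also have "\<dots> = r\<^sup>2 * integral {0..T} (\<lambda>t. (g t)\<^sup>2) + (2 * r * integral {0..T} (\<lambda>t. f t * g t) + integral {0..T} (\<lambda>t. (f t)\<^sup>2))"
    by (subst Henstock_Kurzweil_Integration.integral_add, (intro integrable_continuous_interval continuous_intros f g)+)+ simp
  finally show "0 \<le> r\<^sup>2 * integral {0..T} (\<lambda>t. (g t)\<^sup>2) + 2 * r * integral {0..T} (\<lambda>t. f t * g t) + integral {0..T} (\<lambda>t. (f t)\<^sup>2)"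
    by simp
qed

text \<open>\<open>\<Phi>\<^sub>T\<^sup>* z\<close> for \<open>z \<in> D(A\<^sup>*)\<close>.\<close>

definition output_control :: "real \<Rightarrow> 'h \<Rightarrow> real \<Rightarrow> 'u" where
  "output_control T z s = (if s \<in> {0<..<T} then C (R (T - s) z) else 0)"

lemma output_control_L2:
  assumes z: "z \<in> D" shows "output_control T z \<in> L2 {0<..}"
proof -
  let ?f = "\<lambda>s. C (R (T - s) z)"
  have c: "continuous_on {0..T} ?f" by (rule continuous_on_output_reversed[OF z])
  have "integrable (lebesgue_on {0<..<T}) (\<lambda>s. (norm (?f s))\<^sup>2)"
    by (intro integrable_continuous_Ioo continuous_on_power continuous_on_norm c)
  then have "?f \<in> L2 {0<..<T}" using strongly_measurable_continuous[OF c] by (simp add: L2_def)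
  then show ?thesis
    unfolding output_control_def by (rule L2_extend_zero) auto
qed

text \<open>The energy is a quadratic form on \<open>D(A\<^sup>*)\<close> that dominates the functional \<open>\<langle>y, \<cdot>\<rangle>\<close>. A
  minimising sequence need not converge in \<open>H\<close>, but its outputs form a Cauchy sequence in \<open>L\<^sup>2\<close>; the
  Euler equation says that their limit is a control that steers to \<open>y\<close>.\<close>

lemma steers_if_energy_bound:
  assumes K: "K > 0" and bd: "\<And>z. z \<in> D \<Longrightarrow> (inner y z)\<^sup>2 \<le> K * energy T z"
  shows "\<exists>u\<in>L2 {0<..}. steers T u y"
proof -
  let ?a = "\<lambda>z w. integral {0..T} (\<lambda>s. inner (C (R (T - s) z)) (C (R (T - s) w)))"
  show ?thesis
  proof (rule minimizing_sequence[where D = D and f = "inner y" and K = K and a = ?a])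
    have cont: "continuous_on {0..T} (\<lambda>s. inner (C (R (T - s) z)) (C (R (T - s) w)))"
      if "z \<in> D" "w \<in> D" for z w
      by (intro continuous_on_inner continuous_on_output_reversed that)
    have diag: "?a z z = energy T z" for z
      unfolding energy_reversed[symmetric] by (simp add: power2_norm_eq_inner)
    show "subspace D" by (intro complex_subspace_imp_real D_subspace)
    show "?a z w = ?a w z" for z w
      by (simp add: inner_commute)
    show "?a (x + z) w = ?a x w + ?a z w"
      if "x \<in> D" "z \<in> D" "w \<in> D" for x z w
    proof -
      have "?a (x + z) w
        = integral {0..T} (\<lambda>s. inner (C (R (T - s) x)) (C (R (T - s) w)) + inner (C (R (T - s) z)) (C (R (T - s) w)))"
        using that by (intro Henstock_Kurzweil_Integration.integral_cong)
          (simp add: R_add C_add R_in_D inner_add_left)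
      also have "\<dots> = ?a x w + ?a z w"
        by (intro Henstock_Kurzweil_Integration.integral_add integrable_continuous_interval cont that)
      finally show ?thesis .
    qed
    show "?a (r *\<^sub>R z) w = r * ?a z w"
      if "z \<in> D" for r z w
    proof -
      have "?a (r *\<^sub>R z) w
        = integral {0..T} (\<lambda>s. r * inner (C (R (T - s) z)) (C (R (T - s) w)))"
        using that by (intro Henstock_Kurzweil_Integration.integral_cong) (simp add: R_scaleR C_scaleR R_in_D)
      then show ?thesis by simp
    qed
    show "0 \<le> ?a z z" for z
      by (simp add: diag energy_nonneg)
    show "(inner y z)\<^sup>2 \<le> K * ?a z z" if "z \<in> D" for z
      using bd[OF that] by (simp add: diag)
    show "inner y (x + z) = inner y x + inner y z" for x z by (rule inner_add_right)
    show "inner y (r *\<^sub>R x) = r * inner y x" for r x by simp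
    show "K > 0" by (rule K)
  next
    fix w M
    assume w: "\<And>n. w n \<in> D"
      and cauchy: "\<And>n k. k \<le> n \<Longrightarrow> ?a (w n - w k) (w n - w k) \<le> (1/4)^k"
      and bound: "\<And>n. ?a (w n) (w n) \<le> M"
      and lim: "\<And>z. z \<in> D \<Longrightarrow> (\<lambda>n. ?a (w n) z) \<longlonglongrightarrow> inner y z"
    obtain u where u: "u \<in> L2 {0<..<T}" and ulim: "\<And>g. continuous_on {0..T} g \<Longrightarrow>
        (\<lambda>n. LINT t|lebesgue_on {0<..<T}. cinner (C (R (T - t) (w n))) (g t)) \<longlonglongrightarrow>
        (LINT t|lebesgue_on {0<..<T}. cinner (u t) (g t))"
    proof (rule L2_limit_of_continuous[of T "\<lambda>n s. C (R (T - s) (w n))" M])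
      show "continuous_on {0..T} (\<lambda>s. C (R (T - s) (w n)))" for n
        by (rule continuous_on_output_reversed[OF w])
      show "integral {0..T} (\<lambda>t. (norm (C (R (T - t) (w n))))\<^sup>2) \<le> M" for n
        using bound[of n] by (simp add: power2_norm_eq_inner)
      show "integral {0..T} (\<lambda>t. (norm (C (R (T - t) (w (Suc n))) - C (R (T - t) (w n))))\<^sup>2) \<le> (1/4)^n" for n
      proof -
        have "integral {0..T} (\<lambda>t. (norm (C (R (T - t) (w (Suc n))) - C (R (T - t) (w n))))\<^sup>2) =
          ?a (w (Suc n) - w n) (w (Suc n) - w n)"
          by (intro Henstock_Kurzweil_Integration.integral_cong)
            (simp add: power2_norm_eq_inner R_diff C_diff R_in_D w)
        then show ?thesis using cauchy[of n "Suc n"] by simp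
      qed
    qed (rule that)
    define v where "v s = (if s \<in> {0<..<T} then u s else 0)" for s
    have vL: "v \<in> L2 {0<..}" unfolding v_def by (rule L2_extend_zero[OF u]) auto
    let ?p = "\<lambda>z. LINT s|lebesgue_on {0<..<T}. cinner (v s) (C (R (T - s) z))"
    have v: "?p z = (LINT s|lebesgue_on {0<..<T}. cinner (u s) (C (R (T - s) z)))" for z
      by (intro Bochner_Integration.integral_cong) (auto simp: v_def)
    have "steers T v y"
      unfolding steers_def
    proof
      fix z assume z: "z \<in> D"
      \<comment> \<open>Minimisation over the real vector space \<open>D\<close> yields real parts only; the pairing is antilinear in \<open>z\<close>.\<close>
      show "cinner y z = ?p z"
      proof (rule cinner_eq_if_Re_eq[of D y ?p, OF _ _ _ z])
        fix z assume z: "z \<in> D"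
        have "(\<lambda>n. Re (LINT t|lebesgue_on {0<..<T}. cinner (C (R (T - t) (w n))) (C (R (T - t) z)))) \<longlonglongrightarrow> Re (?p z)"
          unfolding v by (intro tendsto_Re ulim continuous_on_output_reversed z)
        moreover have "Re (LINT t|lebesgue_on {0<..<T}. cinner (C (R (T - t) (w n))) (C (R (T - t) z)))
            = ?a (w n) z" for n
        proof -
          have "continuous_on {0..T} (\<lambda>s. inner (C (R (T - s) (w n))) (C (R (T - s) z)))"
            by (intro continuous_on_inner continuous_on_output_reversed z w)
          note cont = integrable_continuous_Ioo(2)[OF this]
          have "integrable (lebesgue_on {0<..<T}) (\<lambda>t. cinner (C (R (T - t) (w n))) (C (R (T - t) z)))"
            by (intro integrable_continuous_Ioo continuous_on_cinner continuous_on_output_reversed z w)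
          then show ?thesis
            by (subst integral_Re[symmetric]) (simp_all add: Re_cinner cont)
        qed
        ultimately show "inner y z = Re (?p z)"
          using lim[OF z] LIMSEQ_unique by simp
        show "\<i> *\<^sub>C z \<in> D" by (rule D_scaleC[OF z])
        have "?p (\<i> *\<^sub>C z) = (LINT s|lebesgue_on {0<..<T}. (- \<i>) * cinner (v s) (C (R (T - s) z)))"
          using z by (intro Bochner_Integration.integral_cong) (auto simp: R_scaleC C_scaleC R_in_D cinner_scaleC_right)
        then show "?p (\<i> *\<^sub>C z) = - \<i> * ?p z" by simp
      qed
    qed
    with vL show ?thesis by blast
  qed
qed

end

locale admissible_system = control_system S B
  for S :: "real \<Rightarrow> 'h::complex_hilbert \<Rightarrow> 'h" and B :: "'u::complex_hilbert \<Rightarrow> 'h \<Rightarrow> complex" +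
  assumes admissible: "admissible A S B"
begin

text \<open>Admissibility at one time gives it at every time: shorter times by delaying the control,
  longer ones by concatenation.\<close>

lemma exists_steers:
  assumes u: "u \<in> L2 {0<..}" and T: "0 \<le> T" shows "\<exists>h. steers T u h"
proof -
  obtain T1 where T1: "T1 > 0" "\<And>u. u \<in> L2 {0<..} \<Longrightarrow> \<exists>h. steers T1 u h"
    using admissible unfolding admissible_def steers_iff by (metis image_subset_iff rangeE)
  have "\<exists>h. steers T u h" if "u \<in> L2 {0<..}" "0 \<le> T" "T \<le> real n * T1 + T1" for n u T
    using that
  proof (induction n arbitrary: u T)
    case 0
    then have "\<exists>h. steers T1 (\<lambda>s. if s \<in> {T1 - T<..} then u (s - (T1 - T)) else 0) h"
      by (intro T1(2) L2_delay) auto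
    then show ?case using steers_delay[of u T T1] 0 by auto
  next
    case (Suc n)
    show ?case
    proof (cases "T \<le> T1")
      case True
      then show ?thesis using Suc.IH[OF Suc.prems(1,2)] T1(1) by (simp add: add_increasing)
    next
      case False
      have "T - T1 \<le> real n * T1 + T1" using Suc.prems(3) by (simp add: algebra_simps)
      then obtain h where h: "steers (T - T1) u h" using Suc.IH[OF Suc.prems(1), of "T - T1"] False by auto
      obtain h' where h': "steers T1 (\<lambda>s. u (s + (T - T1))) h'"
        using T1(2)[OF L2_advance[OF Suc.prems(1), of "T - T1"]] False by auto
      show ?thesis using steers_concatenate[OF Suc.prems(1) _ _ h h'] False T1(1) by auto
    qed
  qed
  moreover obtain n where "T / T1 \<le> real n" using real_arch_simple by blast
  then have "T \<le> real n * T1 + T1" using T1 by (simp add: field_simps)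
  ultimately show ?thesis using u T by blast
qed

lemma steers_input_map: "u \<in> L2 {0<..} \<Longrightarrow> 0 \<le> T \<Longrightarrow> steers T u (input_map A S B T u)"
  using exists_steers input_map_eq by metis

text \<open>The output map \<open>z \<mapsto> B\<^sup>* S\<^sup>*(\<cdot>) z\<close> is closable: if \<open>w n \<rightarrow> z\<close> and the outputs of \<open>w n\<close> tend to
  \<open>0\<close>, pair with the state \<open>h\<close> reached by the control \<open>\<Phi>\<^sub>T\<^sup>* z\<close>. Then \<open>\<langle>h, w n\<rangle>\<close> tends to \<open>0\<close> by the
  Cauchy-Schwarz inequality, and its limit \<open>\<langle>h, z\<rangle>\<close> is the energy of \<open>z\<close>.\<close>

lemma output_closable:
  assumes z: "z \<in> D" and w: "\<And>n. w n \<in> D" "w \<longlonglongrightarrow> z" "(\<lambda>n. energy T (w n)) \<longlonglongrightarrow> 0"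
    and T: "0 < T" and t: "t \<in> {0..T}"
  shows "C (R t z) = 0"
proof -
  define h where "h = input_map A S B T (output_control T z)"
  have pair: "cinner h y = (LINT s|lebesgue_on {0<..<T}. cinner (C (R (T - s) z)) (C (R (T - s) y)))"
    if y: "y \<in> D" for y
  proof -
    have "steers T (output_control T z) h"
      unfolding h_def by (intro steers_input_map output_control_L2 z) (use T in simp)
    then have "cinner h y = (LINT s|lebesgue_on {0<..<T}. cinner (output_control T z s) (C (R (T - s) y)))"
      using y by (simp add: steers_def)
    then show ?thesis
      by (simp only:) (intro Bochner_Integration.integral_cong, auto simp: output_control_def)
  qed
  have le: "(inner h y)\<^sup>2 \<le> energy T z * energy T y" if y: "y \<in> D" for y
  proof -
    have c: "continuous_on {0..T} (\<lambda>s. cinner (C (R (T - s) z)) (C (R (T - s) y)))"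
      by (intro continuous_on_cinner continuous_on_output_reversed z y)
    have n: "continuous_on {0..T} (\<lambda>s. norm (C (R (T - s) z)) * norm (C (R (T - s) y)))"
      by (intro continuous_intros continuous_on_output_reversed z y)
    have "cmod (cinner h y) = norm (integral {0..T} (\<lambda>s. cinner (C (R (T - s) z)) (C (R (T - s) y))))"
      by (simp add: pair[OF y] integrable_continuous_Ioo(2)[OF c])
    also have "\<dots> \<le> integral {0..T} (\<lambda>s. norm (C (R (T - s) z)) * norm (C (R (T - s) y)))"
      by (intro integral_norm_bound_integral integrable_continuous_interval c n norm_cinner_le)
    finally have "\<bar>inner h y\<bar> \<le> integral {0..T} (\<lambda>s. norm (C (R (T - s) z)) * norm (C (R (T - s) y)))"
      using abs_Re_le_cmod[of "cinner h y"] by (simp add: Re_cinner)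
    then have "\<bar>inner h y\<bar>\<^sup>2 \<le> (integral {0..T} (\<lambda>s. norm (C (R (T - s) z)) * norm (C (R (T - s) y))))\<^sup>2"
      by (intro power_mono) auto
    also have "\<dots> \<le> energy T z * energy T y"
      unfolding energy_reversed[symmetric]
      by (intro cauchy_schwarz_integral continuous_on_norm continuous_on_output_reversed z y)
    finally show ?thesis by simp
  qed
  have "(\<lambda>n. energy T z * energy T (w n)) \<longlonglongrightarrow> 0"
    by (rule tendsto_mult_right_zero[OF w(3)])
  then have "(\<lambda>n. (inner h (w n))\<^sup>2) \<longlonglongrightarrow> 0"
    by (rule tendsto_sandwich[OF _ _ tendsto_const, rotated 2]) (use le[OF w(1)] in auto)
  then have "(\<lambda>n. inner h (w n)) \<longlonglongrightarrow> 0" by (rule tendsto_zero_if_power2)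
  moreover have "(\<lambda>n. inner h (w n)) \<longlonglongrightarrow> inner h z" by (rule tendsto_inner[OF tendsto_const w(2)])
  ultimately have "inner h z = 0" using LIMSEQ_unique by blast
  moreover have "inner h z = energy T z"
  proof -
    have c: "continuous_on {0..T} (\<lambda>s. (norm (C (R (T - s) z)))\<^sup>2)"
      by (intro continuous_intros continuous_on_output_reversed z)
    have "cinner h z = (LINT s|lebesgue_on {0<..<T}. complex_of_real ((norm (C (R (T - s) z)))\<^sup>2))"
      using pair[OF z] by (simp only: cinner_self)
    also have "\<dots> = complex_of_real (energy T z)"
      by (simp only: integral_complex_of_real integrable_continuous_Ioo(2)[OF c] energy_reversed)
    finally show ?thesis by (metis Re_cinner Re_complex_of_real)
  qed
  ultimately show ?thesis using energy_eq_0_iff[OF z T] t by simp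
qed

text \<open>For \<open>z \<in> D(A\<^sup>*)\<close> the output is one function with the property that defines \<open>input_map_adj\<close>,
  so that the chosen function \<open>v\<close> has it too. Testing the property with \<open>v\<close> itself, cut off at \<open>T\<close>, gives
  \<open>\<parallel>v\<parallel>\<^sup>2 = \<langle>v, \<Phi>\<^sub>T\<^sup>* z\<rangle> \<le> (\<parallel>v\<parallel>\<^sup>2 + \<parallel>\<Phi>\<^sub>T\<^sup>* z\<parallel>\<^sup>2) / 2\<close>.\<close>

lemma input_map_adj_energy:
  assumes z: "z \<in> D" and T: "0 < T"
  shows "(LINT t|lebesgue_on {0<..<T}. (norm (input_map_adj A S B T z t))\<^sup>2) \<le> energy T z"
proof -
  let ?y = "\<lambda>t. C (R (T - t) z)"
  let ?P = "\<lambda>v. v \<in> L2 {0<..} \<and> (\<forall>u\<in>L2 {0<..}. cinner (input_map A S B T u) z = (LINT t|lebesgue_on {0<..}. cinner (u t) (v t)))"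
  have pair: "cinner (input_map A S B T u) z = (LINT t|lebesgue_on {0<..<T}. cinner (u t) (?y t))"
    if "u \<in> L2 {0<..}" for u
    using steers_input_map[OF that, of T] T z by (simp add: steers_def)
  have "?P (output_control T z)"
  proof (intro conjI ballI output_control_L2 z)
    fix u :: "real \<Rightarrow> 'u" assume u: "u \<in> L2 {0<..}"
    have "(LINT t|lebesgue_on {0<..}. cinner (u t) (output_control T z t))
      = (LINT t|lebesgue_on {0<..}. (if t \<in> {0<..<T} then cinner (u t) (?y t) else 0))"
      by (intro Bochner_Integration.integral_cong) (auto simp: output_control_def)
    also have "\<dots> = (LINT t|lebesgue_on {0<..<T}. cinner (u t) (?y t))"
      by (rule integrable_lebesgue_on_extend_zero(2)) auto
    finally show "cinner (input_map A S B T u) z = (LINT t|lebesgue_on {0<..}. cinner (u t) (output_control T z t))"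
      using pair[OF u] by simp
  qed
  then have "?P (input_map_adj A S B T z)"
    unfolding input_map_adj_def by (rule someI[where P = ?P])
  then obtain v where v: "v = input_map_adj A S B T z" "v \<in> L2 {0<..}"
      "\<And>u. u \<in> L2 {0<..} \<Longrightarrow> cinner (input_map A S B T u) z = (LINT t|lebesgue_on {0<..}. cinner (u t) (v t))"
    by blast
  have vT: "v \<in> L2 {0<..<T}" by (rule L2_subset[OF v(2)]) auto
  then have vi: "integrable (lebesgue_on {0<..<T}) (\<lambda>t. (norm (v t))\<^sup>2)" by (simp add: L2_def)
  define u where "u t = (if t \<in> {0<..<T} then v t else 0)" for t
  have u: "u \<in> L2 {0<..}" unfolding u_def by (rule L2_extend_zero[OF vT]) auto
  have yc: "continuous_on {0..T} (\<lambda>t. (norm (?y t))\<^sup>2)"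
    by (intro continuous_intros continuous_on_output_reversed z)
  have vy: "integrable (lebesgue_on {0<..<T}) (\<lambda>t. cinner (v t) (?y t))"
    by (intro integrable_cinner_continuous vT continuous_on_output_reversed z)
  have "(LINT t|lebesgue_on {0<..}. cinner (u t) (v t))
      = (LINT t|lebesgue_on {0<..}. (if t \<in> {0<..<T} then complex_of_real ((norm (v t))\<^sup>2) else 0))"
    by (intro Bochner_Integration.integral_cong) (auto simp: u_def cinner_self)
  also have "\<dots> = (LINT t|lebesgue_on {0<..<T}. complex_of_real ((norm (v t))\<^sup>2))"
    by (rule integrable_lebesgue_on_extend_zero(2)) auto
  finally have "complex_of_real (LINT t|lebesgue_on {0<..<T}. (norm (v t))\<^sup>2) = cinner (input_map A S B T u) z"
    using v(3)[OF u] by (simp only: integral_complex_of_real)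
  also have "\<dots> = (LINT t|lebesgue_on {0<..<T}. cinner (v t) (?y t))"
    unfolding pair[OF u] by (intro Bochner_Integration.integral_cong) (auto simp: u_def)
  finally have "(LINT t|lebesgue_on {0<..<T}. (norm (v t))\<^sup>2) = Re (LINT t|lebesgue_on {0<..<T}. cinner (v t) (?y t))"
    by (metis Re_complex_of_real)
  also have "\<dots> = (LINT t|lebesgue_on {0<..<T}. inner (v t) (?y t))"
    using vy by (simp add: Re_cinner flip: integral_Re)
  also have "\<dots> \<le> (LINT t|lebesgue_on {0<..<T}. (norm (v t))\<^sup>2 / 2 + (norm (?y t))\<^sup>2 / 2)"
  proof (rule integral_mono)
    show "integrable (lebesgue_on {0<..<T}) (\<lambda>t. inner (v t) (?y t))"
      using integrable_Re[OF vy] by (simp add: Re_cinner)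
    show "integrable (lebesgue_on {0<..<T}) (\<lambda>t. (norm (v t))\<^sup>2 / 2 + (norm (?y t))\<^sup>2 / 2)"
      using vi integrable_continuous_Ioo(1)[OF yc] by simp
    show "inner (v t) (?y t) \<le> (norm (v t))\<^sup>2 / 2 + (norm (?y t))\<^sup>2 / 2" for t
      using norm_cauchy_schwarz[of "v t" "?y t"] sum_squares_bound[of "norm (v t)" "norm (?y t)"]
      by (simp add: field_simps)
  qed
  also have "\<dots> = (LINT t|lebesgue_on {0<..<T}. (norm (v t))\<^sup>2) / 2 + energy T z / 2"
    using vi integrable_continuous_Ioo(1)[OF yc] integrable_continuous_Ioo(2)[OF yc]
    by (simp add: energy_reversed)
  finally show ?thesis unfolding v(1) by simp
qed

end

section \<open>Orthonormal bases of finite dimensional subspaces\<close>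

definition orthonormal :: "'a::complex_hilbert set \<Rightarrow> bool" where
  "orthonormal F \<longleftrightarrow> (\<forall>x\<in>F. \<forall>y\<in>F. cinner x y = (if x = y then 1 else 0))"

definition proj :: "'a::complex_hilbert set \<Rightarrow> 'a \<Rightarrow> 'a" where
  "proj F z = (\<Sum>e\<in>F. cinner z e *\<^sub>C e)"

lemma proj_in_span: "proj F z \<in> cspan F"
  unfolding proj_def by (intro complex_vector.span_sum complex_vector.span_scale complex_vector.span_base)

lemma bounded_linear_proj: "bounded_linear (proj F)"
  unfolding proj_def
proof (rule bounded_linear_sum)
  fix e :: 'a
  show "bounded_linear (\<lambda>z. cinner z e *\<^sub>C e)"
  proof (rule bounded_linear_intro)
    show "norm (cinner z e *\<^sub>C e) \<le> norm z * (norm e * norm e)" for z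
    proof -
      have "cmod (cinner z e) * norm e \<le> (norm z * norm e) * norm e"
        by (intro mult_right_mono norm_cinner_le) simp
      then show ?thesis by (simp add: norm_scaleC ac_simps)
    qed
  qed (simp_all add: cinner_add_left scaleC_add_left scaleR_scaleC cinner_scaleC_left scaleC_scaleC)
qed

lemma proj_scaleC: "proj F (c *\<^sub>C z) = c *\<^sub>C proj F z"
  unfolding proj_def by (simp add: cinner_scaleC_left scaleC_scaleC complex_vector.scale_sum_right)

lemma residual_orthogonal_basis:
  assumes F: "finite F" "orthonormal F" and e: "e \<in> F"
  shows "cinner (z - proj F z) e = 0"
proof -
  have "cinner (proj F z) e = (\<Sum>e'\<in>F. cinner z e' * cinner e' e)"
    by (simp add: proj_def cinner_sum_left cinner_scaleC_left)
  also have "\<dots> = (\<Sum>e'\<in>F. if e' = e then cinner z e else 0)"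
    using F(2) e by (intro sum.cong) (auto simp: orthonormal_def)
  also have "\<dots> = cinner z e" using F(1) e by simp
  finally show ?thesis by (simp add: cinner_diff_left)
qed

lemma orthogonal_span:
  assumes x: "\<And>e. e \<in> F \<Longrightarrow> cinner x e = 0" and y: "y \<in> cspan F"
  shows "cinner x y = 0"
  using y
proof (rule complex_vector.span_induct)
  show "complex_vector.subspace {y. cinner x y = 0}"
    by (auto simp: complex_vector.subspace_def cinner_add_right cinner_scaleC_right)
qed (rule x)

lemma residual_orthogonal:
  assumes "finite F" "orthonormal F" "y \<in> cspan F"
  shows "cinner (z - proj F z) y = 0"
  by (rule orthogonal_span[OF residual_orthogonal_basis[OF assms(1,2)] assms(3)])

lemma proj_eq:
  assumes "finite F" "orthonormal F" "z \<in> cspan F"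
  shows "proj F z = z"
proof -
  have "z - proj F z \<in> cspan F" by (intro complex_vector.span_diff assms proj_in_span)
  then have "cinner (z - proj F z) (z - proj F z) = 0" by (rule residual_orthogonal[OF assms(1,2)])
  then show ?thesis by simp
qed

lemma orthonormal_independent:
  assumes "finite F" "orthonormal F"
  shows "complex_vector.independent F"
proof (rule complex_vector.independent_if_scalars_zero[OF assms(1)])
  fix f x assume f: "(\<Sum>x\<in>F. f x *\<^sub>C x) = 0" and x: "x \<in> F"
  have "0 = cinner (\<Sum>x\<in>F. f x *\<^sub>C x) x" using f by simp
  also have "\<dots> = (\<Sum>y\<in>F. f y * cinner y x)" by (simp add: cinner_sum_left cinner_scaleC_left)
  also have "\<dots> = (\<Sum>y\<in>F. if y = x then f x else 0)"
    using assms(2) x by (intro sum.cong) (auto simp: orthonormal_def)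
  also have "\<dots> = f x" using assms(1) x by simp
  finally show "f x = 0" by simp
qed

lemma norm_orthonormal: "orthonormal F \<Longrightarrow> e \<in> F \<Longrightarrow> norm e = 1"
proof -
  assume "orthonormal F" "e \<in> F"
  then have "complex_of_real ((norm e)\<^sup>2) = 1" unfolding cinner_self[symmetric] by (simp add: orthonormal_def)
  then have "(norm e)\<^sup>2 = 1" by (metis of_real_eq_1_iff)
  then show ?thesis using norm_ge_zero[of e] by (simp add: power2_eq_1_iff)
qed

text \<open>An orthonormal subset of maximal cardinality spans: the component of any other vector orthogonal to
  its span could be normalised and added.\<close>

lemma exists_orthonormal_basis:
  assumes M: "complex_vector.subspace M"
    and k: "\<And>F. finite F \<Longrightarrow> F \<subseteq> M \<Longrightarrow> orthonormal F \<Longrightarrow> card F \<le> k"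
  shows "\<exists>F. finite F \<and> orthonormal F \<and> cspan F = M"
proof -
  let ?Q = "\<lambda>n. \<exists>F. finite F \<and> F \<subseteq> M \<and> orthonormal F \<and> card F = n"
  have "?Q 0" by (intro exI[of _ "{}"]) (simp add: orthonormal_def)
  then have "\<exists>n. ?Q n \<and> (\<forall>m. ?Q m \<longrightarrow> m \<le> n)"
    using k by (intro Nat.ex_has_greatest_nat[of ?Q 0 k]) auto
  then obtain F where F: "finite F" "F \<subseteq> M" "orthonormal F"
    and max: "\<And>F'. finite F' \<Longrightarrow> F' \<subseteq> M \<Longrightarrow> orthonormal F' \<Longrightarrow> card F' \<le> card F" by blast
  have sub: "cspan F \<subseteq> M" by (rule complex_vector.span_minimal[OF F(2) M])
  have "x \<in> cspan F" if x: "x \<in> M" for x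
  proof (rule ccontr)
    assume nx: "x \<notin> cspan F"
    define w where "w = x - proj F x"
    have w: "w \<noteq> 0" using nx proj_in_span[of F x] by (auto simp: w_def)
    have wM: "w \<in> M" unfolding w_def
      using sub proj_in_span by (intro complex_vector.subspace_diff[OF M x]) blast
    define e where "e = complex_of_real (inverse (norm w)) *\<^sub>C w"
    have eM: "e \<in> M" unfolding e_def by (rule complex_vector.subspace_scale[OF M wM])
    have "norm e = 1" using w by (simp add: e_def norm_scaleC norm_inverse)
    then have ee: "cinner e e = 1" by (simp add: cinner_self)
    have eF: "cinner e y = 0" if "y \<in> F" for y
      using residual_orthogonal_basis[OF F(1,3) that, of x] by (simp add: e_def cinner_scaleC_left w_def)
    have Fe: "cinner y e = 0" if "y \<in> F" for y
      using eF[OF that] by (metis cinner_commute complex_cnj_zero)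
    have "e \<notin> F" using eF ee by force
    moreover have "orthonormal (insert e F)"
      using F(3) ee eF Fe by (auto simp: orthonormal_def)
    ultimately show False using max[of "insert e F"] F eM by simp
  qed
  with sub F show ?thesis by blast
qed

text \<open>Orthonormal vectors are at distance \<open>sqrt 2\<close> from each other, and the compact operator \<open>P\<close>
  keeps those in \<open>M\<close> apart; only finitely many points of a compact set can be that far apart.\<close>

lemma orthonormal_card_bound:
  fixes P :: "'a::complex_hilbert \<Rightarrow> 'v::complex_banach"
  assumes P: "compact_operator P" and \<alpha>: "\<alpha> > 0" and M: "complex_vector.subspace M"
    and le: "\<And>z. z \<in> M \<Longrightarrow> \<alpha> * (norm z)\<^sup>2 \<le> (norm (P z))\<^sup>2"
  shows "\<exists>k. \<forall>F. finite F \<and> F \<subseteq> M \<and> orthonormal F \<longrightarrow> card F \<le> k"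
proof -
  have lin: "bounded_linear P" using P by (simp add: compact_operator_def bounded_clinear_def)
  interpret P: bounded_linear P by (rule lin)
  have "compact (closure (P ` cball 0 1))" using P by (simp add: compact_operator_def)
  then have "\<forall>e>0. \<exists>K. finite K \<and> closure (P ` cball 0 1) \<subseteq> (\<Union>x\<in>K. ball x e)"
    unfolding compact_eq_totally_bounded by (rule conjunct2)
  moreover have "sqrt \<alpha> / 2 > 0" using \<alpha> by simp
  ultimately obtain K where K: "finite K" "closure (P ` cball 0 1) \<subseteq> (\<Union>x\<in>K. ball x (sqrt \<alpha> / 2))"
    by blast
  have "card F \<le> card K" if F: "finite F" "F \<subseteq> M" "orthonormal F" for F
  proof -
    have "\<forall>e\<in>F. \<exists>x. x \<in> K \<and> dist x (P e) < sqrt \<alpha> / 2"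
    proof
      fix e assume "e \<in> F"
      then have "P e \<in> P ` cball 0 1" using norm_orthonormal[OF F(3)] by (intro imageI) simp
      then have "P e \<in> closure (P ` cball 0 1)" by (rule closure_subset[THEN subsetD])
      then have "P e \<in> (\<Union>x\<in>K. ball x (sqrt \<alpha> / 2))" by (rule K(2)[THEN subsetD])
      then show "\<exists>x. x \<in> K \<and> dist x (P e) < sqrt \<alpha> / 2" unfolding UN_iff mem_ball by blast
    qed
    from bchoice[OF this] obtain c where
      c: "\<And>e. e \<in> F \<Longrightarrow> c e \<in> K" "\<And>e. e \<in> F \<Longrightarrow> dist (c e) (P e) < sqrt \<alpha> / 2" by blast
    have "inj_on c F"
    proof (rule inj_onI, rule ccontr)
      fix e e' assume e: "e \<in> F" "e' \<in> F" "c e = c e'" "e \<noteq> e'"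
      have "complex_of_real ((norm (e - e'))\<^sup>2) = 2"
        unfolding cinner_self[symmetric] using F(3) e
        by (simp add: cinner_diff_left cinner_diff_right orthonormal_def)
      then have n2: "(norm (e - e'))\<^sup>2 = 2" by (metis of_real_eq_iff of_real_numeral)
      have "dist (P e) (P e') < sqrt \<alpha>"
        using c(2)[OF e(1)] c(2)[OF e(2)] e(3) dist_triangle3[of "P e" "P e'" "c e"] by simp
      then have "norm (P (e - e')) < sqrt \<alpha>" by (simp add: dist_norm P.diff)
      then have "(norm (P (e - e')))\<^sup>2 < (sqrt \<alpha>)\<^sup>2" by (intro power_strict_mono) auto
      moreover have "\<alpha> * (norm (e - e'))\<^sup>2 \<le> (norm (P (e - e')))\<^sup>2"
        using F(2) e by (intro le complex_vector.subspace_diff[OF M]) auto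
      ultimately show False using \<alpha> n2 by simp
    qed
    then show ?thesis using c(1) K(1) by (intro card_inj_on_le) auto
  qed
  then show ?thesis by blast
qed

section \<open>Generalised eigenspaces of a linear map\<close>

text \<open>A family with a repeated member has an obvious relation; otherwise the \<open>card F + 1\<close> members form a set
too large to be independent.\<close>

lemma exists_linear_relation:
  fixes x :: "nat \<Rightarrow> 'a::complex_normed_vector"
  assumes F: "finite F" and x: "\<And>k. x k \<in> cspan F"
  shows "\<exists>a. (\<exists>k\<le>card F. a k \<noteq> 0) \<and> (\<Sum>k\<le>card F. a k *\<^sub>C x k) = 0"
proof (cases "inj_on x {..card F}")
  case True
  have "complex_vector.dependent (x ` {..card F})"
  proof (rule ccontr)
    assume "\<not> ?thesis"
    then have "card (x ` {..card F}) \<le> card F"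
      using complex_vector.independent_span_bound[OF F, of "x ` {..card F}"] x by auto
    then show False using card_image[OF True] by simp
  qed
  then obtain u where u: "\<exists>v\<in>x ` {..card F}. u v \<noteq> 0" "(\<Sum>v\<in>x ` {..card F}. u v *\<^sub>C v) = 0"
    using complex_vector.dependent_finite[of "x ` {..card F}"] by auto
  then show ?thesis
    by (intro exI[of _ "u \<circ> x"]) (auto simp: sum.reindex[OF True])
next
  case False
  then obtain i j where ij: "i \<le> card F" "j \<le> card F" "i \<noteq> j" "x i = x j"
    by (auto simp: inj_on_def)
  let ?a = "\<lambda>k. if k = i then 1 else if k = j then -1 else (0::complex)"
  have "(\<Sum>k\<le>card F. ?a k *\<^sub>C x k) = (\<Sum>k\<in>{i,j}. ?a k *\<^sub>C x k)"
    using ij by (intro sum.mono_neutral_right) auto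
  also have "\<dots> = 0" using ij by (simp add: scaleC_minus_one)
  finally show ?thesis using ij by (intro exI[of _ ?a]) auto
qed

locale operator_on_subspace =
  fixes K :: "'a::complex_normed_vector \<Rightarrow> 'a" and N :: "'a set"
  assumes K_add: "K (x + y) = K x + K y" and K_scale: "K (c *\<^sub>C x) = c *\<^sub>C K x"
    and N: "complex_vector.subspace N" and K_in: "z \<in> N \<Longrightarrow> K z \<in> N"
begin

text \<open>The operator \<open>c - K\<close>; its powers vanish on the generalised eigenspace \<open>Gen c\<close>.\<close>

definition X :: "complex \<Rightarrow> 'a \<Rightarrow> 'a" where "X c z = c *\<^sub>C z - K z"

definition Gen :: "complex \<Rightarrow> 'a set" where "Gen c = {z \<in> N. \<exists>m. (X c ^^ m) z = 0}"

lemma X_add: "X c (x + y) = X c x + X c y"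
  by (simp add: X_def K_add scaleC_add_right)

lemma X_scale: "X c (a *\<^sub>C x) = a *\<^sub>C X c x"
  by (simp add: X_def K_scale scaleC_scaleC scaleC_diff_right mult.commute)

lemma X_zero [simp]: "X c 0 = 0"
  using X_scale[of c 0 0] by simp

lemma X_diff: "X c (x - y) = X c x - X c y"
  using X_add[of c "x - y" y] by (simp add: algebra_simps)

lemma X_in: "z \<in> N \<Longrightarrow> X c z \<in> N"
  unfolding X_def by (intro complex_vector.subspace_diff[OF N] complex_vector.subspace_scale[OF N] K_in)

lemma X_commute: "X a (X b z) = X b (X a z)"
proof -
  have K_diff: "K (x - y) = K x - K y" for x y using K_add[of "x - y" y] by (simp add: algebra_simps)
  show ?thesis
    unfolding X_def K_diff K_scale scaleC_diff_right scaleC_scaleC mult.commute[of b a]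
    by (simp add: algebra_simps)
qed

lemma Xpow_add: "(X c ^^ m) (x + y) = (X c ^^ m) x + (X c ^^ m) y"
  by (induction m) (simp_all add: X_add)

lemma Xpow_scale: "(X c ^^ m) (a *\<^sub>C x) = a *\<^sub>C (X c ^^ m) x"
  by (induction m) (simp_all add: X_scale)

lemma Xpow_zero [simp]: "(X c ^^ m) 0 = 0"
  using Xpow_scale[of m c 0 0] by simp

lemma Xpow_in: "z \<in> N \<Longrightarrow> (X c ^^ m) z \<in> N"
  by (induction m) (simp_all add: X_in)

lemma Xpow_X: "(X a ^^ m) (X b z) = X b ((X a ^^ m) z)"
  by (induction m) (simp_all add: X_commute)

lemma Xpow_Xpow: "(X a ^^ m) ((X b ^^ k) z) = (X b ^^ k) ((X a ^^ m) z)"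
  by (induction k) (simp_all add: Xpow_X)

lemma Xpow_mono: "(X c ^^ m) z = 0 \<Longrightarrow> m \<le> k \<Longrightarrow> (X c ^^ k) z = 0"
  by (metis Xpow_zero funpow_add le_add_diff_inverse2 o_apply)

lemma Gen_subspace: "complex_vector.subspace (Gen c)"
  unfolding complex_vector.subspace_def
proof (intro conjI ballI allI)
  show "0 \<in> Gen c" using complex_vector.subspace_0[OF N] by (simp add: Gen_def)
  show "x + y \<in> Gen c" if xy: "x \<in> Gen c" "y \<in> Gen c" for x y
  proof -
    obtain m k where "(X c ^^ m) x = 0" "(X c ^^ k) y = 0" using xy by (auto simp: Gen_def)
    then have "(X c ^^ (m + k)) (x + y) = 0"
      using Xpow_mono[of m c x "m + k"] Xpow_mono[of k c y "m + k"] by (simp add: Xpow_add)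
    then show ?thesis using xy complex_vector.subspace_add[OF N] by (auto simp: Gen_def)
  qed
  show "a *\<^sub>C x \<in> Gen c" if "x \<in> Gen c" for a x
    using that complex_vector.subspace_scale[OF N] by (auto simp: Gen_def Xpow_scale)
qed

lemma Gen_Xpow: "z \<in> Gen i \<Longrightarrow> (X j ^^ m) z \<in> Gen i"
  by (auto simp: Gen_def Xpow_in) (metis Xpow_Xpow Xpow_zero)

text \<open>On an eigenvector for \<open>j\<close> the operator \<open>i - K\<close> is multiplication by \<open>i - j\<close>, and no power of this
number vanishes.\<close>

lemma eigenvector_in_other_Gen:
  assumes z: "z \<in> Gen i" and e: "X j z = 0" and ij: "i \<noteq> j"
  shows "z = 0"
proof -
  obtain m where m: "(X i ^^ m) z = 0" using z by (auto simp: Gen_def)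
  have "(X i ^^ m) z = (i - j)^m *\<^sub>C z"
  proof (induction m)
    case (Suc m)
    have "X i z = (i - j) *\<^sub>C z"
      using e by (simp add: X_def complex_vector.scale_left_diff_distrib)
    then show ?case using Suc by (simp add: X_scale scaleC_scaleC mult.commute)
  qed simp
  with m ij show ?thesis by (simp add: complex_vector.scale_eq_0_iff)
qed

lemma Xpow_injective_on_other_Gen:
  assumes "z \<in> Gen i" "(X j ^^ m) z = 0" "i \<noteq> j"
  shows "z = 0"
  using assms
proof (induction m)
  case (Suc m)
  have "(X j ^^ m) z = 0"
    by (rule eigenvector_in_other_Gen[OF Gen_Xpow[OF Suc.prems(1)] _ Suc.prems(3)]) (use Suc.prems in simp)
  then show ?case using Suc by blast
qed simp

text \<open>A power of \<open>X j\<close> removes the component in \<open>Gen j\<close> from a vanishing sum and is injective on the other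
components.\<close>

lemma Gen_direct: "sum_is_direct J Gen"
proof -
  have "finite F \<Longrightarrow> (\<forall>i\<in>F. z i \<in> Gen i) \<Longrightarrow> (\<Sum>i\<in>F. z i) = 0 \<Longrightarrow> \<forall>i\<in>F. z i = 0" for F z
  proof (induction F arbitrary: z rule: finite_induct)
    case (insert j F)
    obtain m where m: "(X j ^^ m) (z j) = 0" using insert.prems(1) by (auto simp: Gen_def)
    have sum: "(X j ^^ m) (\<Sum>i\<in>F'. z i) = (\<Sum>i\<in>F'. (X j ^^ m) (z i))" if "finite F'" for F'
      using that by (induction F' rule: finite_induct) (simp_all add: Xpow_add)
    have "(\<Sum>i\<in>F. (X j ^^ m) (z i)) = 0"
      using sum[of "insert j F"] insert m by simp
    then have "\<forall>i\<in>F. (X j ^^ m) (z i) = 0"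
      using insert.prems(1) by (intro insert.IH) (auto intro: Gen_Xpow)
    then have F: "\<forall>i\<in>F. z i = 0"
      using insert.prems(1) insert.hyps(2) Xpow_injective_on_other_Gen by (metis insertCI)
    then show ?case using insert by simp
  qed simp
  then show ?thesis unfolding sum_is_direct_def by blast
qed

text \<open>On \<open>Gen i\<close> the operator \<open>j - K = (j - i) + (i - K)\<close> is a nonzero scalar plus a nilpotent operator.
The induction on the nilpotency order is the finite Neumann series.\<close>

lemma X_surjective_on_other_Gen:
  assumes "w \<in> N" "(X i ^^ m) w = 0" "i \<noteq> j"
  shows "\<exists>z\<in>Gen i. X j z = w"
  using assms
proof (induction m arbitrary: w)
  case 0
  then show ?case using complex_vector.subspace_0[OF Gen_subspace] by (intro bexI[of _ 0]) auto
next
  case (Suc m)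
  have "(X i ^^ m) (X i w) = 0" using Suc.prems(2) by (simp only: Xpow_X) simp
  then obtain y where y: "y \<in> Gen i" "X j y = X i w" using Suc.IH[OF X_in[OF Suc.prems(1)]] Suc.prems by blast
  have w: "w \<in> Gen i" using Suc.prems by (auto simp: Gen_def simp del: funpow.simps)
  have "X j w = (j - i) *\<^sub>C w + X i w"
    by (simp add: X_def complex_vector.scale_left_diff_distrib)
  then have "X j (w - y) = (j - i) *\<^sub>C w" using y(2) by (simp add: X_diff)
  then have "X j (inverse (j - i) *\<^sub>C (w - y)) = w"
    using Suc.prems(3) by (simp add: X_scale scaleC_scaleC)
  moreover have "inverse (j - i) *\<^sub>C (w - y) \<in> Gen i"
    by (intro complex_vector.subspace_scale[OF Gen_subspace] complex_vector.subspace_diff[OF Gen_subspace] w y)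
  ultimately show ?case by blast
qed

lemma span_Gen_subset: "cspan (\<Union>c. Gen c) \<subseteq> N"
  by (rule complex_vector.span_minimal[OF _ N]) (auto simp: Gen_def)

text \<open>Up to an element of \<open>Gen r\<close>, a vector in the span of the generalised eigenspaces is the image under
\<open>X r\<close> of a vector \<open>y\<close> in that span. Hence \<open>X r (z - y)\<close> lies in \<open>Gen r\<close>, and so does \<open>z - y\<close>.\<close>

lemma preimage_in_span_Gen:
  assumes z: "z \<in> N" and Xz: "X r z \<in> cspan (\<Union>c. Gen c)"
  shows "z \<in> cspan (\<Union>c. Gen c)"
proof -
  let ?W = "cspan (\<Union>c. Gen c)"
  let ?Q = "{w. \<exists>y\<in>?W. \<exists>v\<in>Gen r. w = X r y + v}"
  have "?W \<subseteq> ?Q"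
  proof (rule complex_vector.span_minimal)
    show "complex_vector.subspace ?Q"
      unfolding complex_vector.subspace_def
    proof (intro conjI ballI allI)
      show "0 \<in> ?Q"
        using complex_vector.span_zero complex_vector.subspace_0[OF Gen_subspace]
        by (auto intro!: bexI[of _ 0])
      show "x + y \<in> ?Q" if xy: "x \<in> ?Q" "y \<in> ?Q" for x y
      proof -
        obtain x1 x2 y1 y2 where "x1 \<in> ?W" "x2 \<in> Gen r" "x = X r x1 + x2" "y1 \<in> ?W" "y2 \<in> Gen r" "y = X r y1 + y2"
          using xy by blast
        then show ?thesis
          using complex_vector.span_add[of x1 _ y1] complex_vector.subspace_add[OF Gen_subspace, of x2 r y2]
          by (intro CollectI bexI[of _ "x1 + y1"] bexI[of _ "x2 + y2"]) (auto simp: X_add)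
      qed
      show "a *\<^sub>C x \<in> ?Q" if x: "x \<in> ?Q" for a x
      proof -
        obtain x1 x2 where "x1 \<in> ?W" "x2 \<in> Gen r" "x = X r x1 + x2" using x by blast
        then show ?thesis
          using complex_vector.span_scale[of x1 _ a] complex_vector.subspace_scale[OF Gen_subspace, of x2 r a]
          by (intro CollectI bexI[of _ "a *\<^sub>C x1"] bexI[of _ "a *\<^sub>C x2"]) (auto simp: X_scale scaleC_add_right)
      qed
    qed
    show "(\<Union>c. Gen c) \<subseteq> ?Q"
    proof
      fix w assume w: "w \<in> (\<Union>c. Gen c)"
      obtain i m where i: "w \<in> Gen i" "w \<in> N" "(X i ^^ m) w = 0" using w by (auto simp: Gen_def)
      show "w \<in> ?Q"
      proof (cases "i = r")
        case True
        then show ?thesis using i complex_vector.span_zero by (intro CollectI bexI[of _ 0] bexI[of _ w]) auto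
      next
        case False
        then obtain y where "y \<in> Gen i" "X r y = w" using X_surjective_on_other_Gen[OF i(2,3)] by blast
        then show ?thesis
          using complex_vector.span_base[of y "\<Union>c. Gen c"] complex_vector.subspace_0[OF Gen_subspace]
          by (intro CollectI bexI[of _ y] bexI[of _ 0]) auto
      qed
    qed
  qed
  then have "X r z \<in> ?Q" using Xz by blast
  then obtain y v where y: "y \<in> ?W" "v \<in> Gen r" "X r z = X r y + v" by blast
  have zy: "z - y \<in> N" using z y(1) span_Gen_subset by (intro complex_vector.subspace_diff[OF N]) auto
  obtain m where "(X r ^^ m) v = 0" using y(2) by (auto simp: Gen_def)
  then have "(X r ^^ m) (X r (z - y)) = 0" using y(3) by (simp add: X_diff)
  then have "(X r ^^ Suc m) (z - y) = 0" by (simp add: Xpow_X)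
  then have "z - y \<in> Gen r" using zy unfolding Gen_def by blast
  then have "(z - y) + y \<in> ?W" by (intro complex_vector.span_add y(1) complex_vector.span_base) auto
  then show ?thesis by simp
qed

text \<open>The vector \<open>p(K) z\<close>.\<close>

definition peval :: "complex poly \<Rightarrow> 'a \<Rightarrow> 'a" where
  "peval p z = (\<Sum>k\<le>degree p. coeff p k *\<^sub>C (K ^^ k) z)"

lemma peval_eq: "degree p \<le> n \<Longrightarrow> peval p z = (\<Sum>k\<le>n. coeff p k *\<^sub>C (K ^^ k) z)"
  unfolding peval_def by (intro sum.mono_neutral_left) (auto simp: coeff_eq_0)

lemma peval_linear_factor: "peval ([:-r, 1:] * q) z = - peval q (X r z)"
proof -
  have K0: "K 0 = 0" using K_scale[of 0 0] by simp
  have Km: "K (- x) = - K x" for x using K_scale[of "-1" x] by (simp add: scaleC_minus_one)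
  have Kp_add: "(K ^^ k) (x + y) = (K ^^ k) x + (K ^^ k) y" for k x y
    by (induction k) (simp_all add: K_add)
  have Kp_scale: "(K ^^ k) (c *\<^sub>C x) = c *\<^sub>C (K ^^ k) x" for k c x
    by (induction k) (simp_all add: K_scale)
  have KX: "(K ^^ k) (X r z) = r *\<^sub>C (K ^^ k) z - (K ^^ Suc k) z" for k
    using Kp_add[of k "X r z" "K z"] by (simp add: X_def Kp_scale funpow_swap1 algebra_simps)
  define n where "n = degree q"
  have eq: "[:-r, 1:] * q = pCons 0 q - smult r q" by simp
  have "degree ([:-r, 1:] * q) \<le> Suc n"
    unfolding n_def using degree_mult_le[of "[:-r, 1:]" q] by simp
  then have "peval ([:-r, 1:] * q) z = (\<Sum>k\<le>Suc n. coeff (pCons 0 q - smult r q) k *\<^sub>C (K ^^ k) z)"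
    unfolding eq by (rule peval_eq)
  also have "\<dots> = (\<Sum>k\<le>Suc n. coeff (pCons 0 q) k *\<^sub>C (K ^^ k) z) - (\<Sum>k\<le>Suc n. (r * coeff q k) *\<^sub>C (K ^^ k) z)"
    by (simp add: complex_vector.scale_left_diff_distrib sum_subtractf del: sum.atMost_Suc)
  also have "(\<Sum>k\<le>Suc n. coeff (pCons 0 q) k *\<^sub>C (K ^^ k) z) = (\<Sum>k\<le>n. coeff q k *\<^sub>C (K ^^ Suc k) z)"
    by (subst sum.atMost_Suc_shift) simp
  also have "(\<Sum>k\<le>Suc n. (r * coeff q k) *\<^sub>C (K ^^ k) z) = (\<Sum>k\<le>n. (r * coeff q k) *\<^sub>C (K ^^ k) z)"
    by (simp add: n_def coeff_eq_0)
  also have "(\<Sum>k\<le>n. coeff q k *\<^sub>C (K ^^ Suc k) z) - (\<Sum>k\<le>n. (r * coeff q k) *\<^sub>C (K ^^ k) z)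
      = - (\<Sum>k\<le>n. coeff q k *\<^sub>C (K ^^ k) (X r z))"
    unfolding sum_subtractf[symmetric] sum_negf[symmetric]
    by (intro sum.cong refl) (simp add: KX scaleC_diff_right scaleC_scaleC mult.commute)
  finally show ?thesis by (simp add: peval_def n_def)
qed

text \<open>By the fundamental theorem of algebra a linear factor splits off from \<open>p\<close>; the remaining factor
annihilates \<open>X r z\<close>.\<close>

lemma annihilated_in_span_Gen:
  assumes "p \<noteq> 0" "peval p z = 0" "z \<in> N"
  shows "z \<in> cspan (\<Union>c. Gen c)"
  using assms
proof (induction "degree p" arbitrary: p z)
  case 0
  then obtain a where a: "p = [:a:]" by (metis degree_eq_zeroE)
  then have "z = 0" using 0 by (simp add: peval_def complex_vector.scale_eq_0_iff)
  then show ?case using complex_vector.span_zero by blast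
next
  case (Suc n)
  have "\<not> constant (poly p)" using Suc.hyps(2) by (simp add: constant_degree)
  then obtain r where "poly p r = 0" using fundamental_theorem_of_algebra by blast
  then obtain q where q: "p = [:-r, 1:] * q" by (auto simp: poly_eq_0_iff_dvd elim: dvdE)
  then have q0: "q \<noteq> 0" using Suc.prems(1) by auto
  then have "degree p = Suc (degree q)" unfolding q by (subst degree_mult_eq) auto
  then have "n = degree q" using Suc.hyps(2) by simp
  moreover have "peval q (X r z) = 0" using Suc.prems(2) unfolding q peval_linear_factor by simp
  ultimately have "X r z \<in> cspan (\<Union>c. Gen c)" using Suc.hyps(1) q0 X_in[OF Suc.prems(3)] by blast
  then show ?case by (rule preimage_in_span_Gen[OF Suc.prems(3)])
qed

text \<open>In a space of finite dimension the vectors \<open>z, K z, K (K z), \<dots>\<close> are dependent, so that every vector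
is annihilated by a nonzero polynomial in \<open>K\<close>.\<close>

lemma span_Gen:
  assumes F: "finite F" "cspan F = N"
  shows "cspan (\<Union>c. Gen c) = N"
proof
  show "N \<subseteq> cspan (\<Union>c. Gen c)"
  proof
    fix z assume z: "z \<in> N"
    have "(K ^^ k) z \<in> N" for k by (induction k) (simp_all add: z K_in)
    then obtain a where a: "\<exists>k\<le>card F. a k \<noteq> 0" "(\<Sum>k\<le>card F. a k *\<^sub>C (K ^^ k) z) = 0"
      using exists_linear_relation[OF F(1), of "\<lambda>k. (K ^^ k) z"] F(2) by blast
    define p where "p = (\<Sum>k\<le>card F. monom (a k) k)"
    have coeff: "coeff p k = (if k \<le> card F then a k else 0)" for k
      by (simp add: p_def coeff_sum)
    have "p \<noteq> 0" using a(1) coeff by (metis coeff_0)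
    moreover have "degree p \<le> card F" by (rule degree_le) (simp add: coeff)
    then have "peval p z = 0" using a(2) by (simp add: peval_eq coeff)
    ultimately show "z \<in> cspan (\<Union>c. Gen c)" using z by (rule annihilated_in_span_Gen)
  qed
qed (rule span_Gen_subset)

text \<open>Eigenvectors for distinct eigenvalues are independent, so there are at most \<open>dim N\<close> of them.\<close>

lemma finite_eigenvalues:
  assumes F: "finite F" "cspan F = N"
  shows "finite {c. \<exists>z\<in>N. z \<noteq> 0 \<and> X c z = 0}" (is "finite ?S")
proof (rule ccontr)
  assume "infinite ?S"
  then obtain J where J: "finite J" "J \<subseteq> ?S" "card J = Suc (card F)"
    using infinite_arbitrarily_large by blast
  have "\<forall>c\<in>J. \<exists>z. z \<in> N \<and> z \<noteq> 0 \<and> X c z = 0" using J(2) by blast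
  from bchoice[OF this] obtain e where
    e: "\<And>c. c \<in> J \<Longrightarrow> e c \<in> N \<and> e c \<noteq> 0 \<and> X c (e c) = 0" by blast
  have eG: "e c \<in> Gen c" if "c \<in> J" for c
    unfolding Gen_def using e[OF that] by (intro CollectI conjI exI[of _ 1]) auto
  have inj: "inj_on e J"
  proof (rule inj_onI, rule ccontr)
    fix c d assume cd: "c \<in> J" "d \<in> J" "e c = e d" "c \<noteq> d"
    then have "X d (e c) = 0" using e by simp
    then show False using eigenvector_in_other_Gen[OF eG[OF cd(1)] _ cd(4)] e[OF cd(1)] by blast
  qed
  have "complex_vector.independent (e ` J)"
  proof (rule complex_vector.independent_if_scalars_zero)
    fix f v assume f: "(\<Sum>v\<in>e ` J. f v *\<^sub>C v) = 0" and v: "v \<in> e ` J"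
    have "(\<Sum>c\<in>J. f (e c) *\<^sub>C e c) = 0" using f by (simp add: sum.reindex[OF inj])
    moreover have "\<forall>c\<in>J. f (e c) *\<^sub>C e c \<in> Gen c"
      using eG complex_vector.subspace_scale[OF Gen_subspace] by blast
    ultimately have "\<forall>c\<in>J. f (e c) *\<^sub>C e c = 0"
      using Gen_direct[of J, unfolded sum_is_direct_def, rule_format, of J "\<lambda>c. f (e c) *\<^sub>C e c"] J(1)
      by blast
    then show "f v = 0" using v e by (auto simp: complex_vector.scale_eq_0_iff)
  qed (use J in simp)
  then have "card (e ` J) \<le> card F"
    using complex_vector.independent_span_bound[OF F(1), of "e ` J"] e F(2) by auto
  then show False using card_image[OF inj] J by simp
qed

end

section \<open>The unobservable subspace\<close>

context admissible_system
begin

text \<open>The kernel of \<open>\<Phi>\<^sub>T\<^sup>*\<close>, described through \<open>D(A\<^sup>*)\<close>, where \<open>\<Phi>\<^sub>T\<^sup>*\<close> is explicit.\<close>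

definition output_kernel :: "real \<Rightarrow> 'h set" where
  "output_kernel T = {z. \<exists>w. (\<forall>n. w n \<in> D) \<and> w \<longlonglongrightarrow> z \<and> (\<lambda>n. energy T (w n)) \<longlonglongrightarrow> 0}"

text \<open>Unlike \<open>output_kernel T\<close>, this space consists of states in \<open>D(A\<^sup>*)\<close> and refers to all times; the
  two coincide for \<open>T > T0\<close>.\<close>

definition unobservable :: "'h set" where
  "unobservable = {z \<in> D. \<forall>t\<ge>0. C (R t z) = 0}"

lemma output_kernelI: "(\<And>n. w n \<in> D) \<Longrightarrow> w \<longlonglongrightarrow> z \<Longrightarrow> (\<lambda>n. energy T (w n)) \<longlonglongrightarrow> 0 \<Longrightarrow> z \<in> output_kernel T"
  unfolding output_kernel_def by blast

lemma output_kernelE: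
  assumes "z \<in> output_kernel T"
  obtains w where "\<And>n. w n \<in> D" "w \<longlonglongrightarrow> z" "(\<lambda>n. energy T (w n)) \<longlonglongrightarrow> 0"
  using assms unfolding output_kernel_def by blast

lemma energy_tendsto_0_if_le:
  assumes "\<And>n. energy T (v n) \<le> g n" "g \<longlonglongrightarrow> 0"
  shows "(\<lambda>n. energy T (v n)) \<longlonglongrightarrow> 0"
  by (rule tendsto_sandwich[OF _ _ tendsto_const assms(2)]) (use assms energy_nonneg in auto)

lemma output_kernel_subspace: "complex_vector.subspace (output_kernel T)"
  unfolding complex_vector.subspace_def
proof (intro conjI ballI allI)
  show "0 \<in> output_kernel T"
  proof (rule output_kernelI[of "\<lambda>_. 0"])
    have "energy T 0 = 0" using energy_scaleC[OF D_zero, of T 0] by simp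
    then show "(\<lambda>n. energy T 0) \<longlonglongrightarrow> 0" by simp
  qed (simp_all add: D_zero)
  show "x + y \<in> output_kernel T" if xy: "x \<in> output_kernel T" "y \<in> output_kernel T" for x y
  proof -
    obtain v where v: "\<And>n. v n \<in> D" "v \<longlonglongrightarrow> x" "(\<lambda>n. energy T (v n)) \<longlonglongrightarrow> 0" by (rule output_kernelE[OF xy(1)], rule that)
    obtain w where w: "\<And>n. w n \<in> D" "w \<longlonglongrightarrow> y" "(\<lambda>n. energy T (w n)) \<longlonglongrightarrow> 0" by (rule output_kernelE[OF xy(2)], rule that)
    show ?thesis
    proof (rule output_kernelI)
      show "v n + w n \<in> D" for n by (rule D_add[OF v(1) w(1)])
      show "(\<lambda>n. v n + w n) \<longlonglongrightarrow> x + y" by (rule tendsto_add[OF v(2) w(2)])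
      have "(\<lambda>n. 2 * energy T (v n) + 2 * energy T (w n)) \<longlonglongrightarrow> 0"
        by (rule tendsto_add_zero[OF tendsto_mult_right_zero[OF v(3)] tendsto_mult_right_zero[OF w(3)]])
      then show "(\<lambda>n. energy T (v n + w n)) \<longlonglongrightarrow> 0"
        by (rule energy_tendsto_0_if_le[OF energy_add_le[OF v(1) w(1)]])
    qed
  qed
  show "c *\<^sub>C x \<in> output_kernel T" if x: "x \<in> output_kernel T" for c x
  proof -
    obtain v where v: "\<And>n. v n \<in> D" "v \<longlonglongrightarrow> x" "(\<lambda>n. energy T (v n)) \<longlonglongrightarrow> 0" by (rule output_kernelE[OF x], rule that)
    show ?thesis
    proof (rule output_kernelI)
      show "c *\<^sub>C v n \<in> D" for n by (rule D_scaleC[OF v(1)])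
      show "(\<lambda>n. c *\<^sub>C v n) \<longlonglongrightarrow> c *\<^sub>C x" by (rule tendsto_scaleC[OF v(2)])
      show "(\<lambda>n. energy T (c *\<^sub>C v n)) \<longlonglongrightarrow> 0"
        unfolding energy_scaleC[OF v(1)] by (rule tendsto_mult_right_zero[OF v(3)])
    qed
  qed
qed

lemma output_kernel_antimono: "T \<le> T' \<Longrightarrow> output_kernel T' \<subseteq> output_kernel T"
proof
  fix z assume T: "T \<le> T'" and z: "z \<in> output_kernel T'"
  obtain v where v: "\<And>n. v n \<in> D" "v \<longlonglongrightarrow> z" "(\<lambda>n. energy T' (v n)) \<longlonglongrightarrow> 0" by (rule output_kernelE[OF z], rule that)
  show "z \<in> output_kernel T"
    by (rule output_kernelI[OF v(1,2) energy_tendsto_0_if_le[OF energy_mono[OF v(1) T] v(3)]])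
qed

text \<open>The output of \<open>R h z\<close> on \<open>[0, T]\<close> is the output of \<open>z\<close> on \<open>[h, T + h]\<close>.\<close>

lemma R_output_kernel:
  assumes z: "z \<in> output_kernel (T + h)" and h: "0 \<le> h" and T: "0 \<le> T"
  shows "R h z \<in> output_kernel T"
proof -
  obtain v where v: "\<And>n. v n \<in> D" "v \<longlonglongrightarrow> z" "(\<lambda>n. energy (T + h) (v n)) \<longlonglongrightarrow> 0" by (rule output_kernelE[OF z], rule that)
  show ?thesis
  proof (rule output_kernelI)
    show "R h (v n) \<in> D" for n by (rule R_in_D[OF v(1) h])
    show "(\<lambda>n. R h (v n)) \<longlonglongrightarrow> R h z" by (rule bounded_linear.tendsto[OF adjoint.linear[OF h] v(2)])
    show "(\<lambda>n. energy T (R h (v n))) \<longlonglongrightarrow> 0"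
      by (rule energy_tendsto_0_if_le[OF energy_shift[OF v(1) h T] v(3)])
  qed
qed

lemma output_kernel_output_eq_0:
  assumes "z \<in> output_kernel T" "z \<in> D" "0 < T" "t \<in> {0..T}" shows "C (R t z) = 0"
proof -
  obtain v where v: "\<And>n. v n \<in> D" "v \<longlonglongrightarrow> z" "(\<lambda>n. energy T (v n)) \<longlonglongrightarrow> 0" by (rule output_kernelE[OF assms(1)], rule that)
  show ?thesis by (rule output_closable[OF assms(2) v assms(3,4)])
qed

lemma unobservable_subset_output_kernel: "unobservable \<subseteq> output_kernel T"
proof
  fix z assume z: "z \<in> unobservable"
  have "energy T z = integral {0..T} (\<lambda>t. 0)"
    unfolding energy_def using z by (intro Henstock_Kurzweil_Integration.integral_cong) (simp add: unobservable_def)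
  then show "z \<in> output_kernel T" using z by (intro output_kernelI[of "\<lambda>_. z"]) (auto simp: unobservable_def)
qed

lemma unobservable_subspace: "complex_vector.subspace unobservable"
  unfolding complex_vector.subspace_def
proof (intro conjI ballI allI)
  show "0 \<in> unobservable" using C_scaleC[OF D_zero, of 0] by (simp add: unobservable_def D_zero R_zero)
  show "x + y \<in> unobservable" if "x \<in> unobservable" "y \<in> unobservable" for x y
    using that by (simp add: unobservable_def D_add R_add C_add R_in_D)
  show "c *\<^sub>C x \<in> unobservable" if "x \<in> unobservable" for c x
    using that by (simp add: unobservable_def D_scaleC R_scaleC C_scaleC R_in_D)
qed

lemma unobservable_in_D: "z \<in> unobservable \<Longrightarrow> z \<in> D"
  by (simp add: unobservable_def)

lemma R_unobservable: "z \<in> unobservable \<Longrightarrow> 0 \<le> h \<Longrightarrow> R h z \<in> unobservable"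
  by (simp add: unobservable_def R_in_D adjoint.add[symmetric])

lemma C_unobservable: "z \<in> unobservable \<Longrightarrow> C z = 0"
  unfolding unobservable_def using adjoint.zero[of z] by (metis (mono_tags, lifting) mem_Collect_eq order_refl)

text \<open>The difference quotients that define \<open>G z\<close> stay in the space, which is closed because it has finite
dimension; closedness is expressed by the continuous projection \<open>proj F\<close>.\<close>

lemma G_unobservable:
  assumes F: "finite F" "orthonormal F" "cspan F = unobservable" and z: "z \<in> unobservable"
  shows "G z \<in> unobservable"
proof -
  have lim: "((\<lambda>h. (R h z - z) /\<^sub>R h) \<longlongrightarrow> G z) (at_right 0)"
    using adj_eq_G[OF unobservable_in_D[OF z]] by (simp add: generator_R[symmetric] generator_eq_Some_iff)
  have "((\<lambda>h. proj F ((R h z - z) /\<^sub>R h)) \<longlongrightarrow> proj F (G z)) (at_right 0)"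
    by (rule bounded_linear.tendsto[OF bounded_linear_proj lim])
  moreover have "\<forall>\<^sub>F h in at_right 0. proj F ((R h z - z) /\<^sub>R h) = (R h z - z) /\<^sub>R h"
    using eventually_at_right_less[of "0::real"]
  proof eventually_elim
    case (elim h)
    have "(R h z - z) /\<^sub>R h \<in> unobservable"
      unfolding scaleR_scaleC using elim
      by (intro complex_vector.subspace_scale[OF unobservable_subspace] complex_vector.subspace_diff[OF unobservable_subspace] R_unobservable z) simp
    then show ?case using F by (intro proj_eq) auto
  qed
  ultimately have "((\<lambda>h. (R h z - z) /\<^sub>R h) \<longlongrightarrow> proj F (G z)) (at_right 0)"
    by (rule Lim_transform_eventually)
  then have "G z = proj F (G z)" by (rule tendsto_unique[OF trivial_limit_at_right_real lim])
  then show ?thesis using proj_in_span[of F "G z"] F by simp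
qed

text \<open>The averages of the orbits in \<open>M\<close> lie in \<open>M\<close> and in \<open>D(A\<^sup>*)\<close> and approximate every vector of \<open>M\<close>.
  Hence \<open>M \<inter> D\<close> is dense in \<open>M\<close>, which forces equality in finite dimension.\<close>

lemma invariant_subspace_in_D:
  assumes F: "finite F" "orthonormal F" "cspan F = M"
    and inv: "\<And>z h. z \<in> M \<Longrightarrow> 0 \<le> h \<Longrightarrow> R h z \<in> M"
    and card: "\<And>F'. finite F' \<Longrightarrow> F' \<subseteq> M \<inter> D \<Longrightarrow> orthonormal F' \<Longrightarrow> card F' \<le> k"
  shows "M \<subseteq> D"
proof
  fix x assume x: "x \<in> M"
  have M: "complex_vector.subspace M" using F(3) complex_vector.subspace_span by blast
  obtain F' where F': "finite F'" "orthonormal F'" "cspan F' = M \<inter> D"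
    using exists_orthonormal_basis[OF complex_vector.subspace_inter[OF M D_subspace] card] by blast
  define y where "y = x - proj F' x"
  have pM: "proj F' x \<in> M \<inter> D" using proj_in_span[of F' x] F'(3) by simp
  then have y: "y \<in> M" unfolding y_def by (intro complex_vector.subspace_diff[OF M] x) simp
  have perp: "cinner y w = 0" if "w \<in> M \<inter> D" for w
    unfolding y_def by (rule residual_orthogonal[OF F'(1,2)]) (use that F' in simp)
  have J: "adjoint.J h y /\<^sub>R h \<in> M \<inter> D" if h: "0 < h" for h
  proof -
    have "proj F (adjoint.J h y) = integral {0..h} (proj F \<circ> (\<lambda>s. R s y))"
      unfolding adjoint.J_def
      by (rule integral_linear[OF adjoint.integrable bounded_linear_proj, symmetric]) simp
    also have "\<dots> = adjoint.J h y"
      unfolding adjoint.J_def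
    proof (rule Henstock_Kurzweil_Integration.integral_cong)
      fix s assume "s \<in> {0..h}"
      then have "R s y \<in> cspan F" using inv[OF y, of s] F(3) by simp
      then show "(proj F \<circ> (\<lambda>s. R s y)) s = R s y" using proj_eq[OF F(1,2)] by simp
    qed
    finally have "adjoint.J h y \<in> M" using proj_in_span[of F "adjoint.J h y"] F(3) by simp
    moreover have "adjoint.J h y \<in> D"
      using adjoint.generator_J[of h y] h by (auto simp: generator_R D_def)
    ultimately show ?thesis unfolding scaleR_scaleC
      by (intro IntI complex_vector.subspace_scale[OF M] D_scaleC)
  qed
  have "((\<lambda>h. cinner y (adjoint.J h y /\<^sub>R h)) \<longlongrightarrow> cinner y y) (at_right 0)"
    by (rule tendsto_cinner[OF tendsto_const adjoint.J_average])
  moreover have "\<forall>\<^sub>F h in at_right 0. cinner y (adjoint.J h y /\<^sub>R h) = 0"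
    using eventually_at_right_less[of "0::real"] by eventually_elim (rule perp[OF J])
  ultimately have "((\<lambda>h::real. 0) \<longlongrightarrow> cinner y y) (at_right 0)"
    by (rule Lim_transform_eventually)
  then have "cinner y y = 0" by (simp add: tendsto_const_iff)
  then show "x \<in> D" using pM by (simp add: y_def)
qed

end

locale weakly_observable = admissible_system S B
  for S :: "real \<Rightarrow> 'h::complex_hilbert \<Rightarrow> 'h" and B :: "'u::complex_hilbert \<Rightarrow> 'h \<Rightarrow> complex" +
  fixes P :: "'h \<Rightarrow> 'v::complex_banach" and T0 \<alpha> :: real
  assumes P: "compact_operator P" and T0: "T0 > 0" and \<alpha>: "\<alpha> > 0"
    and obs: "\<And>z. z \<in> D \<Longrightarrow> \<alpha> * (norm z)\<^sup>2 \<le> energy T0 z + (norm (P z))\<^sup>2"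
begin

lemma bounded_linear_P: "bounded_linear P"
  using P by (simp add: compact_operator_def bounded_clinear_def)

text \<open>The energies of the approximating states tend to \<open>0\<close> in the observability inequality.\<close>

lemma output_kernel_norm_le:
  assumes z: "z \<in> output_kernel T0" shows "\<alpha> * (norm z)\<^sup>2 \<le> (norm (P z))\<^sup>2"
proof -
  obtain v where v: "\<And>n. v n \<in> D" "v \<longlonglongrightarrow> z" "(\<lambda>n. energy T0 (v n)) \<longlonglongrightarrow> 0" by (rule output_kernelE[OF z], rule that)
  have "(\<lambda>n. \<alpha> * (norm (v n))\<^sup>2) \<longlonglongrightarrow> \<alpha> * (norm z)\<^sup>2"
    by (intro tendsto_mult tendsto_const tendsto_power tendsto_norm v)
  moreover have "(\<lambda>n. energy T0 (v n) + (norm (P (v n)))\<^sup>2) \<longlonglongrightarrow> 0 + (norm (P z))\<^sup>2"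
    by (intro tendsto_add tendsto_power tendsto_norm v bounded_linear.tendsto[OF bounded_linear_P])
  ultimately have "\<alpha> * (norm z)\<^sup>2 \<le> 0 + (norm (P z))\<^sup>2"
    by (rule LIMSEQ_le) (use obs[OF v(1)] in auto)
  then show ?thesis by simp
qed

definition dim_bound :: nat where
  "dim_bound = (SOME k. \<forall>F. finite F \<and> F \<subseteq> output_kernel T0 \<and> orthonormal F \<longrightarrow> card F \<le> k)"

lemma card_le_dim_bound: "finite F \<Longrightarrow> F \<subseteq> output_kernel T0 \<Longrightarrow> orthonormal F \<Longrightarrow> card F \<le> dim_bound"
  using someI_ex[OF orthonormal_card_bound[OF P \<alpha> output_kernel_subspace output_kernel_norm_le]]
  unfolding dim_bound_def by blast

lemma subspace_of_output_kernel_basis: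
  assumes "complex_vector.subspace M" "M \<subseteq> output_kernel T0"
  shows "\<exists>F. finite F \<and> orthonormal F \<and> cspan F = M"
  by (rule exists_orthonormal_basis[OF assms(1)]) (use assms(2) card_le_dim_bound in blast)

text \<open>The spaces \<open>output_kernel r\<close> decrease with \<open>r\<close> and have finite dimension, so that they are constant
  on some interval to the left of \<open>T\<close>; a space that is reached by shifting itself is invariant.\<close>

lemma output_kernel_eq_on_interval:
  assumes T: "T0 < T"
  obtains r where "T0 \<le> r" "r < T" "\<And>r'. r \<le> r' \<Longrightarrow> r' < T \<Longrightarrow> output_kernel r' = output_kernel r"
proof -
  let ?Q = "\<lambda>k. \<exists>r F. T0 \<le> r \<and> r < T \<and> finite F \<and> complex_vector.independent F \<and> cspan F = output_kernel r \<and> card F = k"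
  have basis: "\<exists>F. finite F \<and> complex_vector.independent F \<and> cspan F = output_kernel r" if "T0 \<le> r" for r
    using subspace_of_output_kernel_basis[OF output_kernel_subspace output_kernel_antimono[OF that]] orthonormal_independent by blast
  have "\<exists>k. ?Q k" using basis[of T0] T by auto
  then have "?Q (LEAST k. ?Q k)" by (rule LeastI_ex)
  then obtain r F where r: "T0 \<le> r" "r < T" and F: "finite F" "complex_vector.independent F"
      "cspan F = output_kernel r" "card F = (LEAST k. ?Q k)" by blast
  show thesis
  proof (rule that[OF r])
    fix r' assume r': "r \<le> r'" "r' < T"
    have sub: "output_kernel r' \<subseteq> output_kernel r" by (rule output_kernel_antimono[OF r'(1)])
    obtain F' where F': "finite F'" "complex_vector.independent F'" "cspan F' = output_kernel r'"
      using basis[of r'] r r' by auto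
    have "?Q (card F')" using r r' F' by (intro exI[of _ r'] exI[of _ F']) auto
    then have card: "card F \<le> card F'" unfolding F(4) by (rule Least_le)
    have "output_kernel r \<subseteq> output_kernel r'"
    proof (rule ccontr)
      assume "\<not> ?thesis"
      then obtain x where x: "x \<in> output_kernel r" "x \<notin> cspan F'" using F'(3) by blast
      have "complex_vector.independent (insert x F')"
        using complex_vector.independent_insertI[OF x(2) F'(2)] .
      moreover have "insert x F' \<subseteq> cspan F"
        using x(1) sub complex_vector.span_superset[of F'] F(3) F'(3) by auto
      ultimately have "card (insert x F') \<le> card F"
        using complex_vector.independent_span_bound[OF F(1)] by blast
      moreover have "x \<notin> F'" using x(2) complex_vector.span_base by blast
      ultimately show False using card F'(1) by simp
    qed
    with sub show "output_kernel r' = output_kernel r" by blast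
  qed
qed

text \<open>On the interval where \<open>output_kernel\<close> does not change, \<open>R h\<close> maps the space \<open>M\<close> to itself for small
\<open>h\<close>, hence for all \<open>h\<close>. So \<open>M\<close> lies in \<open>D(A\<^sup>*)\<close>, and for \<open>z \<in> M\<close> the output at time \<open>t\<close> is the output
of \<open>R t z \<in> M\<close> at time \<open>0\<close>, which vanishes.\<close>

lemma output_kernel_eq_unobservable:
  assumes T: "T0 < T" shows "output_kernel T = unobservable"
proof
  show "unobservable \<subseteq> output_kernel T" by (rule unobservable_subset_output_kernel)
  obtain r where r: "T0 \<le> r" "r < T" "\<And>r'. r \<le> r' \<Longrightarrow> r' < T \<Longrightarrow> output_kernel r' = output_kernel r"
    by (rule output_kernel_eq_on_interval[OF T], rule that)
  define s where "s = (r + T) / 2"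
  have s: "r < s" "s < T" using r(2) by (simp_all add: s_def)
  define M where "M = output_kernel s"
  have small: "R h z \<in> M" if "z \<in> M" "0 \<le> h" "h \<le> s - r" for z h
  proof -
    have "R h z \<in> output_kernel (s - h)" using that r(1) T0 by (intro R_output_kernel) (auto simp: M_def)
    then show ?thesis using r(3)[of "s - h"] r(3)[of s] that s by (simp add: M_def)
  qed
  have iter: "R h z \<in> M" if "z \<in> M" "0 \<le> h" "h \<le> real n * (s - r)" for n z h
    using that
  proof (induction n arbitrary: h)
    case 0
    then show ?case by simp
  next
    case (Suc n)
    show ?case
    proof (cases "h \<le> s - r")
      case True
      then show ?thesis using small Suc.prems by blast
    next
      case False
      have "h \<le> real n * (s - r) + (s - r)"
        using Suc.prems(3) by (simp only: of_nat_Suc distrib_right mult_1 add.commute)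
      then have "R (h - (s - r)) z \<in> M"
        using False by (intro Suc.IH[OF Suc.prems(1)]) linarith+
      then have "R (s - r) (R (h - (s - r)) z) \<in> M" by (rule small) (use s in auto)
      then show ?thesis using False s adjoint.add[of "s - r" "h - (s - r)" z] by simp
    qed
  qed
  have inv: "R h z \<in> M" if "z \<in> M" "0 \<le> h" for z h
  proof -
    obtain n where "h / (s - r) \<le> real n" using real_arch_simple by blast
    then have "h \<le> real n * (s - r)" using s by (simp only: pos_divide_le_eq diff_gt_0_iff_gt)
    then show ?thesis by (rule iter[OF that])
  qed
  have MT0: "M \<subseteq> output_kernel T0" unfolding M_def using r s by (intro output_kernel_antimono) simp
  obtain F where F: "finite F" "orthonormal F" "cspan F = M"
    using subspace_of_output_kernel_basis[OF output_kernel_subspace MT0[unfolded M_def]] unfolding M_def by blast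
  have MD: "M \<subseteq> D"
    by (rule invariant_subspace_in_D[OF F inv, of dim_bound]) (use MT0 card_le_dim_bound in blast)+
  have "C (R t z) = 0" if z: "z \<in> M" and t: "0 \<le> t" for z t
  proof -
    have "R t z \<in> M" by (rule inv[OF z t])
    then have "C (R 0 (R t z)) = 0"
      using MD r(1) s T0 by (intro output_kernel_output_eq_0[of _ s]) (auto simp: M_def)
    then show ?thesis by simp
  qed
  then have "M \<subseteq> unobservable" using MD by (auto simp: unobservable_def)
  moreover have "output_kernel T \<subseteq> M" unfolding M_def using s by (intro output_kernel_antimono) simp
  ultimately show "output_kernel T \<subseteq> unobservable" by blast
qed

lemma unobservable_basis: "\<exists>F. finite F \<and> orthonormal F \<and> cspan F = unobservable"
  by (rule subspace_of_output_kernel_basis[OF unobservable_subspace unobservable_subset_output_kernel])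

text \<open>Otherwise there are unit vectors orthogonal to the unobservable space with energies tending to
  \<open>0\<close>. Along a subsequence their images under \<open>P\<close> converge, and then the observability inequality makes
  the vectors themselves a Cauchy sequence. Their limit is a unit vector in \<open>output_kernel T\<close>, which is
  the unobservable space, and at the same time orthogonal to it.\<close>

lemma observability_on_complement:
  assumes T: "T0 < T"
  shows "\<exists>c>0. \<forall>w\<in>D. (\<forall>z\<in>unobservable. cinner w z = 0) \<longrightarrow> (norm w)\<^sup>2 \<le> c * energy T w"
proof (rule ccontr)
  assume neg: "\<not> ?thesis"
  have "\<forall>n. \<exists>w. w \<in> D \<and> (\<forall>z\<in>unobservable. cinner w z = 0) \<and> norm w = 1 \<and> energy T w \<le> inverse (real (Suc n))"
  proof
    fix n
    obtain w where w: "w \<in> D" "\<forall>z\<in>unobservable. cinner w z = 0" "real (Suc n) * energy T w < (norm w)\<^sup>2"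
      using neg by (metis not_le of_nat_0_less_iff zero_less_Suc)
    have "0 \<le> real (Suc n) * energy T w" using energy_nonneg by (intro mult_nonneg_nonneg) auto
    then have nw: "norm w > 0" using w(3) by (cases "w = 0") auto
    define v where "v = complex_of_real (inverse (norm w)) *\<^sub>C w"
    have "energy T v = (inverse (norm w))\<^sup>2 * energy T w"
      unfolding v_def energy_scaleC[OF w(1)] by (simp add: norm_inverse)
    also have "\<dots> \<le> inverse (real (Suc n))"
      using w(3) nw by (simp add: field_simps power2_eq_square)
    finally have "energy T v \<le> inverse (real (Suc n))" .
    moreover have "norm v = 1" using nw by (simp add: v_def norm_scaleC norm_inverse)
    moreover have "v \<in> D" unfolding v_def by (rule D_scaleC[OF w(1)])
    moreover have "\<forall>z\<in>unobservable. cinner v z = 0" using w(2) by (simp add: v_def cinner_scaleC_left)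
    ultimately show "\<exists>w. w \<in> D \<and> (\<forall>z\<in>unobservable. cinner w z = 0) \<and> norm w = 1 \<and> energy T w \<le> inverse (real (Suc n))"
      by blast
  qed
  from choice[OF this] obtain w where w: "\<And>n. w n \<in> D" "\<And>n z. z \<in> unobservable \<Longrightarrow> cinner (w n) z = 0"
      "\<And>n. norm (w n) = 1" "\<And>n. energy T (w n) \<le> inverse (real (Suc n))" by blast
  interpret P: bounded_linear P by (rule bounded_linear_P)
  have comp: "compact (closure (P ` cball 0 1))" using P by (simp add: compact_operator_def)
  have "P (w n) \<in> closure (P ` cball 0 1)" for n
    by (rule closure_subset[THEN subsetD], rule imageI) (simp add: w(3))
  then obtain l q where q: "strict_mono q" "((\<lambda>n. P (w n)) \<circ> q) \<longlonglongrightarrow> l"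
    using comp unfolding compact_def by (metis (no_types, lifting))
  define v where "v n = w (q n)" for n
  have v: "\<And>n. v n \<in> D" "\<And>n z. z \<in> unobservable \<Longrightarrow> cinner (v n) z = 0" "\<And>n. norm (v n) = 1"
    unfolding v_def using w by auto
  have e0: "(\<lambda>n. energy T (v n)) \<longlonglongrightarrow> 0"
  proof (rule energy_tendsto_0_if_le)
    show "energy T (v n) \<le> inverse (real (Suc n))" for n
    proof -
      have "energy T (v n) \<le> inverse (real (Suc (q n)))" unfolding v_def by (rule w(4))
      also have "\<dots> \<le> inverse (real (Suc n))"
        using seq_suble[OF q(1), of n] by (intro le_imp_inverse_le) auto
      finally show ?thesis .
    qed
  qed (rule LIMSEQ_inverse_real_of_nat)
  have CP: "Cauchy (\<lambda>n. P (v n))"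
    using LIMSEQ_imp_Cauchy[OF q(2)] by (simp add: v_def o_def)
  have "Cauchy v"
  proof (rule metric_CauchyI)
    fix e :: real assume e: "e > 0"
    define d where "d = \<alpha> * e\<^sup>2 / 8"
    have d: "d > 0" using e \<alpha> by (simp add: d_def)
    obtain n1 where n1: "\<And>n. n \<ge> n1 \<Longrightarrow> energy T (v n) < d"
      using order_tendstoD(2)[OF e0 d] unfolding eventually_sequentially by blast
    obtain n2 where n2: "\<And>m n. m \<ge> n2 \<Longrightarrow> n \<ge> n2 \<Longrightarrow> dist (P (v m)) (P (v n)) < sqrt d"
      using metric_CauchyD[OF CP, of "sqrt d"] d by auto
    have "dist (v m) (v n) < e" if "m \<ge> max n1 n2" "n \<ge> max n1 n2" for m n
    proof -
      have "\<alpha> * (norm (v m - v n))\<^sup>2 \<le> energy T0 (v m - v n) + (norm (P (v m - v n)))\<^sup>2"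
        by (rule obs[OF D_diff[OF v(1) v(1)]])
      also have "energy T0 (v m - v n) \<le> energy T (v m - v n)"
        using T by (intro energy_mono D_diff v) simp
      also have "\<dots> \<le> 2 * energy T (v m) + 2 * energy T (v n)" by (rule energy_diff_le[OF v(1) v(1)])
      finally have 1: "\<alpha> * (norm (v m - v n))\<^sup>2 \<le> 2 * energy T (v m) + 2 * energy T (v n) + (norm (P (v m - v n)))\<^sup>2"
        by simp
      have "(norm (P (v m - v n)))\<^sup>2 < (sqrt d)\<^sup>2"
        using n2[of m n] that by (intro power_strict_mono) (auto simp: dist_norm P.diff)
      then have "(norm (P (v m - v n)))\<^sup>2 < d" using d by simp
      with 1 n1[of m] n1[of n] that have "\<alpha> * (norm (v m - v n))\<^sup>2 < 8 * d" using d by simp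
      then have "\<alpha> * (norm (v m - v n))\<^sup>2 < \<alpha> * e\<^sup>2" by (simp add: d_def)
      then have "(norm (v m - v n))\<^sup>2 < e\<^sup>2" using \<alpha> by simp
      then have "norm (v m - v n) < e" using e by (auto intro: power2_less_imp_less)
      then show ?thesis by (simp add: dist_norm)
    qed
    then show "\<exists>k. \<forall>m\<ge>k. \<forall>n\<ge>k. dist (v m) (v n) < e" by blast
  qed
  then obtain x where x: "v \<longlonglongrightarrow> x" using Cauchy_convergent convergent_def by blast
  have "x \<in> unobservable" unfolding output_kernel_eq_unobservable[OF T, symmetric] by (rule output_kernelI[OF v(1) x e0])
  then have "(\<lambda>n. cinner (v n) x) \<longlonglongrightarrow> 0" using v(2) by simp
  moreover have "(\<lambda>n. cinner (v n) x) \<longlonglongrightarrow> cinner x x" by (rule tendsto_cinner[OF x tendsto_const])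
  ultimately have "cinner x x = 0" using LIMSEQ_unique by blast
  then have "x = 0" by simp
  have "(\<lambda>n. norm (v n)) \<longlonglongrightarrow> norm x" by (rule tendsto_norm[OF x])
  then have "(\<lambda>n::nat. 1) \<longlonglongrightarrow> norm x" by (simp only: v(3))
  then have "norm x = 1" by (simp only: LIMSEQ_const_iff)
  with \<open>x = 0\<close> show False by simp
qed

text \<open>A reachable state is orthogonal to the states without output. If \<open>y\<close> is orthogonal to them, the
unobservable part of \<open>w\<close> can be removed without changing \<open>\<langle>y, w\<rangle>\<close> or the energy of \<open>w\<close>; the inequality on
the complement then bounds \<open>\<langle>y, w\<rangle>\<close> by the energy.\<close>

lemma input_map_range:
  assumes T: "T0 < T"
  shows "input_map A S B T ` L2 {0<..} = orth_compl unobservable"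
proof (intro set_eqI iffI)
  have T': "0 < T" using T T0 by simp
  fix y assume "y \<in> input_map A S B T ` L2 {0<..}"
  then obtain u where u: "u \<in> L2 {0<..}" "y = input_map A S B T u" by blast
  have st: "steers T u y" unfolding u(2) by (rule steers_input_map[OF u(1)]) (use T' in simp)
  have "cinner y z = 0" if z: "z \<in> unobservable" for z
  proof -
    have "cinner y z = (LINT s|lebesgue_on {0<..<T}. cinner (u s) (C (R (T - s) z)))"
      using st unobservable_in_D[OF z] by (simp add: steers_def)
    also have "\<dots> = (LINT s|lebesgue_on {0<..<T}. 0)"
      using z by (intro Bochner_Integration.integral_cong) (auto simp: unobservable_def)
    finally show ?thesis by simp
  qed
  then show "y \<in> orth_compl unobservable" by (simp add: orth_compl_def)
next
  fix y assume "y \<in> orth_compl unobservable"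
  then have y: "cinner y z = 0" if "z \<in> unobservable" for z using that by (simp add: orth_compl_def)
  obtain F where F: "finite F" "orthonormal F" "cspan F = unobservable" using unobservable_basis by blast
  obtain c where c: "c > 0" "\<And>w. w \<in> D \<Longrightarrow> (\<And>z. z \<in> unobservable \<Longrightarrow> cinner w z = 0) \<Longrightarrow> (norm w)\<^sup>2 \<le> c * energy T w"
    using observability_on_complement[OF T] by blast
  define K where "K = (norm y)\<^sup>2 * c + 1"
  have K: "K > 0" unfolding K_def using c(1) by (intro add_nonneg_pos) auto
  have "(inner y w)\<^sup>2 \<le> K * energy T w" if w: "w \<in> D" for w
  proof -
    define p where "p = proj F w"
    have p: "p \<in> unobservable" unfolding p_def using proj_in_span F(3) by blast
    have wp: "w - p \<in> D" by (rule D_diff[OF w unobservable_in_D[OF p]])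
    have "energy T (w - p) = energy T w"
      unfolding energy_def
    proof (rule Henstock_Kurzweil_Integration.integral_cong)
      fix t assume t: "t \<in> {0..T}"
      have "C (R t p) = 0" using p t by (simp add: unobservable_def)
      then show "(norm (C (R t (w - p))))\<^sup>2 = (norm (C (R t w)))\<^sup>2"
        using t R_in_D[OF w, of t] R_in_D[OF unobservable_in_D[OF p], of t] by (simp add: R_diff C_diff)
    qed
    moreover have "(norm (w - p))\<^sup>2 \<le> c * energy T (w - p)"
    proof (rule c(2)[OF wp])
      show "cinner (w - p) z = 0" if "z \<in> unobservable" for z
        unfolding p_def by (rule residual_orthogonal[OF F(1,2)]) (use that F(3) in simp)
    qed
    ultimately have le: "(norm (w - p))\<^sup>2 \<le> c * energy T w" by simp
    have "inner y p = 0" using y[OF p] by (metis Re_cinner zero_complex.sel(1))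
    then have "inner y w = inner y (w - p)" by (simp add: inner_diff_right)
    then have "\<bar>inner y w\<bar> \<le> norm y * norm (w - p)" by (simp add: Cauchy_Schwarz_ineq2)
    then have "\<bar>inner y w\<bar>\<^sup>2 \<le> (norm y * norm (w - p))\<^sup>2" by (intro power_mono) auto
    also have "\<dots> \<le> (norm y)\<^sup>2 * (c * energy T w)"
      unfolding power_mult_distrib by (intro mult_left_mono le) simp
    also have "\<dots> \<le> K * energy T w" using energy_nonneg[of T w] by (simp add: K_def algebra_simps)
    finally show ?thesis by simp
  qed
  then obtain u where "u \<in> L2 {0<..}" "steers T u y" using steers_if_energy_bound[OF K] by blast
  then show "y \<in> input_map A S B T ` L2 {0<..}" using input_map_eq by blast
qed

end

section \<open>Generalised eigenspaces of the unobservable subspace\<close>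

lemma map_comp_assoc: "(f \<circ>\<^sub>m g) \<circ>\<^sub>m h = f \<circ>\<^sub>m (g \<circ>\<^sub>m h)"
  by (rule ext) (simp add: map_comp_def split: option.split)

lemma op_power_Suc_right: "op_power R (Suc m) = op_power R m \<circ>\<^sub>m R"
proof (induction m)
  case 0
  show ?case by (rule ext) (simp add: map_comp_def split: option.split)
next
  case (Suc m)
  have "op_power R (Suc (Suc m)) = R \<circ>\<^sub>m (op_power R m \<circ>\<^sub>m R)"
    unfolding Suc[symmetric] by simp
  then show ?case by (simp add: map_comp_assoc)
qed

lemma bounded_bilinear_scaleC:
  "bounded_bilinear (scaleC :: complex \<Rightarrow> 'a::complex_normed_vector \<Rightarrow> 'a)"
proof
  show "\<exists>K. \<forall>a (b::'a). norm (a *\<^sub>C b) \<le> norm a * norm b * K"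
    by (rule exI[of _ 1]) (simp add: norm_scaleC)
qed (simp_all add: scaleC_add_left scaleC_add_right scaleR_scaleC scaleC_scaleC scaleC_complex_def mult.commute)

context admissible_system
begin

text \<open>The curve \<open>exp (- c t) R t z\<close> has the derivative \<open>- exp (- c t) R t (c z - G z)\<close>, which stays in the
unobservable space. Hence its component orthogonal to this space is constant, so that the curve
differs from \<open>z\<close> only by unobservable states and its output is a multiple of \<open>C z = 0\<close>.\<close>

lemma in_unobservable_if_shift_in_unobservable:
  assumes F: "finite F" "orthonormal F" "cspan F = unobservable"
    and z: "z \<in> D" and Cz: "C z = 0" and w: "c *\<^sub>C z - G z \<in> unobservable"
  shows "z \<in> unobservable"
proof -
  define e where "e t = exp (t *\<^sub>R (- c))" for t :: real
  have "C (R t z) = 0" if t: "0 \<le> t" for t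
  proof -
    have deriv: "((\<lambda>s. e s *\<^sub>C R s z - proj F (e s *\<^sub>C R s z)) has_vector_derivative 0) (at s within {0..t})"
      if s: "s \<in> {0..t}" for s
    proof -
      have "generator R z = Some (G z)" by (simp add: generator_R adj_eq_G z)
      then have "((\<lambda>u. R u z) has_vector_derivative R s (G z)) (at s within {0..t})"
        using s by (intro adjoint.has_derivative_on_domain) auto
      moreover have "(e has_vector_derivative e s * (- c)) (at s within {0..t})"
        unfolding e_def by (rule exp_scaleR_has_vector_derivative_right)
      ultimately have "((\<lambda>u. e u *\<^sub>C R u z) has_vector_derivative
          (e s *\<^sub>C R s (G z) + (e s * (- c)) *\<^sub>C R s z)) (at s within {0..t})"
        by (intro bounded_bilinear.has_vector_derivative[OF bounded_bilinear_scaleC])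
      moreover have "e s *\<^sub>C R s (G z) + (e s * (- c)) *\<^sub>C R s z = - e s *\<^sub>C R s (c *\<^sub>C z - G z)"
        using s by (simp add: R_diff R_scaleC scaleC_diff_right scaleC_scaleC
            complex_vector.scale_minus_left)
      ultimately have d: "((\<lambda>u. e u *\<^sub>C R u z) has_vector_derivative - e s *\<^sub>C R s (c *\<^sub>C z - G z)) (at s within {0..t})"
        by simp
      have "- e s *\<^sub>C R s (c *\<^sub>C z - G z) \<in> cspan F"
        unfolding F(3) using s by (intro complex_vector.subspace_scale[OF unobservable_subspace] R_unobservable w) auto
      then have p: "proj F (- e s *\<^sub>C R s (c *\<^sub>C z - G z)) = - e s *\<^sub>C R s (c *\<^sub>C z - G z)"
        by (rule proj_eq[OF F(1,2)])
      have "((\<lambda>u. e u *\<^sub>C R u z - proj F (e u *\<^sub>C R u z)) has_vector_derivative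
          - e s *\<^sub>C R s (c *\<^sub>C z - G z) - proj F (- e s *\<^sub>C R s (c *\<^sub>C z - G z))) (at s within {0..t})"
        by (intro has_vector_derivative_diff d bounded_linear.has_vector_derivative[OF bounded_linear_proj])
      then show ?thesis unfolding p by simp
    qed
    obtain k where k: "\<And>s. s \<in> {0..t} \<Longrightarrow> e s *\<^sub>C R s z - proj F (e s *\<^sub>C R s z) = k"
      by (rule has_vector_derivative_zero_constant[OF convex_closed_interval deriv], assumption, rule that)
    have "e t *\<^sub>C R t z - proj F (e t *\<^sub>C R t z) = e 0 *\<^sub>C R 0 z - proj F (e 0 *\<^sub>C R 0 z)"
      using k[of t] k[of 0] t by simp
    then have eq: "e t *\<^sub>C R t z = z + (proj F (e t *\<^sub>C R t z) - proj F z)"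
      by (simp add: e_def algebra_simps)
    have pN: "proj F v \<in> unobservable" for v using proj_in_span F(3) by blast
    have diffN: "proj F (e t *\<^sub>C R t z) - proj F z \<in> unobservable"
      by (intro complex_vector.subspace_diff[OF unobservable_subspace] pN)
    have "e t *\<^sub>C C (R t z) = C (e t *\<^sub>C R t z)" by (simp add: C_scaleC R_in_D z t)
    also have "\<dots> = C z + C (proj F (e t *\<^sub>C R t z) - proj F z)"
      by (subst eq) (rule C_add[OF z unobservable_in_D[OF diffN]])
    also have "\<dots> = 0" by (simp add: Cz C_unobservable[OF diffN])
    finally show ?thesis by (simp add: complex_vector.scale_eq_0_iff e_def)
  qed
  then show ?thesis using z by (simp add: unobservable_def)
qed

lemma shift_op_on_D: "z \<in> D \<Longrightarrow> shift_op c (adj A) z = Some (c *\<^sub>C z - G z)"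
  by (simp add: shift_op_def adj_eq_G)

lemma control_adj_eq_Some_0: "control_adj A B z = Some 0 \<longleftrightarrow> z \<in> D \<and> C z = 0"
  by (cases "z \<in> D") (auto simp: control_adj_eq, auto simp: control_adj_def D_def split: if_splits)

text \<open>Induction on the order of the generalised eigenvector: \<open>c z - A\<^sup>* z\<close> has smaller order.\<close>

lemma E_space_subset_unobservable:
  assumes F: "finite F" "orthonormal F" "cspan F = unobservable"
  shows "E_space A B c \<subseteq> unobservable"
proof
  fix z assume "z \<in> E_space A B c"
  then obtain m where "op_power (shift_op c (adj A)) m z = Some 0"
      "\<And>k. (control_adj A B \<circ>\<^sub>m op_power (shift_op c (adj A)) k) z = Some 0"
    unfolding E_space_def ker_def by blast
  then show "z \<in> unobservable"
  proof (induction m arbitrary: z)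
    case 0
    then show ?case using complex_vector.subspace_0[OF unobservable_subspace] by simp
  next
    case (Suc m)
    have "control_adj A B z = Some 0" using Suc.prems(2)[of 0] by simp
    then have z: "z \<in> D" "C z = 0" by (simp_all add: control_adj_eq_Some_0)
    have "op_power (shift_op c (adj A)) m (c *\<^sub>C z - G z) = Some 0"
      using Suc.prems(1) unfolding op_power_Suc_right by (simp add: shift_op_on_D z(1))
    moreover have "(control_adj A B \<circ>\<^sub>m op_power (shift_op c (adj A)) k) (c *\<^sub>C z - G z) = Some 0" for k
      using Suc.prems(2)[of "Suc k"] unfolding op_power_Suc_right map_comp_assoc[symmetric]
      by (simp add: shift_op_on_D z(1))
    ultimately have "c *\<^sub>C z - G z \<in> unobservable" by (rule Suc.IH)
    then show ?case by (rule in_unobservable_if_shift_in_unobservable[OF F z])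
  qed
qed

lemma ker_inter_ker:
  "z \<in> ker (shift_op c (adj A)) \<inter> ker (control_adj A B) \<longleftrightarrow> z \<in> D \<and> C z = 0 \<and> c *\<^sub>C z - G z = 0"
  unfolding ker_def by (auto simp: control_adj_eq_Some_0 shift_op_on_D)

end

context weakly_observable
begin

text \<open>The operator \<open>A\<^sup>*\<close>, preceded by the projection onto the unobservable space, is a total linear map that
leaves this space invariant and agrees with \<open>A\<^sup>*\<close> on it. Its generalised eigenspaces are the spaces
\<open>E_space A B c\<close>; they are trivial unless \<open>c\<close> is an eigenvalue, and together they span the space.\<close>

lemma unobservable_decomposition:
  shows "finite (sigma_F A B)" and "\<forall>c. finite_dimensional (E_space A B c)"
    and "sum_is_direct (sigma_F A B) (E_space A B)"
    and "orth_compl (subspace_sum (sigma_F A B) (E_space A B)) = orth_compl unobservable"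
proof -
  obtain F where F: "finite F" "orthonormal F" "cspan F = unobservable" using unobservable_basis by blast
  define K where "K z = G (proj F z)" for z
  have pN: "proj F z \<in> unobservable" for z using proj_in_span F(3) by blast
  have KN: "K z = G z" if "z \<in> unobservable" for z using that F by (simp add: K_def proj_eq)
  interpret operator_on_subspace K unobservable
  proof
    show "K (x + y) = K x + K y" for x y
      unfolding K_def linear_add[OF bounded_linear.linear[OF bounded_linear_proj]]
      by (intro G_add unobservable_in_D pN)
    show "K (c *\<^sub>C x) = c *\<^sub>C K x" for c x
      unfolding K_def proj_scaleC by (intro G_scaleC unobservable_in_D pN)
    show "complex_vector.subspace unobservable" by (rule unobservable_subspace)
    show "K z \<in> unobservable" if "z \<in> unobservable" for z unfolding K_def by (rule G_unobservable[OF F pN])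
  qed
  have shift: "shift_op c (adj A) z = Some (X c z)" if "z \<in> unobservable" for c z
    using that by (simp add: shift_op_on_D[OF unobservable_in_D] X_def KN)
  have pow: "op_power (shift_op c (adj A)) m z = Some ((X c ^^ m) z)" if z: "z \<in> unobservable" for c z and m :: nat
    by (induction m) (simp_all add: shift Xpow_in[OF z])
  have control: "control_adj A B z = Some 0" if "z \<in> unobservable" for z
    using that by (simp add: control_adj_eq_Some_0 unobservable_in_D C_unobservable)
  have E: "E_space A B c = Gen c" for c
  proof (intro set_eqI iffI)
    fix z assume z: "z \<in> E_space A B c"
    then have zN: "z \<in> unobservable" using E_space_subset_unobservable[OF F] by blast
    from z obtain m where "op_power (shift_op c (adj A)) m z = Some 0"
      unfolding E_space_def ker_def by blast
    then have "(X c ^^ m) z = 0" unfolding pow[OF zN] by simp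
    with zN show "z \<in> Gen c" unfolding Gen_def by blast
  next
    fix z assume "z \<in> Gen c"
    then obtain m where z: "z \<in> unobservable" "(X c ^^ m) z = 0" by (auto simp: Gen_def)
    have "(X c ^^ Suc m) z = 0" by (rule Xpow_mono[OF z(2)]) simp
    then have "z \<in> ker (op_power (shift_op c (adj A)) (Suc m))"
      unfolding ker_def mem_Collect_eq pow[OF z(1)] by simp
    moreover have "(control_adj A B \<circ>\<^sub>m op_power (shift_op c (adj A)) k) z = Some 0" for k
      using pow[OF z(1), of c k] control[OF Xpow_in[OF z(1)]] by simp
    moreover have "Suc m \<in> {1..}" by simp
    ultimately show "z \<in> E_space A B c" unfolding E_space_def by blast
  qed
  have sigma: "sigma_F A B = {c. \<exists>z\<in>unobservable. z \<noteq> 0 \<and> X c z = 0}"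
  proof (intro set_eqI iffI)
    fix c assume "c \<in> sigma_F A B"
    moreover have "0 \<in> ker (shift_op c (adj A)) \<inter> ker (control_adj A B)"
      using complex_vector.subspace_0[OF unobservable_subspace] shift[of 0 c] control[of 0] by (simp add: ker_def)
    ultimately obtain z where z: "z \<in> ker (shift_op c (adj A)) \<inter> ker (control_adj A B)" "z \<noteq> 0"
      unfolding sigma_F_def by blast
    then have zD: "z \<in> D" "C z = 0" "c *\<^sub>C z - G z = 0" unfolding ker_inter_ker by blast+
    have zN: "z \<in> unobservable"
      by (rule in_unobservable_if_shift_in_unobservable[OF F zD(1,2), of c]) (simp add: zD(3) complex_vector.subspace_0[OF unobservable_subspace])
    then have "X c z = 0" using zD(3) by (simp add: X_def KN)
    with z(2) zN show "c \<in> {c. \<exists>z\<in>unobservable. z \<noteq> 0 \<and> X c z = 0}" by blast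
  next
    fix c assume "c \<in> {c. \<exists>z\<in>unobservable. z \<noteq> 0 \<and> X c z = 0}"
    then obtain z where z: "z \<in> unobservable" "z \<noteq> 0" "X c z = 0" by blast
    then have "z \<in> ker (shift_op c (adj A)) \<inter> ker (control_adj A B)"
      using shift[OF z(1), of c] control[OF z(1)] by (simp add: ker_def)
    with z(2) show "c \<in> sigma_F A B" unfolding sigma_F_def by blast
  qed
  show "finite (sigma_F A B)" unfolding sigma by (rule finite_eigenvalues[OF F(1,3)])
  show "\<forall>c. finite_dimensional (E_space A B c)"
  proof
    fix c
    have "Gen c \<subseteq> output_kernel T0" using unobservable_subset_output_kernel by (auto simp: Gen_def)
    then show "finite_dimensional (E_space A B c)"
      unfolding E finite_dimensional_def using subspace_of_output_kernel_basis[OF Gen_subspace] by metis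
  qed
  show "sum_is_direct (sigma_F A B) (E_space A B)"
    using Gen_direct[of "sigma_F A B"] unfolding sum_is_direct_def E .
  have trivial: "Gen c \<subseteq> {0}" if c: "c \<notin> sigma_F A B" for c
  proof
    fix z assume "z \<in> Gen c"
    then obtain m where z: "z \<in> unobservable" "(X c ^^ m) z = 0" by (auto simp: Gen_def)
    from z(2) have "z = 0"
    proof (induction m)
      case (Suc m)
      then have "X c ((X c ^^ m) z) = 0" by simp
      then have "(X c ^^ m) z = 0" using c Xpow_in[OF z(1), of m c] unfolding sigma by blast
      then show ?case by (rule Suc.IH)
    qed simp
    then show "z \<in> {0}" by simp
  qed
  show "orth_compl (subspace_sum (sigma_F A B) (E_space A B)) = orth_compl unobservable"
  proof (intro set_eqI iffI)
    fix x assume x: "x \<in> orth_compl (subspace_sum (sigma_F A B) (E_space A B))"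
    have perp: "cinner x e = 0" if e: "e \<in> (\<Union>c. Gen c)" for e
    proof -
      obtain c where e: "e \<in> Gen c" using e by blast
      show ?thesis
      proof (cases "c \<in> sigma_F A B")
        case True
        have "(\<Sum>i\<in>{c}. e) \<in> subspace_sum (sigma_F A B) (E_space A B)"
          unfolding subspace_sum_def mem_Collect_eq
          by (rule exI[of _ "{c}"], rule exI[of _ "\<lambda>_. e"]) (use True e in \<open>simp add: E\<close>)
        then show ?thesis using x by (simp add: orth_compl_def)
      next
        case False
        then have "e = 0" using trivial[of c] e by blast
        then show ?thesis by simp
      qed
    qed
    have "cinner x y = 0" if "y \<in> unobservable" for y
      by (rule orthogonal_span[OF perp]) (use that span_Gen[OF F(1,3)] in blast)+
    then show "x \<in> orth_compl unobservable" by (simp add: orth_compl_def)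
  next
    fix x assume x: "x \<in> orth_compl unobservable"
    have "y \<in> unobservable" if y: "y \<in> subspace_sum (sigma_F A B) (E_space A B)" for y
    proof -
      obtain J z where y: "y = (\<Sum>i\<in>J. z i)" "\<forall>i\<in>J. z i \<in> E_space A B i"
        using y unfolding subspace_sum_def by blast
      show ?thesis unfolding y(1)
        using y(2) E_space_subset_unobservable[OF F] by (intro complex_vector.subspace_sum[OF unobservable_subspace]) blast
    qed
    with x show "x \<in> orth_compl (subspace_sum (sigma_F A B) (E_space A B))"
      unfolding orth_compl_def by blast
  qed
qed

text \<open>Cutting off a control at \<open>T\<close> does not change the state that it reaches at time \<open>T\<close>.\<close>

lemma exactly_controllable_if_onto:
  assumes T: "T0 < T" and onto: "input_map A S B T ` L2 {0<..} = UNIV"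
  shows "exactly_controllable A S B T"
  unfolding exactly_controllable_def trajectory_def
proof (intro allI)
  fix y0 y1
  obtain u where u: "u \<in> L2 {0<..}" "y1 - S T y0 = input_map A S B T u"
    using onto by (metis UNIV_I imageE)
  let ?v = "\<lambda>s. if s \<in> {0<..<T} then u s else 0"
  have "steers T u (y1 - S T y0)"
    unfolding u(2) by (rule steers_input_map[OF u(1)]) (use T T0 in simp)
  then have "steers T ?v (y1 - S T y0)" using steers_cong[of T u ?v] by simp
  then have "input_map A S B T ?v = y1 - S T y0" by (rule input_map_eq)
  moreover have "u \<in> L2 {0<..<T}" by (rule L2_subset[OF u(1)]) auto
  ultimately show "\<exists>u\<in>L2 {0<..<T}. S T y0 + input_map A S B T (\<lambda>s. if s \<in> {0<..<T} then u s else 0) = y1"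
    by (intro bexI[of _ u]) simp_all
qed

end

theorem theorem4p1:
  fixes A :: "'h::complex_hilbert \<rightharpoonup> 'h"
    and S :: "real \<Rightarrow> 'h \<Rightarrow> 'h"
    and B :: "'u::complex_hilbert \<Rightarrow> 'h \<Rightarrow> complex"
    and P :: "'h \<Rightarrow> 'v::complex_banach"
    and T0 \<alpha> :: real
  assumes "C0_semigroup S" and "A = generator S"
    and "control_operator A B" and "admissible A S B"
    and "compact_operator P"
    and "T0 > 0" and "\<alpha> > 0"
    and "\<forall>z. \<alpha> * (norm z)\<^sup>2 \<le>
           (LINT t|lebesgue_on {0<..<T0}. (norm (input_map_adj A S B T0 z t))\<^sup>2) + (norm (P z))\<^sup>2"
  shows "finite (sigma_F A B) \<and>
         (\<forall>c. finite_dimensional (E_space A B c)) \<and>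
         sum_is_direct (sigma_F A B) (E_space A B) \<and>
         (\<forall>T>T0. input_map A S B T ` L2 {0<..} = orth_compl (subspace_sum (sigma_F A B) (E_space A B))) \<and>
         ((\<forall>c. ker (shift_op c (adj A)) \<inter> ker (control_adj A B) = {0}) \<longrightarrow>
            (\<forall>T>T0. exactly_controllable A S B T))"
proof -
  interpret sys: admissible_system S B
    by unfold_locales (use assms(1,3,4) in \<open>simp_all add: assms(2)\<close>)
  interpret weakly_observable S B P T0 \<alpha>
  proof unfold_locales
    fix z assume z: "z \<in> sys.D"
    have "\<alpha> * (norm z)\<^sup>2 \<le>
        (LINT t|lebesgue_on {0<..<T0}. (norm (input_map_adj (generator S) S B T0 z t))\<^sup>2) + (norm (P z))\<^sup>2"
      using assms(8) unfolding assms(2) by blast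
    also have "\<dots> \<le> sys.energy T0 z + (norm (P z))\<^sup>2"
      by (intro add_right_mono sys.input_map_adj_energy z assms(6))
    finally show "\<alpha> * (norm z)\<^sup>2 \<le> sys.energy T0 z + (norm (P z))\<^sup>2" .
  qed (fact assms)+
  have range: "\<forall>T>T0. input_map A S B T ` L2 {0<..} = orth_compl (subspace_sum (sigma_F A B) (E_space A B))"
    using input_map_range unobservable_decomposition(4) unfolding assms(2) by simp
  moreover have "exactly_controllable A S B T"
    if ker: "\<forall>c. ker (shift_op c (adj A)) \<inter> ker (control_adj A B) = {0}" and T: "T0 < T" for T
  proof -
    have "sigma_F A B = {}" using ker by (simp add: sigma_F_def)
    then have "subspace_sum (sigma_F A B) (E_space A B) = {0}" by (auto simp: subspace_sum_def)
    then have "orth_compl (subspace_sum (sigma_F A B) (E_space A B)) = UNIV" by (simp add: orth_compl_def)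
    then show ?thesis
      using range T exactly_controllable_if_onto[OF T] unfolding assms(2) by simp
  qed
  ultimately show ?thesis
    using unobservable_decomposition(1-3) unfolding assms(2) by blast
qed

end
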